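(* The problem Panel Crossing Minimization is NP-complete, even when restricted to instances with at most 2 tests.
   Context: A panel data instance $(S,\mathcal{C},T)$ consists of a finite set $S$ of subjects, a finite set $\mathcal{C}$ of categories, and a sequence $T$ of tests $t_0,\dots,t_m$, each a function $S\to\mathcal{C}$. Given a linear order $\sigma$ of $\mathcal{C}$, a combinatorial layout is a sequence of linear orders $\pi_0,\dots,\pi_m$ of $S$ such that $t_j(s)\prec_\sigma t_j(s')$ implies $s$ precedes $s'$ in $\pi_j$; its number of crossings is the number of pairs $(j,\{s,s'\})$, $0\le j\le m-1$, such that the relative order of $s,s'$ differs in $\pi_j$ and $\pi_{j+1}$; and $pcr(S,\mathcal{C},T,\sigma)$ is the minimum number of crossings over all combinatorial layouts. Panel Crossing Minimization: given a panel data instance $(S,\mathcal{C},T)$ and an integer $k$, decide whether there exists a linear order $\sigma$ of $\mathcal{C}$ with $pcr(S,\mathcal{C},T,\sigma)\le k$. *)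

theory Defs
  imports Main "HOL-Computational_Algebra.Polynomial"
begin

section \<open>Panel data and crossings\<close>

definition panel_data :: "'s set \<Rightarrow> 'c set \<Rightarrow> ('s \<Rightarrow> 'c) list \<Rightarrow> bool" where
  "panel_data S C T \<longleftrightarrow> finite S \<and> finite C \<and> T \<noteq> [] \<and> (\<forall>t\<in>set T. t ` S \<subseteq> C)"

text \<open>Linear orders are reflexive relations, so the strict order of \<open>\<sigma>\<close> is \<open>\<sigma> - Id\<close>.\<close>

definition layout :: "'s set \<Rightarrow> ('s \<Rightarrow> 'c) list \<Rightarrow> 'c rel \<Rightarrow> 's rel list \<Rightarrow> bool" where
  "layout S T \<sigma> \<pi> \<longleftrightarrow> length \<pi> = length T \<and>
     (\<forall>j<length T. linear_order_on S (\<pi> ! j) \<and>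
        (\<forall>s\<in>S. \<forall>s'\<in>S. ((T ! j) s, (T ! j) s') \<in> \<sigma> - Id \<longrightarrow> (s, s') \<in> \<pi> ! j - Id))"

definition crossings :: "'s set \<Rightarrow> 's rel list \<Rightarrow> nat" where
  "crossings S \<pi> = card {(j, {s, s'}) | j s s'. Suc j < length \<pi> \<and> s \<in> S \<and> s' \<in> S \<and> s \<noteq> s' \<and>
     ((s, s') \<in> \<pi> ! j) \<noteq> ((s, s') \<in> \<pi> ! Suc j)}"

definition pcr :: "'s set \<Rightarrow> ('s \<Rightarrow> 'c) list \<Rightarrow> 'c rel \<Rightarrow> nat" where
  "pcr S T \<sigma> = Inf {crossings S \<pi> | \<pi>. layout S T \<sigma> \<pi>}"

text \<open>Layouts exist, so the infimum of natural numbers above is a minimum.\<close>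

lemma layout_exists:
  assumes "panel_data S C T" and "linear_order_on C \<sigma>"
  shows "\<exists>\<pi>. layout S T \<sigma> \<pi>"
proof -
  obtain r where "well_order_on S r" using well_order_on by blast
  then have r: "linear_order_on S r" by (simp add: well_order_on_def)
  define lx where "lx t = {(s, s'). s \<in> S \<and> s' \<in> S \<and>
      ((t s, t s') \<in> \<sigma> - Id \<or> t s = t s' \<and> (s, s') \<in> r)}" for t :: "'a \<Rightarrow> 'b"
  have lin: "linear_order_on S (lx t)" if t: "t ` S \<subseteq> C" for t
    unfolding order_on_defs
  proof (intro conjI)
    show "lx t \<subseteq> S \<times> S" by (auto simp: lx_def)
    show "refl_on S (lx t)"
      using r by (auto simp: lx_def order_on_defs refl_on_def)
    show "trans (lx t)"
    proof (rule transI)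
      fix x y z assume "(x, y) \<in> lx t" "(y, z) \<in> lx t"
      moreover have "trans \<sigma>" "antisym \<sigma>" "trans r"
        using assms(2) r by (auto simp: order_on_defs)
      ultimately show "(x, z) \<in> lx t"
        unfolding lx_def by (auto dest: transD antisymD)
    qed
    show "antisym (lx t)"
      using assms(2) r unfolding lx_def antisym_def order_on_defs by auto
    show "total_on S (lx t)"
      using assms(2) r t unfolding lx_def total_on_def order_on_defs
      by (simp add: image_subset_iff) metis
  qed
  have "layout S T \<sigma> (map lx T)"
    unfolding layout_def using assms(1) lin
    by (auto simp: panel_data_def lx_def)
  then show ?thesis by blast
qed

lemma pcr_attained:
  assumes "panel_data S C T" and "linear_order_on C \<sigma>"
  shows "\<exists>\<pi>. layout S T \<sigma> \<pi> \<and> crossings S \<pi> = pcr S T \<sigma>"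
proof -
  have "{crossings S \<pi> | \<pi>. layout S T \<sigma> \<pi>} \<noteq> {}"
    using layout_exists[OF assms] by blast
  from Inf_nat_def1[OF this] show ?thesis unfolding pcr_def by auto
qed

definition panel_crossing_yes :: "'s set \<Rightarrow> 'c set \<Rightarrow> ('s \<Rightarrow> 'c) list \<Rightarrow> int \<Rightarrow> bool" where
  "panel_crossing_yes S C T k \<longleftrightarrow> (\<exists>\<sigma>. linear_order_on C \<sigma> \<and> int (pcr S T \<sigma>) \<le> k)"


section \<open>Instances as bit strings\<close>

text \<open>Up to renaming, \<open>S = {..<n}\<close> and \<open>C = {..<c}\<close>. The sizes of the two sets and the number of
  tests are written in unary, so that an encoding is at least as long as a list of the elements
  of the sets; categories and \<open>k\<close> are written in binary (least significant bit first), in blocks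
  where each bit is preceded by \<open>True\<close> and the end is marked by \<open>False\<close>.\<close>

fun binary :: "nat \<Rightarrow> bool list" where
  "binary n = (if n = 0 then [] else odd n # binary (n div 2))"

declare binary.simps [simp del]

definition enc_block :: "bool list \<Rightarrow> bool list" where
  "enc_block bs = concat (map (\<lambda>b. [True, b]) bs) @ [False]"

definition enc_nat :: "nat \<Rightarrow> bool list" where
  "enc_nat n = enc_block (binary n)"

definition enc_int :: "int \<Rightarrow> bool list" where
  "enc_int k = (k < 0) # enc_nat (nat \<bar>k\<bar>)"

definition enc_unary :: "nat \<Rightarrow> bool list" where
  "enc_unary n = replicate n True @ [False]"

definition enc_test :: "nat \<Rightarrow> (nat \<Rightarrow> nat) \<Rightarrow> bool list" where
  "enc_test n t = concat (map (\<lambda>s. enc_nat (t s)) [0..<n])"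

definition enc_instance :: "nat \<Rightarrow> nat \<Rightarrow> (nat \<Rightarrow> nat) list \<Rightarrow> int \<Rightarrow> bool list" where
  "enc_instance n c T k = enc_unary n @ enc_unary c @ enc_unary (length T) @
     concat (map (enc_test n) T) @ enc_int k"

lemma enc_block_append_inj: "enc_block bs @ u = enc_block bs' @ v \<longleftrightarrow> bs = bs' \<and> u = v"
proof (induction bs arbitrary: bs')
  case Nil
  then show ?case by (cases bs') (auto simp: enc_block_def)
next
  case (Cons b bs)
  then show ?case by (cases bs') (auto simp: enc_block_def)
qed

lemma binary_inj: "binary m = binary n \<longleftrightarrow> m = n"
proof (induction m arbitrary: n rule: less_induct)
  case (less m)
  show ?case
  proof (cases "m = 0 \<or> n = 0")
    case True
    then show ?thesis by (auto simp: binary.simps[of m] binary.simps[of n])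
  next
    case False
    then have "binary m = binary n \<longleftrightarrow> odd m = odd n \<and> m div 2 = n div 2"
      using less.IH[of "m div 2" "n div 2"]
      by (simp add: binary.simps[of m] binary.simps[of n])
    also have "\<dots> \<longleftrightarrow> m = n" by presburger
    finally show ?thesis .
  qed
qed

lemma enc_nat_append_inj: "enc_nat m @ u = enc_nat n @ v \<longleftrightarrow> m = n \<and> u = v"
  by (simp add: enc_nat_def enc_block_append_inj binary_inj)

lemma enc_unary_append_inj: "enc_unary m @ u = enc_unary n @ v \<longleftrightarrow> m = n \<and> u = v"
proof (induction m arbitrary: n)
  case 0
  then show ?case by (cases n) (auto simp: enc_unary_def)
next
  case (Suc m)
  then show ?case by (cases n) (auto simp: enc_unary_def)
qed

lemma enc_int_inj: "enc_int k = enc_int l \<longleftrightarrow> k = l"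
  using enc_nat_append_inj[of "nat \<bar>k\<bar>" "[]" "nat \<bar>l\<bar>" "[]"] by (auto simp: enc_int_def)

lemma enc_test_append_inj:
  "enc_test n t @ u = enc_test n t' @ v \<longleftrightarrow> (\<forall>s<n. t s = t' s) \<and> u = v"
proof (induction n arbitrary: u v)
  case 0
  then show ?case by (simp add: enc_test_def)
next
  case (Suc n)
  then show ?case by (auto simp: enc_test_def enc_nat_append_inj less_Suc_eq)
qed

text \<open>An encoding determines the instance, up to values of the tests outside \<open>S\<close>.\<close>

lemma enc_instance_inj:
  "enc_instance n c T k = enc_instance n' c' T' k' \<longleftrightarrow>
     n = n' \<and> c = c' \<and> list_all2 (\<lambda>t t'. \<forall>s<n. t s = t' s) T T' \<and> k = k'"
proof -
  have "concat (map (enc_test n) T) @ enc_int k = concat (map (enc_test n) T') @ enc_int k' \<longleftrightarrow>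
      list_all2 (\<lambda>t t'. \<forall>s<n. t s = t' s) T T' \<and> k = k'" if "length T = length T'"
    using that
    by (induction rule: list_induct2) (auto simp: enc_int_inj enc_test_append_inj)
  then show ?thesis
    by (auto simp: enc_instance_def enc_unary_append_inj list_all2_lengthD)
qed

type_synonym language = "bool list set"

definition Panel_Crossing_Minimization :: language where
  "Panel_Crossing_Minimization = {enc_instance n c T k | n c T k.
     panel_data {..<n} {..<c} T \<and> panel_crossing_yes {..<n} {..<c} T k}"

text \<open>The restriction to instances with at most \<open>d\<close> tests.\<close>

definition Panel_Crossing_Minimization_tests :: "nat \<Rightarrow> language" where
  "Panel_Crossing_Minimization_tests d = {enc_instance n c T k | n c T k.
     panel_data {..<n} {..<c} T \<and> length T \<le> d \<and> panel_crossing_yes {..<n} {..<c} T k}"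


section \<open>Turing machines and polynomial time\<close>

text \<open>Deterministic Turing machines with a fixed number of two-way infinite tapes. The states are
  \<open>0, \<dots>, tm_states\<close>, with \<open>0\<close> initial and \<open>tm_states\<close> halting; the tape symbols
  are \<open>0, \<dots>, tm_symbols - 1\<close>, where \<open>0\<close> is the blank and \<open>1\<close>, \<open>2\<close> stand
  for \<open>False\<close>, \<open>True\<close>.\<close>

datatype move = Move_Left | Move_Stay | Move_Right

record tm =
  tm_tapes :: nat
  tm_states :: nat
  tm_symbols :: nat
  tm_delta :: "nat \<Rightarrow> nat list \<Rightarrow> nat \<times> (nat \<times> move) list"

definition tm_wf :: "tm \<Rightarrow> bool" where
  "tm_wf M \<longleftrightarrow> 2 \<le> tm_tapes M \<and> 3 \<le> tm_symbols M \<and>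
     (\<forall>q<tm_states M. \<forall>as. length as = tm_tapes M \<and> set as \<subseteq> {..<tm_symbols M} \<longrightarrow>
        fst (tm_delta M q as) \<le> tm_states M \<and>
        length (snd (tm_delta M q as)) = tm_tapes M \<and>
        fst ` set (snd (tm_delta M q as)) \<subseteq> {..<tm_symbols M})"

text \<open>A tape is its contents together with the position of the head.\<close>

type_synonym tape = "(int \<Rightarrow> nat) \<times> int"
type_synonym config = "nat \<times> tape list"

fun tape_read :: "tape \<Rightarrow> nat" where
  "tape_read (f, p) = f p"

fun tape_act :: "nat \<times> move \<Rightarrow> tape \<Rightarrow> tape" where
  "tape_act (a, d) (f, p) = (f(p := a),
     case d of Move_Left \<Rightarrow> p - 1 | Move_Stay \<Rightarrow> p | Move_Right \<Rightarrow> p + 1)"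

fun tm_step :: "tm \<Rightarrow> config \<Rightarrow> config" where
  "tm_step M (q, ts) =
     (if q = tm_states M then (q, ts)
      else let (q', acts) = tm_delta M q (map tape_read ts) in (q', map2 tape_act acts ts))"

definition bit_symbol :: "bool \<Rightarrow> nat" where
  "bit_symbol b = (if b then 2 else 1)"

definition blank_tape :: tape where
  "blank_tape = (\<lambda>_. 0, 0)"

definition input_tape :: "bool list \<Rightarrow> tape" where
  "input_tape x = (\<lambda>i. if 0 \<le> i \<and> i < int (length x) then bit_symbol (x ! nat i) else 0, 0)"

definition tm_init :: "tm \<Rightarrow> bool list \<Rightarrow> config" where
  "tm_init M x = (0, input_tape x # replicate (tm_tapes M - 1) blank_tape)"

text \<open>The output is read from cell \<open>0\<close> rightwards up to the first blank.\<close>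

definition tape_holds :: "tape \<Rightarrow> bool list \<Rightarrow> bool" where
  "tape_holds t y \<longleftrightarrow>
     (\<forall>i<length y. fst t (int i) = bit_symbol (y ! i)) \<and> fst t (int (length y)) = 0"

text \<open>Input is on tape \<open>0\<close>, output on tape \<open>1\<close>. As halting configurations are fixed
  by \<open>tm_step\<close>, the machine halts within \<open>m\<close> steps iff it is in the halting state
  after \<open>m\<close> steps.\<close>

definition tm_computes_within :: "tm \<Rightarrow> (bool list \<Rightarrow> bool list) \<Rightarrow> (nat \<Rightarrow> nat) \<Rightarrow> bool" where
  "tm_computes_within M f time \<longleftrightarrow> (\<forall>x.
     case (tm_step M ^^ time (length x)) (tm_init M x) of
       (q, ts) \<Rightarrow> q = tm_states M \<and> tape_holds (ts ! 1) (f x))"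

definition poly_time :: "(bool list \<Rightarrow> bool list) \<Rightarrow> bool" where
  "poly_time f \<longleftrightarrow> (\<exists>M (p :: nat poly). tm_wf M \<and> tm_computes_within M f (poly p))"


section \<open>NP-completeness\<close>

definition class_P :: "language set" where
  "class_P = {L. poly_time (\<lambda>x. [x \<in> L])}"

definition bit_pair :: "bool list \<Rightarrow> bool list \<Rightarrow> bool list" where
  "bit_pair x w = enc_block x @ w"

definition class_NP :: "language set" where
  "class_NP = {L. \<exists>R\<in>class_P. \<exists>p :: nat poly. \<forall>x.
     x \<in> L \<longleftrightarrow> (\<exists>w. length w \<le> poly p (length x) \<and> bit_pair x w \<in> R)}"

definition poly_reducible :: "language \<Rightarrow> language \<Rightarrow> bool" where
  "poly_reducible L L' \<longleftrightarrow> (\<exists>f. poly_time f \<and> (\<forall>x. x \<in> L \<longleftrightarrow> f x \<in> L'))"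

definition NP_hard :: "language \<Rightarrow> bool" where
  "NP_hard L \<longleftrightarrow> (\<forall>L'\<in>class_NP. poly_reducible L' L)"

definition NP_complete :: "language \<Rightarrow> bool" where
  "NP_complete L \<longleftrightarrow> L \<in> class_NP \<and> NP_hard L"

end

theory Submission
  imports Defs "HOL-Library.Nat_Bijection"
begin

text \<open>With two tests, subjects are directed edges between categories, and the crossings that no
  layout can avoid are the pairs of edges that \<open>\<sigma>\<close> orders differently at their sources and
  targets. A loop at \<open>a\<close> crosses the edges that pass over \<open>a\<close>; heavy loops and edges thus
  encode a cut problem, the sides of the cut being the categories before and after a distinguished one.
  Cuts encode not-all-equal satisfiability by triangles, and clauses describe a computation of the Turing
  machine verifying a given problem in NP, whose cells are addressed relative to the heads.

  Polynomial time bounds come for free: functions on words whose digits are given by arithmetic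
  expressions with bounded summation compile to counter programs, in which all values and running times are
  polynomial. Certificates for layouts are checked, and the reduction is written down, by such expressions.\<close>

section \<open>Counter programs on Turing machines\<close>

text \<open>Heavy loops at the distinguished category penalise cut edges, so few crossings would
  favour a small cut, while the hard problem asks for a large one. Hence the edges of the cut
  instance are represented by their absence from complete graphs. The cut of a complete graph
  depends on how balanced its sides are; a second family of heavy crossings cancels this dependence
  exactly.

  The clauses of a computation only push forward: they state facts about the start and implications,
  and only those against a rejecting output are purely negative. A satisfying assignment may make
  more variables true than the run does, and no clause says that a cell holds at most one symbol.
  Although a step depends on all heads, three literals per clause suffice, as the symbols under the
  heads are collected one at a time.

  A formula is never listed. It is a predicate on triples of literals, and every triple gets its own
  vertices and triangles, harmless ones if it is not a clause; this gives the graph the regular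
  shape that arithmetic expressions can describe.\<close>

datatype test = Nonzero nat | In_True | In_Cell

datatype com =
    Skip | Inc nat | Dec nat | In_Right | In_Left | Out bool
  | Seq com com | If test com | While test com

text \<open>The components are the registers, the position of the head on the input, and the output
  written so far.\<close>

type_synonym store = "(nat \<Rightarrow> nat) \<times> nat \<times> bool list"

fun holds :: "bool list \<Rightarrow> test \<Rightarrow> store \<Rightarrow> bool" where
  "holds x (Nonzero r) (R, p, out) \<longleftrightarrow> R r \<noteq> 0"
| "holds x In_True (R, p, out) \<longleftrightarrow> p < length x \<and> x ! p"
| "holds x In_Cell (R, p, out) \<longleftrightarrow> p < length x"

text \<open>The counts are exactly the steps of the compiled machine: a test costs one step, and so
  does the jump back after a loop body, which is the inner \<open>Suc\<close> of
  \<open>runs_While_True\<close>. At position 0 there is no rule for \<open>In_Left\<close>, so a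
  run never leaves the input on the left.\<close>

inductive runs :: "bool list \<Rightarrow> com \<Rightarrow> store \<Rightarrow> nat \<Rightarrow> store \<Rightarrow> bool" for x where
  runs_Skip: "runs x Skip s 0 s"
| runs_Inc: "runs x (Inc r) (R, p, out) 1 (R(r := Suc (R r)), p, out)"
| runs_Dec: "runs x (Dec r) (R, p, out) 1 (R(r := R r - 1), p, out)"
| runs_In_Right: "runs x In_Right (R, p, out) 1 (R, Suc p, out)"
| runs_In_Left: "runs x In_Left (R, Suc p, out) 1 (R, p, out)"
| runs_Out: "runs x (Out b) (R, p, out) 1 (R, p, out @ [b])"
| runs_Seq: "runs x c s m s' \<Longrightarrow> runs x d s' n s'' \<Longrightarrow> runs x (Seq c d) s (m + n) s''"
| runs_If_True: "holds x t s \<Longrightarrow> runs x c s n s' \<Longrightarrow> runs x (If t c) s (Suc n) s'"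
| runs_If_False: "\<not> holds x t s \<Longrightarrow> runs x (If t c) s 1 s"
| runs_While_False: "\<not> holds x t s \<Longrightarrow> runs x (While t c) s 1 s"
| runs_While_True: "holds x t s \<Longrightarrow> runs x c s m s' \<Longrightarrow> runs x (While t c) s' n s'' \<Longrightarrow>
    runs x (While t c) s (Suc (m + Suc n)) s''"

fun regs :: "com \<Rightarrow> nat" where
  "regs (Inc r) = Suc r"
| "regs (Dec r) = Suc r"
| "regs (Seq c d) = max (regs c) (regs d)"
| "regs (If t c) = max (case t of Nonzero r \<Rightarrow> Suc r | _ \<Rightarrow> 0) (regs c)"
| "regs (While t c) = max (case t of Nonzero r \<Rightarrow> Suc r | _ \<Rightarrow> 0) (regs c)"
| "regs _ = 0"

text \<open>An instruction names the only tape it looks at and, for each symbol read there, the symbol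
  written, the movement and the next state. Register \<open>r\<close> is the head position on tape
  \<open>r + 2\<close>, whose cell \<open>0\<close> carries the marker \<open>1\<close>.\<close>

type_synonym instr = "nat \<times> (nat \<Rightarrow> nat \<times> move \<times> nat)"

fun test_tape :: "test \<Rightarrow> nat" where
  "test_tape (Nonzero r) = r + 2"
| "test_tape _ = 0"

fun test_symbol :: "test \<Rightarrow> nat \<Rightarrow> bool" where
  "test_symbol (Nonzero r) a \<longleftrightarrow> a \<noteq> 1"
| "test_symbol In_True a \<longleftrightarrow> a = 2"
| "test_symbol In_Cell a \<longleftrightarrow> a \<noteq> 0"

fun code_size :: "com \<Rightarrow> nat" where
  "code_size Skip = 0"
| "code_size (Seq c d) = code_size c + code_size d"
| "code_size (If t c) = Suc (code_size c)"
| "code_size (While t c) = Suc (Suc (code_size c))"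
| "code_size _ = 1"

text \<open>Code placed at address \<open>q\<close> is always left through address
  \<open>q + code_size c\<close>, which makes sequencing plain concatenation. \<open>Dec\<close>
  stays on the marker, in agreement with truncated subtraction. The last instruction of a loop is an
  unconditional jump, written as an action on tape 0 that changes nothing.\<close>

fun code :: "com \<Rightarrow> nat \<Rightarrow> instr list" where
  "code Skip q = []"
| "code (Inc r) q = [(r + 2, \<lambda>a. (a, Move_Right, Suc q))]"
| "code (Dec r) q = [(r + 2, \<lambda>a. (a, if a = 1 then Move_Stay else Move_Left, Suc q))]"
| "code In_Right q = [(0, \<lambda>a. (a, Move_Right, Suc q))]"
| "code In_Left q = [(0, \<lambda>a. (a, Move_Left, Suc q))]"
| "code (Out b) q = [(1, \<lambda>a. (bit_symbol b, Move_Right, Suc q))]"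
| "code (Seq c d) q = code c q @ code d (q + code_size c)"
| "code (If t c) q =
     (test_tape t, \<lambda>a. (a, Move_Stay, if test_symbol t a then Suc q else q + Suc (code_size c)))
     # code c (Suc q)"
| "code (While t c) q =
     (test_tape t, \<lambda>a. (a, Move_Stay, if test_symbol t a then Suc q else q + Suc (Suc (code_size c))))
     # code c (Suc q) @ [(0, \<lambda>a. (a, Move_Stay, q))]"

lemma length_code [simp]: "length (code c q) = code_size c"
  by (induction c arbitrary: q) auto

lemma code_bounds:
  "(k, g) \<in> set (code c q) \<Longrightarrow> (a < 3 \<longrightarrow> fst (g a) < 3) \<and> snd (snd (g a)) \<le> q + code_size c"
proof (induction c arbitrary: q)
  case (Seq c d)
  then show ?case by (fastforce)
next
  case (If t c)
  from If.prems show ?case using If.IH[of "Suc q"] by auto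
next
  case (While t c)
  from While.prems show ?case using While.IH[of "Suc q"] by auto
qed (auto simp: bit_symbol_def)

text \<open>The first \<open>regs c\<close> instructions put the markers on the register tapes;
  therefore the code proper starts at address \<open>regs c\<close>.\<close>

definition prog :: "com \<Rightarrow> instr list" where
  "prog c = map (\<lambda>r. (r + 2, \<lambda>a. (1, Move_Stay, Suc r))) [0..<regs c] @ code c (regs c)"

definition machine :: "instr list \<Rightarrow> nat \<Rightarrow> tm" where
  "machine P n = \<lparr>tm_tapes = n, tm_states = length P, tm_symbols = 3,
     tm_delta = (\<lambda>q as. case P ! q of (k, g) \<Rightarrow> case g (as ! k) of (b, d, q') \<Rightarrow>
       (q', map (\<lambda>j. if j = k then (b, d) else (as ! j, Move_Stay)) [0..<n]))\<rparr>"

lemma tape_act_same [simp]: "tape_act (tape_read t, Move_Stay) t = t"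
  by (cases t) auto

lemma machine_step:
  assumes "q < length P" "length ts = n" "P ! q = (k, g)" "k < n"
    and "g (tape_read (ts ! k)) = (b, d, q')"
  shows "tm_step (machine P n) (q, ts) = (q', ts[k := tape_act (b, d) (ts ! k)])"
proof -
  have "map2 tape_act (map (\<lambda>j. if j = k then (b, d) else (map tape_read ts ! j, Move_Stay)) [0..<n]) ts
      = ts[k := tape_act (b, d) (ts ! k)]"
    using assms(2,4) by (intro nth_equalityI) (auto simp: nth_list_update)
  then show ?thesis
    using assms by (simp add: machine_def Let_def)
qed

lemma machine_simps [simp]:
  "tm_tapes (machine P n) = n" "tm_states (machine P n) = length P" "tm_symbols (machine P n) = 3"
  by (simp_all add: machine_def)

lemma machine_wf:
  assumes "2 \<le> n" and written: "\<And>k g a. (k, g) \<in> set P \<Longrightarrow> a < 3 \<Longrightarrow> fst (g a) < 3"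
    and target: "\<And>k g a. (k, g) \<in> set P \<Longrightarrow> snd (snd (g a)) \<le> length P"
  shows "tm_wf (machine P n)"
proof -
  have "fst (tm_delta (machine P n) q as) \<le> length P \<and>
      length (snd (tm_delta (machine P n) q as)) = n \<and>
      fst ` set (snd (tm_delta (machine P n) q as)) \<subseteq> {..<3}"
    if q: "q < length P" and as: "length as = n" "set as \<subseteq> {..<3}" for q as
  proof -
    obtain k g where kg: "P ! q = (k, g)" by force
    obtain b d q' where g: "g (as ! k) = (b, d, q')" by (metis prod_cases3)
    have mem: "(k, g) \<in> set P"
      using q kg by (metis nth_mem)
    have as3: "as ! j < 3" if "j < n" for j
      using as that nth_mem[of j as] by blast
    have delta: "tm_delta (machine P n) q as =
        (q', map (\<lambda>j. if j = k then (b, d) else (as ! j, Move_Stay)) [0..<n])"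
      by (simp add: machine_def kg g)
    have "b < 3" if "k < n"
      using written[OF mem as3[OF that]] g by simp
    moreover have "q' \<le> length P"
      using target[OF mem, of "as ! k"] g by simp
    ultimately show ?thesis
      using as3 by (auto simp: delta)
  qed
  then show ?thesis
    using \<open>2 \<le> n\<close> by (simp add: tm_wf_def)
qed

section \<open>Simulation of counter programs\<close>

definition in_tape :: "bool list \<Rightarrow> int \<Rightarrow> nat" where
  "in_tape x = (\<lambda>i. if 0 \<le> i \<and> i < int (length x) then bit_symbol (x ! nat i) else 0)"

definition mark_tape :: "int \<Rightarrow> nat" where
  "mark_tape = (\<lambda>i. if i = 0 then 1 else 0)"

text \<open>The contents of a register tape never change once the marker is there; the value of the
  register is the head position alone. The output head stands on the first unwritten cell.\<close>

fun tapes :: "nat \<Rightarrow> bool list \<Rightarrow> store \<Rightarrow> tape list" where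
  "tapes n x (R, p, out) =
     (in_tape x, int p) # (in_tape out, int (length out)) # map (\<lambda>r. (mark_tape, int (R r))) [0..<n]"

lemma length_tapes [simp]: "length (tapes n x s) = Suc (Suc n)"
  by (cases s) auto

lemma tapes_nth [simp]: "r < n \<Longrightarrow> tapes n x (R, p, out) ! Suc (Suc r) = (mark_tape, int (R r))"
  by simp

lemma tapes_update:
  "r < n \<Longrightarrow> (tapes n x (R, p, out))[Suc (Suc r) := (mark_tape, int v)] =
     tapes n x (R(r := v), p, out)"
  by (auto intro!: nth_equalityI simp: nth_list_update)

lemma in_tape_snoc:
  "(in_tape out)(int (length out) := bit_symbol b) = in_tape (out @ [b])"
  by (rule ext) (auto simp: in_tape_def nth_append nat_less_iff)

lemma test_correct:
  assumes "case t of Nonzero r \<Rightarrow> r < n | _ \<Rightarrow> True"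
  shows "test_tape t < Suc (Suc n)"
    and "test_symbol t (tape_read (tapes n x s ! test_tape t)) \<longleftrightarrow> holds x t s"
  using assms by (cases s; cases t; auto simp: mark_tape_def in_tape_def bit_symbol_def)+

definition code_at :: "instr list \<Rightarrow> nat \<Rightarrow> instr list \<Rightarrow> bool" where
  "code_at P q L \<longleftrightarrow> (\<exists>A B. P = A @ L @ B \<and> length A = q)"

lemma code_at_append: "code_at P q (L @ L') \<Longrightarrow> code_at P q L \<and> code_at P (q + length L) L'"
  unfolding code_at_def by (metis append.assoc length_append)

lemma code_at_Cons:
  assumes "code_at P q (i # L)"
  shows "q < length P \<and> P ! q = i \<and> code_at P (Suc q) L"
proof -
  obtain A B where P: "P = A @ i # L @ B" "length A = q"
    using assms by (auto simp: code_at_def)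
  then have "code_at P (Suc q) L"
    unfolding code_at_def by (intro exI[of _ "A @ [i]"] exI[of _ B]) simp
  then show ?thesis using P by (simp add: nth_append)
qed

lemma code_step:
  assumes "code_at P q ((k, g) # L)" "k < Suc (Suc m)"
    and "g (tape_read (tapes m x s ! k)) = (b, d, q')"
  shows "tm_step (machine P (Suc (Suc m))) (q, tapes m x s) =
    (q', (tapes m x s)[k := tape_act (b, d) (tapes m x s ! k)])"
  using code_at_Cons[OF assms(1)] assms(2,3) by (intro machine_step[where g = g]) simp_all

lemma test_step:
  assumes "code_at P q ((test_tape t, \<lambda>a. (a, Move_Stay, if test_symbol t a then q1 else q2)) # L)"
    and "case t of Nonzero r \<Rightarrow> r < m | _ \<Rightarrow> True"
  shows "tm_step (machine P (Suc (Suc m))) (q, tapes m x s) =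
    (if holds x t s then q1 else q2, tapes m x s)"
  by (subst code_step[OF assms(1) test_correct(1)[OF assms(2)] refl])
    (simp add: test_correct(2)[OF assms(2)])

text \<open>The step counts of \<open>runs\<close> are those of the machine, so the simulation is an
  equation and no estimates enter. The address \<open>q\<close> is generalised because the parts of
  a command sit at other addresses.\<close>

lemma runs_steps:
  assumes "runs x c s n s'" and "regs c \<le> m" and "code_at P q (code c q)"
  shows "(tm_step (machine P (Suc (Suc m))) ^^ n) (q, tapes m x s) =
    (q + code_size c, tapes m x s')"
  using assms
proof (induction arbitrary: q rule: runs.induct)
  case (runs_Skip s)
  show ?case by simp
next
  case (runs_Inc r R p out)
  then have at: "code_at P q [(Suc (Suc r), \<lambda>a. (a, Move_Right, Suc q))]" and r: "r < m"
    by simp_all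
  have upd: "tape_act (mark_tape (int (R r)), Move_Right) (mark_tape, int (R r)) =
      (mark_tape, int (Suc (R r)))"
    by simp
  have "tm_step (machine P (Suc (Suc m))) (q, tapes m x (R, p, out)) =
      (Suc q, tapes m x (R(r := Suc (R r)), p, out))"
    using r by (subst code_step[OF at _ refl])
      (simp_all only: tapes_nth[OF r] tape_read.simps upd tapes_update[OF r] Suc_less_eq)
  then show ?case by simp
next
  case (runs_Dec r R p out)
  then have at: "code_at P q
      [(Suc (Suc r), \<lambda>a. (a, if a = 1 then Move_Stay else Move_Left, Suc q))]" and r: "r < m"
    by simp_all
  have upd: "tape_act (mark_tape (int (R r)), if mark_tape (int (R r)) = 1 then Move_Stay else Move_Left)
      (mark_tape, int (R r)) = (mark_tape, int (R r - 1))"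
    by (cases "R r") (simp_all add: mark_tape_def fun_eq_iff)
  have "tm_step (machine P (Suc (Suc m))) (q, tapes m x (R, p, out)) =
      (Suc q, tapes m x (R(r := R r - 1), p, out))"
    using r by (subst code_step[OF at _ refl])
      (simp_all only: tapes_nth[OF r] tape_read.simps upd tapes_update[OF r] Suc_less_eq)
  then show ?case by simp
next
  case (runs_In_Right R p out)
  then have at: "code_at P q [(0, \<lambda>a. (a, Move_Right, Suc q))]" by simp
  show ?case
    by (simp del: tm_step.simps tapes.simps, subst code_step[OF at _ refl])
      (simp_all add: algebra_simps)
next
  case (runs_In_Left R p out)
  then have at: "code_at P q [(0, \<lambda>a. (a, Move_Left, Suc q))]" by simp
  show ?case
    by (simp del: tm_step.simps tapes.simps, subst code_step[OF at _ refl])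
      (simp_all add: algebra_simps)
next
  case (runs_Out b R p out)
  then have at: "code_at P q [(Suc 0, \<lambda>a. (bit_symbol b, Move_Right, Suc q))]" by simp
  show ?case
    by (simp del: tm_step.simps tapes.simps, subst code_step[OF at _ refl])
      (simp_all add: in_tape_snoc algebra_simps)
next
  case (runs_Seq c s n1 s' d n2 s'')
  from runs_Seq.prems have "code_at P q (code c q)" "code_at P (q + code_size c) (code d (q + code_size c))"
    using code_at_append[of P q "code c q" "code d (q + code_size c)"] by simp_all
  then have "(tm_step (machine P (Suc (Suc m))) ^^ n1) (q, tapes m x s) = (q + code_size c, tapes m x s')"
    "(tm_step (machine P (Suc (Suc m))) ^^ n2) (q + code_size c, tapes m x s') =
      (q + code_size c + code_size d, tapes m x s'')"
    using runs_Seq.IH runs_Seq.prems(1) by simp_all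
  then show ?case
    by (simp add: add.commute[of n1] funpow_add add.assoc)
next
  case (runs_If_True t s c n s')
  have at: "code_at P q ((test_tape t, \<lambda>a. (a, Move_Stay, if test_symbol t a then Suc q
      else q + Suc (code_size c))) # code c (Suc q))"
    using runs_If_True.prems(2) by simp
  have "tm_step (machine P (Suc (Suc m))) (q, tapes m x s) = (Suc q, tapes m x s)"
    using runs_If_True.prems(1) runs_If_True.hyps(1)
    by (subst test_step[OF at]) (simp_all split: test.splits)
  moreover have "(tm_step (machine P (Suc (Suc m))) ^^ n) (Suc q, tapes m x s) =
      (Suc q + code_size c, tapes m x s')"
    using runs_If_True.IH[of "Suc q"] runs_If_True.prems(1) code_at_Cons[OF at] by simp
  ultimately show ?case
    by (simp add: funpow_Suc_right del: funpow.simps tm_step.simps)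
next
  case (runs_If_False t s c)
  have at: "code_at P q ((test_tape t, \<lambda>a. (a, Move_Stay, if test_symbol t a then Suc q
      else q + Suc (code_size c))) # code c (Suc q))"
    using runs_If_False.prems(2) by simp
  have "tm_step (machine P (Suc (Suc m))) (q, tapes m x s) = (q + Suc (code_size c), tapes m x s)"
    using runs_If_False.prems(1) runs_If_False.hyps(1)
    by (subst test_step[OF at]) (simp_all split: test.splits)
  then show ?case by (simp del: tm_step.simps)
next
  case (runs_While_False t s c)
  have at: "code_at P q ((test_tape t, \<lambda>a. (a, Move_Stay, if test_symbol t a then Suc q
      else q + Suc (Suc (code_size c)))) # code c (Suc q) @ [(0, \<lambda>a. (a, Move_Stay, q))])"
    using runs_While_False.prems(2) by simp
  have "tm_step (machine P (Suc (Suc m))) (q, tapes m x s) =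
      (q + Suc (Suc (code_size c)), tapes m x s)"
    using runs_While_False.prems(1) runs_While_False.hyps(1)
    by (subst test_step[OF at]) (simp_all split: test.splits)
  then show ?case by (simp del: tm_step.simps)
next
  case (runs_While_True t s c n1 s' n2 s'')
  let ?M = "machine P (Suc (Suc m))"
  have at: "code_at P q ((test_tape t, \<lambda>a. (a, Move_Stay, if test_symbol t a then Suc q
      else q + Suc (Suc (code_size c)))) # code c (Suc q) @ [(0, \<lambda>a. (a, Move_Stay, q))])"
    using runs_While_True.prems(2) by simp
  have at2: "code_at P (Suc q) (code c (Suc q))"
    "code_at P (Suc (q + code_size c)) [(0, \<lambda>a. (a, Move_Stay, q))]"
    using code_at_append[of P "Suc q" "code c (Suc q)" "[(0, \<lambda>a. (a, Move_Stay, q))]"]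
      code_at_Cons[OF at] by simp_all
  have "tm_step ?M (q, tapes m x s) = (Suc q, tapes m x s)"
    using runs_While_True.prems(1) runs_While_True.hyps(1)
    by (subst test_step[OF at]) (simp_all split: test.splits)
  moreover have "(tm_step ?M ^^ n1) (Suc q, tapes m x s) = (Suc (q + code_size c), tapes m x s')"
    using runs_While_True.IH(1)[of "Suc q"] at2 runs_While_True.prems(1) by simp
  moreover have "tm_step ?M (Suc (q + code_size c), tapes m x s') = (q, tapes m x s')"
    by (subst code_step[OF at2(2) _ refl]) (simp_all add: list_update_id del: tapes.simps)
  moreover have "(tm_step ?M ^^ n2) (q, tapes m x s') = (q + code_size (While t c), tapes m x s'')"
    using runs_While_True.IH(2)[of q] runs_While_True.prems by simp
  moreover have "tm_step ?M ^^ Suc (n1 + Suc n2) =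
      (tm_step ?M ^^ n2) \<circ> tm_step ?M \<circ> (tm_step ?M ^^ n1) \<circ> tm_step ?M"
    by (simp only: funpow_Suc_right funpow_add comp_assoc add.commute[of n1])
  ultimately show ?case by (simp del: tm_step.simps funpow.simps code_size.simps)
qed

lemma tm_step_halted: "(tm_step M ^^ n) (tm_states M, ts) = (tm_states M, ts)"
  by (induction n) auto

lemma tm_step_halted_mono:
  assumes "(tm_step M ^^ n) c = (tm_states M, ts)" "n \<le> m"
  shows "(tm_step M ^^ m) c = (tm_states M, ts)"
  using assms tm_step_halted[of "m - n" M ts]
  by (metis comp_apply funpow_add le_add_diff_inverse2)

lemma init_steps:
  fixes c x
  defines "M \<equiv> machine (prog c) (Suc (Suc (regs c)))"
  shows "(tm_step M ^^ regs c) (tm_init M x) = (regs c, tapes (regs c) x (\<lambda>_. 0, 0, []))"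
proof -
  let ?m = "regs c"
  let ?ts = "\<lambda>j. (in_tape x, 0) # (in_tape [], 0) #
      map (\<lambda>r. (if r < j then mark_tape else (\<lambda>_. 0), 0)) [0..<?m]"
  have "(tm_step M ^^ j) (tm_init M x) = (j, ?ts j)" if "j \<le> ?m" for j
    using that
  proof (induction j)
    case 0
    then show ?case
      by (auto simp: tm_init_def M_def machine_def input_tape_def in_tape_def blank_tape_def
          map_replicate_const)
  next
    case (Suc j)
    then have "(tm_step M ^^ Suc j) (tm_init M x) = tm_step M (j, ?ts j)" by simp
    also have "\<dots> = (Suc j, (?ts j)[j + 2 := tape_act (1, Move_Stay) (?ts j ! (j + 2))])"
      unfolding M_def using Suc.prems
      by (intro machine_step[where g = "\<lambda>a. (1, Move_Stay, Suc j)"])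
        (auto simp: prog_def nth_append)
    also have "(?ts j)[j + 2 := tape_act (1, Move_Stay) (?ts j ! (j + 2))] = ?ts (Suc j)"
      using Suc.prems by (auto simp: nth_list_update mark_tape_def fun_eq_iff intro!: nth_equalityI)
    finally show ?case .
  qed
  from this[of ?m] show ?thesis by (auto cong: map_cong)
qed

text \<open>Writing the markers adds the constant \<open>regs c\<close> to the bound, and a machine
  that halts early keeps its configuration until the bound is reached.\<close>

lemma runs_poly_time:
  assumes "\<And>x. \<exists>n R p. n \<le> poly P (length x) \<and> runs x c (\<lambda>_. 0, 0, []) n (R, p, f x)"
  shows "poly_time f"
proof -
  define M where "M = machine (prog c) (Suc (Suc (regs c)))"
  have "tm_wf M"
    unfolding M_def
  proof (rule machine_wf)
    fix k g a assume "(k, g) \<in> set (prog c)"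
    then show "a < 3 \<Longrightarrow> fst (g a) < 3" "snd (snd (g a)) \<le> length (prog c)"
      using code_bounds[of k g c "regs c" a] by (auto simp: prog_def)
  qed auto
  moreover have "tm_computes_within M f (poly (P + [:regs c:]))"
    unfolding tm_computes_within_def
  proof
    fix x
    obtain n R p where n: "n \<le> poly P (length x)" and r: "runs x c (\<lambda>_. 0, 0, []) n (R, p, f x)"
      using assms by blast
    have at: "code_at (prog c) (regs c) (code c (regs c))"
      unfolding code_at_def prog_def
      by (intro exI[of _ "map (\<lambda>r. (r + 2, \<lambda>a. (1, Move_Stay, Suc r))) [0..<regs c]"] exI[of _ "[]"]) simp
    have "(tm_step M ^^ (n + regs c)) (tm_init M x) =
        (regs c + code_size c, tapes (regs c) x (R, p, f x))"
      using runs_steps[OF r order_refl at] init_steps[of c x]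
      unfolding M_def by (simp add: funpow_add del: tm_step.simps tapes.simps)
    also have "regs c + code_size c = tm_states M"
      by (simp add: M_def prog_def)
    finally have "(tm_step M ^^ poly (P + [:regs c:]) (length x)) (tm_init M x) =
        (tm_states M, tapes (regs c) x (R, p, f x))"
      by (rule tm_step_halted_mono) (use n in simp)
    then show "case (tm_step M ^^ poly (P + [:regs c:]) (length x)) (tm_init M x) of
        (q, ts) \<Rightarrow> q = tm_states M \<and> tape_holds (ts ! 1) (f x)"
      by (simp add: tape_holds_def in_tape_def)
  qed
  ultimately show ?thesis unfolding poly_time_def by blast
qed

section \<open>Unary arithmetic expressions\<close>

text \<open>Summation is the only way to iterate, so values and running times are polynomially bounded
  for every expression. Variables are de Bruijn indices.\<close>

datatype ex = Var nat | Cst nat | Len | Bit ex | Add ex ex | Sub ex ex | Sum ex ex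

definition bt :: "bool list \<Rightarrow> nat \<Rightarrow> bool" where
  "bt x i \<longleftrightarrow> i < length x \<and> x ! i"

fun ev :: "bool list \<Rightarrow> (nat \<Rightarrow> nat) \<Rightarrow> ex \<Rightarrow> nat" where
  "ev x e (Var i) = e i"
| "ev x e (Cst c) = c"
| "ev x e Len = length x"
| "ev x e (Bit a) = of_bool (bt x (ev x e a))"
| "ev x e (Add a b) = ev x e a + ev x e b"
| "ev x e (Sub a b) = ev x e a - ev x e b"
| "ev x e (Sum a b) = (\<Sum>i<ev x e a. ev x (case_nat i e) b)"

fun incs :: "nat \<Rightarrow> nat \<Rightarrow> com" where
  "incs d 0 = Skip"
| "incs d (Suc c) = Seq (incs d c) (Inc d)"

text \<open>The value of an expression is put into register \<open>d\<close>; the registers above \<open>d\<close>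
  are scratch space, and the values of the variables are in registers \<open>\<rho> ! i < d\<close>.\<close>

fun compile :: "ex \<Rightarrow> nat list \<Rightarrow> nat \<Rightarrow> com" where
  "compile (Var i) \<rho> d = (if i < length \<rho> then
     Seq (While (Nonzero (\<rho> ! i)) (Seq (Dec (\<rho> ! i)) (Seq (Inc d) (Inc (Suc d)))))
       (While (Nonzero (Suc d)) (Seq (Dec (Suc d)) (Inc (\<rho> ! i)))) else Skip)"
| "compile (Cst c) \<rho> d = incs d c"
| "compile Len \<rho> d =
     Seq (While In_Cell (Seq In_Right (Seq (Inc d) (Inc (Suc d)))))
       (While (Nonzero (Suc d)) (Seq (Dec (Suc d)) In_Left))"
| "compile (Bit a) \<rho> d = Seq (compile a \<rho> (d + 1))
     (Seq (While (Nonzero (d + 1)) (Seq (Dec (d + 1)) (Seq (Inc (d + 2)) In_Right)))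
     (Seq (If In_True (Inc d)) (While (Nonzero (d + 2)) (Seq (Dec (d + 2)) In_Left))))"
| "compile (Add a b) \<rho> d = Seq (compile a \<rho> d) (Seq (compile b \<rho> (d + 1))
     (While (Nonzero (d + 1)) (Seq (Dec (d + 1)) (Inc d))))"
| "compile (Sub a b) \<rho> d = Seq (compile a \<rho> d) (Seq (compile b \<rho> (d + 1))
     (While (Nonzero (d + 1)) (Seq (Dec (d + 1)) (Dec d))))"
| "compile (Sum a b) \<rho> d = Seq (compile a \<rho> (d + 1))
     (Seq (While (Nonzero (d + 1)) (Seq (compile b ((d + 2) # \<rho>) (d + 3))
        (Seq (While (Nonzero (d + 3)) (Seq (Dec (d + 3)) (Inc d))) (Seq (Dec (d + 1)) (Inc (d + 2))))))
     (While (Nonzero (d + 2)) (Dec (d + 2))))"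

section \<open>Running times of compiled expressions\<close>

definition runs_in :: "bool list \<Rightarrow> com \<Rightarrow> store \<Rightarrow> nat \<Rightarrow> store \<Rightarrow> bool" where
  "runs_in x c s n s' \<longleftrightarrow> (\<exists>m\<le>n. runs x c s m s')"

lemma runs_in_mono: "runs_in x c s m s' \<Longrightarrow> m \<le> n \<Longrightarrow> runs_in x c s n s'"
  unfolding runs_in_def by (meson le_trans)

lemma runs_in_Skip: "s' = s \<Longrightarrow> runs_in x Skip s 0 s'"
  unfolding runs_in_def by (blast intro: runs_Skip)

lemma runs_in_Inc:
  "R' = R(r := Suc (R r)) \<Longrightarrow> 1 \<le> n \<Longrightarrow> runs_in x (Inc r) (R, p, out) n (R', p, out)"
  unfolding runs_in_def by (blast intro: runs_Inc)

lemma runs_in_Dec: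
  "R' = R(r := R r - 1) \<Longrightarrow> 1 \<le> n \<Longrightarrow> runs_in x (Dec r) (R, p, out) n (R', p, out)"
  unfolding runs_in_def by (blast intro: runs_Dec)

lemma runs_in_In_Right: "p' = Suc p \<Longrightarrow> 1 \<le> n \<Longrightarrow> runs_in x In_Right (R, p, out) n (R, p', out)"
  unfolding runs_in_def by (blast intro: runs_In_Right)

lemma runs_in_In_Left: "p = Suc p' \<Longrightarrow> 1 \<le> n \<Longrightarrow> runs_in x In_Left (R, p, out) n (R, p', out)"
  unfolding runs_in_def by (blast intro: runs_In_Left)

lemma runs_in_Out: "out' = out @ [b] \<Longrightarrow> 1 \<le> n \<Longrightarrow> runs_in x (Out b) (R, p, out) n (R, p, out')"
  unfolding runs_in_def by (blast intro: runs_Out)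

lemma runs_in_Seq:
  "runs_in x c s m s' \<Longrightarrow> runs_in x d s' n s'' \<Longrightarrow> runs_in x (Seq c d) s (m + n) s''"
  unfolding runs_in_def by (meson add_mono runs_Seq)

lemma runs_in_If_True: "holds x t s \<Longrightarrow> runs_in x c s n s' \<Longrightarrow> runs_in x (If t c) s (Suc n) s'"
  unfolding runs_in_def by (meson Suc_le_mono runs_If_True)

lemma runs_in_If_False: "\<not> holds x t s \<Longrightarrow> s' = s \<Longrightarrow> runs_in x (If t c) s 1 s'"
  unfolding runs_in_def by (metis order_refl runs_If_False)

text \<open>A loop is described by the store \<open>S i\<close> before its iteration
  \<open>i\<close>. Every iteration pays two steps beyond its body, for the test and the jump back,
  and the failing test pays one more.\<close>

lemma runs_in_While:
  assumes "\<And>i. i < N \<Longrightarrow> holds x t (S i)" and "\<And>i. i < N \<Longrightarrow> runs_in x c (S i) T (S (Suc i))"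
    and "\<not> holds x t (S N)" and "S 0 = s" and "S N = s'"
  shows "runs_in x (While t c) s (N * (T + 2) + 1) s'"
proof -
  \<comment> \<open>The induction is on the number \<open>j\<close> of remaining iterations, since
    the rule for loops unfolds them from the front.\<close>
  have "runs_in x (While t c) (S (N - j)) (j * (T + 2) + 1) (S N)" if "j \<le> N" for j
    using that
  proof (induction j)
    case 0
    then show ?case
      unfolding runs_in_def using runs_While_False[OF assms(3)] by auto
  next
    case (Suc j)
    then have eq: "Suc (N - Suc j) = N - j" by simp
    obtain m where m: "m \<le> T" "runs x c (S (N - Suc j)) m (S (N - j))"
      using assms(2)[of "N - Suc j"] Suc.prems unfolding runs_in_def eq by auto
    obtain n where n: "n \<le> j * (T + 2) + 1" "runs x (While t c) (S (N - j)) n (S N)"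
      using Suc unfolding runs_in_def by auto
    have "runs x (While t c) (S (N - Suc j)) (Suc (m + Suc n)) (S N)"
      using runs_While_True[OF assms(1)[of "N - Suc j"] m(2) n(2)] Suc.prems by simp
    moreover have "Suc (m + Suc n) \<le> Suc j * (T + 2) + 1"
      using m(1) n(1) by simp
    ultimately show ?case unfolding runs_in_def by blast
  qed
  from this[of N] assms(4,5) show ?thesis by simp
qed

lemma runs_in_Seq1:
  "runs_in x c s 1 s' \<Longrightarrow> runs_in x d s' (n - 1) s'' \<Longrightarrow> 1 \<le> n \<Longrightarrow> runs_in x (Seq c d) s n s''"
  using runs_in_Seq[of x c s 1 s' d "n - 1" s''] by simp

lemmas runs_in_basic = runs_in_Inc runs_in_Dec runs_in_In_Right runs_in_In_Left

lemma runs_in_atoms: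
  "runs_in x (Inc r) (R, p, out) 1 (R(r := Suc (R r)), p, out)"
  "runs_in x (Dec r) (R, p, out) 1 (R(r := R r - 1), p, out)"
  "runs_in x In_Right (R, p, out) 1 (R, Suc p, out)"
  "p \<noteq> 0 \<Longrightarrow> runs_in x In_Left (R, p, out) 1 (R, p - 1, out)"
  "runs_in x (Out b) (R, p, out) 1 (R, p, out @ [b])"
  by (simp_all add: runs_in_basic runs_in_Out)

lemma nat_poly_mono: "a \<le> b \<Longrightarrow> poly (p :: nat poly) a \<le> poly p b"
  by (induction p) (auto intro: add_mono mult_mono)

text \<open>A single number \<open>B\<close> bounds the input length and all variables, so that
  polynomials in one variable suffice. The scratch registers are zero before and, as only
  \<open>d\<close> is updated, zero again afterwards. Variables beyond \<open>\<rho>\<close> have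
  value 0, which is what \<open>Skip\<close> leaves in \<open>d\<close>.\<close>

definition compiles :: "ex \<Rightarrow> nat poly \<Rightarrow> bool" where
  "compiles E P \<longleftrightarrow> (\<forall>x \<rho> d R e B out.
     (\<forall>i<length \<rho>. \<rho> ! i < d \<and> R (\<rho> ! i) = e i) \<longrightarrow> (\<forall>i\<ge>length \<rho>. e i = 0) \<longrightarrow>
     (\<forall>r\<ge>d. R r = 0) \<longrightarrow> length x \<le> B \<longrightarrow> (\<forall>i. e i \<le> B) \<longrightarrow>
     ev x e E \<le> poly P B \<and>
     runs_in x (compile E \<rho> d) (R, 0, out) (poly P B) (R(d := ev x e E), 0, out))"

lemma compilesD:
  assumes "compiles E P" "\<forall>i<length \<rho>. \<rho> ! i < d \<and> R (\<rho> ! i) = e i" "\<forall>i\<ge>length \<rho>. e i = 0"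
    "\<forall>r\<ge>d. R r = 0" "length x \<le> B" "\<forall>i. e i \<le> B"
  shows "ev x e E \<le> poly P B \<and>
    runs_in x (compile E \<rho> d) (R, 0, out) (poly P B) (R(d := ev x e E), 0, out)"
  using assms unfolding compiles_def by blast

lemma runs_in_incs: "runs_in x (incs d c) (R, p, out) c (R(d := R d + c), p, out)"
proof (induction c)
  case 0
  then show ?case by (auto intro!: runs_in_Skip)
next
  case (Suc c)
  then show ?case
    using runs_in_Seq[OF Suc runs_in_Inc[where r = d, OF refl order_refl]]
    by (simp only: incs.simps fun_upd_same fun_upd_upd add_Suc_right Suc_eq_plus1[symmetric])
qed

lemma runs_in_add_loop:
  assumes "r \<noteq> d" "R r = v"
  shows "runs_in x (While (Nonzero r) (Seq (Dec r) (Inc d))) (R, p, out) (4 * v + 1)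
    (R(r := 0, d := R d + v), p, out)"
proof -
  have "runs_in x (While (Nonzero r) (Seq (Dec r) (Inc d))) (R, p, out) (v * ((1 + 1) + 2) + 1)
    (R(r := 0, d := R d + v), p, out)"
    using assms
    by (intro runs_in_While[where S = "\<lambda>i. (R(r := v - i, d := R d + i), p, out)"])
      (simp_all, (rule runs_in_Seq1, rule runs_in_atoms)+,
        auto intro!: runs_in_basic simp: fun_eq_iff)
  then show ?thesis by (rule runs_in_mono) simp
qed

lemma runs_in_sub_loop:
  assumes "r \<noteq> d" "R r = v"
  shows "runs_in x (While (Nonzero r) (Seq (Dec r) (Dec d))) (R, p, out) (4 * v + 1)
    (R(r := 0, d := R d - v), p, out)"
proof -
  have "runs_in x (While (Nonzero r) (Seq (Dec r) (Dec d))) (R, p, out) (v * ((1 + 1) + 2) + 1)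
    (R(r := 0, d := R d - v), p, out)"
    using assms
    by (intro runs_in_While[where S = "\<lambda>i. (R(r := v - i, d := R d - i), p, out)"])
      (simp_all, (rule runs_in_Seq1, rule runs_in_atoms)+,
        auto intro!: runs_in_basic simp: fun_eq_iff)
  then show ?thesis by (rule runs_in_mono) simp
qed

lemma runs_in_back_loop:
  assumes "R r = v" "v \<le> p"
  shows "runs_in x (While (Nonzero r) (Seq (Dec r) In_Left)) (R, p, out) (4 * v + 1)
    (R(r := 0), p - v, out)"
proof -
  have "runs_in x (While (Nonzero r) (Seq (Dec r) In_Left)) (R, p, out) (v * ((1 + 1) + 2) + 1)
    (R(r := 0), p - v, out)"
    using assms
    by (intro runs_in_While[where S = "\<lambda>i. (R(r := v - i), p - i, out)"])
      (simp_all, (rule runs_in_Seq1, rule runs_in_atoms)+,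
        auto intro!: runs_in_basic simp: fun_eq_iff)
  then show ?thesis by (rule runs_in_mono) simp
qed

text \<open>Reading a register by counting destroys it. The value is moved to both \<open>d\<close>
  and \<open>d + 1\<close>, at 5 steps per unit, and moved back from \<open>d + 1\<close>, at 4
  steps per unit; the two failing tests give the constant 2.\<close>

lemma compiles_Var: "compiles (Var i) [:2, 9:]"
  unfolding compiles_def
proof (intro allI impI)
  fix x :: "bool list" and \<rho> :: "nat list" and d :: nat and R e :: "nat \<Rightarrow> nat" and B and out :: "bool list"
  assume \<rho>: "\<forall>i<length \<rho>. \<rho> ! i < d \<and> R (\<rho> ! i) = e i" and e: "\<forall>i\<ge>length \<rho>. e i = 0"
    and R: "\<forall>r\<ge>d. R r = (0::nat)" and B: "\<forall>i. e i \<le> B"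
  show "ev x e (Var i) \<le> poly [:2, 9:] B \<and>
     runs_in x (compile (Var i) \<rho> d) (R, 0, out) (poly [:2, 9:] B) (R(d := ev x e (Var i)), 0, out)"
  proof (cases "i < length \<rho>")
    case True
    define r where "r = \<rho> ! i"
    have r: "r < d" "R r = e i" using \<rho> True by (auto simp: r_def)
    let ?R = "R(r := 0, d := e i, Suc d := e i)"
    have 1: "runs_in x (While (Nonzero r) (Seq (Dec r) (Seq (Inc d) (Inc (Suc d))))) (R, 0, out)
        (e i * ((1 + (1 + 1)) + 2) + 1) (?R, 0, out)"
      using r R
      by (intro runs_in_While[where S = "\<lambda>j. (R(r := e i - j, d := j, Suc d := j), 0, out)"])
        (simp_all, (rule runs_in_Seq1, rule runs_in_atoms)+,
        auto intro!: runs_in_basic simp: fun_eq_iff)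
    have 2: "runs_in x (While (Nonzero (Suc d)) (Seq (Dec (Suc d)) (Inc r))) (?R, 0, out)
        (4 * e i + 1) (?R(Suc d := 0, r := ?R r + e i), 0, out)"
      using r by (intro runs_in_add_loop) auto
    have 3: "?R(Suc d := 0, r := ?R r + e i) = R(d := e i)"
      using r R by (auto simp: fun_eq_iff)
    have "runs_in x (compile (Var i) \<rho> d) (R, 0, out)
        ((e i * ((1 + (1 + 1)) + 2) + 1) + (4 * e i + 1)) (R(d := e i), 0, out)"
      using runs_in_Seq[OF 1 2[unfolded 3]] True by (simp only: compile.simps if_True r_def)
    moreover have "(e i * ((1 + (1 + 1)) + 2) + 1) + (4 * e i + 1) \<le> poly [:2, 9:] B"
      using B[rule_format, of i] by simp
    ultimately show ?thesis
      using B[rule_format, of i] by (auto intro: runs_in_mono)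
  next
    case False
    then have "R(d := e i) = R" using e R by (auto simp: fun_eq_iff)
    then show ?thesis
      using B[rule_format, of i] False by (auto intro: runs_in_mono[OF runs_in_Skip])
  qed
qed

lemma compiles_Len: "compiles Len [:2, 9:]"
  unfolding compiles_def
proof (intro allI impI)
  fix x :: "bool list" and \<rho> :: "nat list" and d :: nat and R e :: "nat \<Rightarrow> nat" and B and out :: "bool list"
  assume R: "\<forall>r\<ge>d. R r = (0::nat)" and B: "length x \<le> B"
  let ?R = "R(d := length x, Suc d := length x)"
  have 1: "runs_in x (While In_Cell (Seq In_Right (Seq (Inc d) (Inc (Suc d))))) (R, 0, out)
      (length x * ((1 + (1 + 1)) + 2) + 1) (?R, length x, out)"
    using R
    by (intro runs_in_While[where S = "\<lambda>j. (R(d := j, Suc d := j), j, out)"])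
      (simp_all, (rule runs_in_Seq1, rule runs_in_atoms)+,
        auto intro!: runs_in_basic simp: fun_eq_iff)
  have 2: "runs_in x (While (Nonzero (Suc d)) (Seq (Dec (Suc d)) In_Left)) (?R, length x, out)
      (4 * length x + 1) (?R(Suc d := 0), 0, out)"
    using runs_in_back_loop[of ?R "Suc d" "length x" "length x"] by simp
  have 3: "?R(Suc d := 0) = R(d := length x)"
    using R by (auto simp: fun_eq_iff)
  have "runs_in x (compile Len \<rho> d) (R, 0, out)
      ((length x * ((1 + (1 + 1)) + 2) + 1) + (4 * length x + 1)) (R(d := length x), 0, out)"
    using runs_in_Seq[OF 1 2[unfolded 3]] by (simp only: compile.simps)
  then show "ev x e Len \<le> poly [:2, 9:] B \<and>
      runs_in x (compile Len \<rho> d) (R, 0, out) (poly [:2, 9:] B) (R(d := ev x e Len), 0, out)"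
    using B by (auto intro: runs_in_mono)
qed

text \<open>The head walks to the requested position while register \<open>d + 2\<close> records the
  way back. Past the end of the input \<open>In_True\<close> fails, in agreement with
  \<open>bt\<close>.\<close>

lemma compiles_Bit:
  assumes "compiles a P"
  shows "compiles (Bit a) (smult 10 P + [:4:])"
  unfolding compiles_def
proof (intro allI impI)
  fix x :: "bool list" and \<rho> :: "nat list" and d :: nat and R e :: "nat \<Rightarrow> nat" and B and out :: "bool list"
  assume *: "\<forall>i<length \<rho>. \<rho> ! i < d \<and> R (\<rho> ! i) = e i" "\<forall>i\<ge>length \<rho>. e i = 0"
    "\<forall>r\<ge>d. R r = (0::nat)" "length x \<le> B" "\<forall>i. e i \<le> B"
  define v where "v = ev x e a"
  have up: "\<forall>i<length \<rho>. \<rho> ! i < d + 1 \<and> R (\<rho> ! i) = e i" "\<forall>r\<ge>d + 1. R r = 0"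
    using *(1,3) by (auto intro: less_SucI)
  have 1: "v \<le> poly P B"
    "runs_in x (compile a \<rho> (d + 1)) (R, 0, out) (poly P B) (R(d + 1 := v), 0, out)"
    using compilesD[OF assms up(1) *(2) up(2) *(4,5), of out] unfolding v_def by simp_all
  have 2: "runs_in x (While (Nonzero (d + 1)) (Seq (Dec (d + 1)) (Seq (Inc (d + 2)) In_Right)))
      (R(d + 1 := v), 0, out) (v * ((1 + (1 + 1)) + 2) + 1) (R(d + 2 := v), v, out)"
    using *(3)
    by (intro runs_in_While[where S = "\<lambda>j. (R(d + 1 := v - j, d + 2 := j), j, out)"])
      (simp_all, (rule runs_in_Seq1, rule runs_in_atoms)+,
        auto intro!: runs_in_basic simp: fun_eq_iff)
  let ?R = "R(d := of_bool (bt x v), d + 2 := v)"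
  have 3: "runs_in x (If In_True (Inc d)) (R(d + 2 := v), v, out) 2 (?R, v, out)"
  proof (cases "bt x v")
    case True
    then have "runs_in x (If In_True (Inc d)) (R(d + 2 := v), v, out) (Suc 1) (?R, v, out)"
      using *(3) by (intro runs_in_If_True runs_in_Inc) (auto simp: bt_def fun_eq_iff)
    then show ?thesis by (simp add: numeral_2_eq_2)
  next
    case False
    then have "runs_in x (If In_True (Inc d)) (R(d + 2 := v), v, out) 1 (?R, v, out)"
      using *(3) by (intro runs_in_If_False) (auto simp: bt_def fun_eq_iff)
    then show ?thesis by (rule runs_in_mono) simp
  qed
  have 4: "runs_in x (While (Nonzero (d + 2)) (Seq (Dec (d + 2)) In_Left)) (?R, v, out)
      (4 * v + 1) (?R(d + 2 := 0), v - v, out)"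
    by (intro runs_in_back_loop) auto
  have "?R(d + 2 := 0) = R(d := of_bool (bt x v))"
    using *(3) by (auto simp: fun_eq_iff)
  with 1(2) 2 3 4 have "runs_in x (compile (Bit a) \<rho> d) (R, 0, out)
      (poly P B + ((v * ((1 + (1 + 1)) + 2) + 1) + (2 + (4 * v + 1)))) (R(d := of_bool (bt x v)), 0, out)"
    unfolding compile.simps by (intro runs_in_Seq) auto
  moreover have "poly P B + ((v * ((1 + (1 + 1)) + 2) + 1) + (2 + (4 * v + 1))) \<le>
      poly (smult 10 P + [:4:]) B"
    using 1(1) by simp
  ultimately show "ev x e (Bit a) \<le> poly (smult 10 P + [:4:]) B \<and>
      runs_in x (compile (Bit a) \<rho> d) (R, 0, out) (poly (smult 10 P + [:4:]) B)
        (R(d := ev x e (Bit a)), 0, out)"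
    using 1(1) unfolding v_def ev.simps by (auto intro: runs_in_mono)
qed

lemma compiles_Add_Sub:
  assumes "compiles a P" "compiles b Q"
  shows "compiles (Add a b) (P + smult 5 Q + [:1:])" "compiles (Sub a b) (P + smult 5 Q + [:1:])"
proof -
  let ?Q = "P + smult 5 Q + [:1:]"
  have "ev x e (Add a b) \<le> poly ?Q B \<and> ev x e (Sub a b) \<le> poly ?Q B \<and>
      runs_in x (compile (Add a b) \<rho> d) (R, 0, out) (poly ?Q B) (R(d := ev x e (Add a b)), 0, out) \<and>
      runs_in x (compile (Sub a b) \<rho> d) (R, 0, out) (poly ?Q B) (R(d := ev x e (Sub a b)), 0, out)"
    if *: "\<forall>i<length \<rho>. \<rho> ! i < d \<and> R (\<rho> ! i) = e i" "\<forall>i\<ge>length \<rho>. e i = 0"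
    "\<forall>r\<ge>d. R r = (0::nat)" "length x \<le> B" "\<forall>i. e i \<le> B" for x \<rho> d R e B out
  proof -
    define v w where "v = ev x e a" and "w = ev x e b"
    have 1: "v \<le> poly P B"
      "runs_in x (compile a \<rho> d) (R, 0, out) (poly P B) (R(d := v), 0, out)"
      using compilesD[OF assms(1) *, of out] unfolding v_def by simp_all
    have up: "\<forall>i<length \<rho>. \<rho> ! i < d + 1 \<and> (R(d := v)) (\<rho> ! i) = e i"
      "\<forall>r\<ge>d + 1. (R(d := v)) r = 0"
      using *(1,3) by (auto intro: less_SucI)
    have 2: "w \<le> poly Q B" "runs_in x (compile b \<rho> (d + 1)) (R(d := v), 0, out) (poly Q B)
        (R(d := v, d + 1 := w), 0, out)"
      using compilesD[where R = "R(d := v)", OF assms(2) up(1) *(2) up(2) *(4,5), of out]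
      unfolding w_def by simp_all
    let ?R = "R(d := v, d + 1 := w)"
    have "runs_in x (While (Nonzero (d + 1)) (Seq (Dec (d + 1)) (Inc d))) (?R, 0, out) (4 * w + 1)
        (?R(d + 1 := 0, d := ?R d + w), 0, out)"
      by (rule runs_in_add_loop) auto
    moreover have "?R(d + 1 := 0, d := ?R d + w) = R(d := v + w)"
      using *(3) by (auto simp: fun_eq_iff)
    ultimately have add: "runs_in x (compile (Add a b) \<rho> d) (R, 0, out)
        (poly P B + (poly Q B + (4 * w + 1))) (R(d := v + w), 0, out)"
      unfolding compile.simps using 1(2) 2(2) by (intro runs_in_Seq) auto
    have "runs_in x (While (Nonzero (d + 1)) (Seq (Dec (d + 1)) (Dec d))) (?R, 0, out) (4 * w + 1)
        (?R(d + 1 := 0, d := ?R d - w), 0, out)"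
      by (rule runs_in_sub_loop) auto
    moreover have "?R(d + 1 := 0, d := ?R d - w) = R(d := v - w)"
      using *(3) by (auto simp: fun_eq_iff)
    ultimately have sub: "runs_in x (compile (Sub a b) \<rho> d) (R, 0, out)
        (poly P B + (poly Q B + (4 * w + 1))) (R(d := v - w), 0, out)"
      unfolding compile.simps using 1(2) 2(2) by (intro runs_in_Seq) auto
    have "poly P B + (poly Q B + (4 * w + 1)) \<le> poly ?Q B"
      using 2(1) by simp
    then show ?thesis
      using 1(1) 2(1) add sub unfolding ev.simps v_def[symmetric] w_def[symmetric]
      by (auto intro: runs_in_mono)
  qed
  then show "compiles (Add a b) ?Q" "compiles (Sub a b) ?Q"
    unfolding compiles_def by blast+
qed

text \<open>Inside the sum the index is a new variable with values below \<open>poly P B\<close>;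
  hence the summand is bounded at \<open>P + [:0, 1:]\<close>, that is at
  \<open>poly P B + B\<close>, which explains the composition.\<close>

lemma compiles_Sum:
  assumes "compiles a P" "compiles b Q"
  defines "Q' \<equiv> pcompose Q (P + [:0, 1:])"
  shows "compiles (Sum a b) (P * (smult 5 Q' + [:9:]) + [:2:])"
  unfolding compiles_def
proof (intro allI impI)
  fix x :: "bool list" and \<rho> :: "nat list" and d :: nat and R e :: "nat \<Rightarrow> nat" and B and out :: "bool list"
  assume *: "\<forall>i<length \<rho>. \<rho> ! i < d \<and> R (\<rho> ! i) = e i" "\<forall>i\<ge>length \<rho>. e i = 0"
    "\<forall>r\<ge>d. R r = (0::nat)" "length x \<le> B" "\<forall>i. e i \<le> B"
  have up: "\<forall>i<length \<rho>. \<rho> ! i < d + 1 \<and> R (\<rho> ! i) = e i" "\<forall>r\<ge>d + 1. R r = 0"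
    using *(1,3) by (auto intro: less_SucI)
  let ?P = "P * (smult 5 Q' + [:9:]) + [:2:]"
  let ?body = "Seq (compile b ((d + 2) # \<rho>) (d + 3))
    (Seq (While (Nonzero (d + 3)) (Seq (Dec (d + 3)) (Inc d))) (Seq (Dec (d + 1)) (Inc (d + 2))))"
  define N where "N = ev x e a"
  define w where "w i = ev x (case_nat i e) b" for i
  have 1: "N \<le> poly P B"
    "runs_in x (compile a \<rho> (d + 1)) (R, 0, out) (poly P B) (R(d + 1 := N), 0, out)"
    using compilesD[OF assms(1) up(1) *(2) up(2) *(4,5), of out] unfolding N_def by simp_all
  \<comment> \<open>Register \<open>d\<close> holds the partial sum, \<open>d + 1\<close> the number
    of remaining rounds, and \<open>d + 2\<close> the index, which is variable 0 of the
    summand.\<close>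
  let ?S = "\<lambda>i. R(d := sum w {..<i}, d + 1 := N - i, d + 2 := i)"
  have body: "w i \<le> poly Q' B \<and>
      runs_in x (compile b ((d + 2) # \<rho>) (d + 3)) (?S i, 0, out) (poly Q' B) ((?S i)(d + 3 := w i), 0, out)"
    if "i < N" for i
  proof -
    have env: "\<forall>j<length ((d + 2) # \<rho>). ((d + 2) # \<rho>) ! j < d + 3 \<and>
        ?S i (((d + 2) # \<rho>) ! j) = case_nat i e j"
      using *(1) by (fastforce simp: nth_Cons split: nat.splits)
    have "\<forall>j\<ge>length ((d + 2) # \<rho>). case_nat i e j = 0"
      using *(2) by (auto split: nat.splits)
    moreover have "\<forall>r\<ge>d + 3. ?S i r = 0"
      using *(3) by auto
    moreover have "length x \<le> poly (P + [:0, 1:]) B" "\<forall>j. case_nat i e j \<le> poly (P + [:0, 1:]) B"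
      using *(4,5) that 1(1) by (auto split: nat.splits intro: trans_le_add2)
    ultimately show ?thesis
      using compilesD[OF assms(2) env, of x "poly (P + [:0, 1:]) B" out]
      unfolding w_def Q'_def poly_pcompose by blast
  qed
  have step: "runs_in x ?body
      (?S i, 0, out) (poly Q' B + ((4 * poly Q' B + 1) + (1 + 1))) (?S (Suc i), 0, out)"
    if "i < N" for i
  proof (intro runs_in_Seq)
    let ?R = "(?S i)(d + 3 := w i)"
    let ?R' = "?R(d + 3 := 0, d := ?R d + w i)"
    show "runs_in x (compile b ((d + 2) # \<rho>) (d + 3)) (?S i, 0, out) (poly Q' B) (?R, 0, out)"
      using body[OF that] by blast
    have "runs_in x (While (Nonzero (d + 3)) (Seq (Dec (d + 3)) (Inc d))) (?R, 0, out) (4 * w i + 1)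
       (?R', 0, out)"
      by (rule runs_in_add_loop) auto
    then show "runs_in x (While (Nonzero (d + 3)) (Seq (Dec (d + 3)) (Inc d))) (?R, 0, out)
        (4 * poly Q' B + 1) (?R', 0, out)"
      by (rule runs_in_mono) (use body[OF that] in auto)
    show "runs_in x (Dec (d + 1)) (?R', 0, out) 1 (?R'(d + 1 := ?R' (d + 1) - 1), 0, out)"
      by (rule runs_in_Dec) simp_all
    show "runs_in x (Inc (d + 2)) (?R'(d + 1 := ?R' (d + 1) - 1), 0, out) 1 (?S (Suc i), 0, out)"
      by (rule runs_in_Inc, goal_cases) (use *(3) in \<open>auto simp: fun_eq_iff\<close>)
  qed
  have 2: "runs_in x (While (Nonzero (d + 1)) ?body)
      (R(d + 1 := N), 0, out) (N * ((poly Q' B + ((4 * poly Q' B + 1) + (1 + 1))) + 2) + 1) (?S N, 0, out)"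
  proof (rule runs_in_While[where S = "\<lambda>i. (?S i, 0, out)"])
    show "(?S 0, 0, out) = (R(d + 1 := N), 0, out)"
      using *(3) by (auto simp: fun_eq_iff)
    show "runs_in x ?body
      (?S i, 0, out) (poly Q' B + ((4 * poly Q' B + 1) + (1 + 1))) (?S (Suc i), 0, out)"
      if "i < N" for i
      using step[OF that] .
  qed auto
  have 3: "runs_in x (While (Nonzero (d + 2)) (Dec (d + 2))) (?S N, 0, out) (N * (1 + 2) + 1)
      (R(d := sum w {..<N}), 0, out)"
    using *(3)
    by (intro runs_in_While[where S = "\<lambda>i. (R(d := sum w {..<N}, d + 2 := N - i), 0, out)"])
      (auto intro!: runs_in_Dec simp: fun_eq_iff)
  have "runs_in x (compile (Sum a b) \<rho> d) (R, 0, out)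
      (poly P B + ((N * ((poly Q' B + ((4 * poly Q' B + 1) + (1 + 1))) + 2) + 1) + (N * (1 + 2) + 1)))
      (R(d := sum w {..<N}), 0, out)"
    unfolding compile.simps by (rule runs_in_Seq[OF 1(2) runs_in_Seq[OF 2 3]])
  moreover have "poly P B + ((N * ((poly Q' B + ((4 * poly Q' B + 1) + (1 + 1))) + 2) + 1) + (N * (1 + 2) + 1))
      \<le> poly ?P B" (is "?lhs \<le> _")
  proof -
    have "?lhs = poly P B + N * (5 * poly Q' B + 8) + 2"
      by (simp add: algebra_simps)
    also have "\<dots> \<le> poly P B + poly P B * (5 * poly Q' B + 8) + 2"
      using 1(1) by (intro add_mono mult_right_mono) auto
    finally show ?thesis by (simp add: algebra_simps)
  qed
  moreover have "sum w {..<N} \<le> poly ?P B"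
  proof -
    have "sum w {..<N} \<le> N * poly Q' B"
      using sum_bounded_above[of "{..<N}" w "poly Q' B"] body by auto
    also have "\<dots> \<le> poly P B * poly Q' B"
      using 1(1) by (rule mult_right_mono) simp
    finally show ?thesis by (simp add: algebra_simps)
  qed
  ultimately show "ev x e (Sum a b) \<le> poly ?P B \<and>
      runs_in x (compile (Sum a b) \<rho> d) (R, 0, out) (poly ?P B)
        (R(d := ev x e (Sum a b)), 0, out)"
    unfolding ev.simps w_def[symmetric] N_def[symmetric] by (blast intro: runs_in_mono)
qed

lemma ex_compiles: "\<exists>P. compiles E P"
proof (induction E)
  case (Cst c)
  have "compiles (Cst c) [:c:]"
    unfolding compiles_def
  proof (intro allI impI)
    fix x :: "bool list" and \<rho> :: "nat list" and d :: nat and R e :: "nat \<Rightarrow> nat" and B out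
    assume "\<forall>r\<ge>d. R r = 0"
    then show "ev x e (Cst c) \<le> poly [:c:] B \<and>
        runs_in x (compile (Cst c) \<rho> d) (R, 0, out) (poly [:c:] B) (R(d := ev x e (Cst c)), 0, out)"
      using runs_in_incs[of x d c R 0 out] by simp
  qed
  then show ?case ..
qed (blast intro: compiles_Var compiles_Len compiles_Bit compiles_Add_Sub compiles_Sum)+

lemma ex_poly_time:
  assumes len: "\<And>x. ev x (\<lambda>_. 0) L = length (f x)"
    and bit: "\<And>x i. ev x (case_nat i (\<lambda>_. 0)) G = of_bool (bt (f x) i)"
  shows "poly_time f"
proof -
  obtain P Q where P: "compiles L P" and Q: "compiles G Q"
    using ex_compiles by blast
  define Q' where "Q' = pcompose Q (P + [:0, 1:])"
  \<comment> \<open>Register 0 counts the bits still to be written and register 1 is the index.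
    \<open>If\<close> has no alternative branch: register 3 is set to 1 and cleared together with
    register 2 if the bit is \<open>True\<close>, so a test of register 3 covers the other
    case.\<close>
  define body where "body = Seq (compile G [1] 2) (Seq (Inc 3)
    (Seq (If (Nonzero 2) (Seq (Out True) (Seq (Dec 2) (Dec 3))))
    (Seq (If (Nonzero 3) (Seq (Out False) (Dec 3))) (Seq (Dec 0) (Inc 1)))))"
  show ?thesis
  proof (rule runs_poly_time)
    fix x
    define N where "N = length (f x)"
    define B where "B = poly (P + [:0, 1:]) (length x)"
    let ?t = "poly Q B + (1 + (Suc (1 + (1 + 1)) + (Suc (1 + 1) + (1 + 1))))"
    let ?Z = "\<lambda>_::nat. 0::nat" and ?out = "\<lambda>i. take i (f x)"
    have 1: "N \<le> poly P (length x)" "runs_in x (compile L [] 0) (?Z, 0, []) (poly P (length x)) (?Z(0 := N), 0, [])"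
      using compilesD[OF P, of "[]" 0 ?Z ?Z x "length x" "[]"] by (auto simp: len N_def)
    have "runs_in x body (?Z(0 := N - i, 1 := i), 0, ?out i)
        ?t
        (?Z(0 := N - Suc i, 1 := Suc i), 0, ?out (Suc i))" if i: "i < N" for i
      unfolding body_def
    proof (intro runs_in_Seq)
      let ?R = "?Z(0 := N - i, 1 := i)"
      let ?b = "f x ! i"
      show "runs_in x (compile G [1] 2) (?R, 0, ?out i) (poly Q B)
          (?R(2 := of_bool ?b), 0, ?out i)"
        using compilesD[OF Q, of "[1]" 2 ?R "case_nat i ?Z" x B "?out i"] 1(1) i
        by (auto simp: bit bt_def N_def B_def split: nat.splits)
      show "runs_in x (Inc 3) (?R(2 := of_bool ?b), 0, ?out i) 1
          (?R(2 := of_bool ?b, 3 := 1), 0, ?out i)"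
        by (rule runs_in_Inc, goal_cases) (auto simp: fun_eq_iff)
      show "runs_in x (If (Nonzero 2) (Seq (Out True) (Seq (Dec 2) (Dec 3))))
          (?R(2 := of_bool ?b, 3 := 1), 0, ?out i) (Suc (1 + (1 + 1)))
          (?R(3 := of_bool (\<not> ?b)), 0, ?out i @ (if ?b then [True] else []))"
      proof (cases ?b)
        case True
        show ?thesis
          by (rule runs_in_If_True, simp add: True, (rule runs_in_Seq1, rule runs_in_atoms)+,
            auto intro!: runs_in_Dec simp: fun_eq_iff True)
      next
        case False
        then show ?thesis
          by (intro runs_in_mono[OF runs_in_If_False]) (auto simp: fun_eq_iff)
      qed
      show "runs_in x (If (Nonzero 3) (Seq (Out False) (Dec 3)))
          (?R(3 := of_bool (\<not> ?b)), 0, ?out i @ (if ?b then [True] else [])) (Suc (1 + 1))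
          (?R, 0, ?out (Suc i))"
      proof (cases ?b)
        case True
        then show ?thesis using i
          by (intro runs_in_mono[OF runs_in_If_False]) (auto simp: fun_eq_iff take_Suc_conv_app_nth N_def)
      next
        case False
        show ?thesis
          by (rule runs_in_If_True, simp add: False, (rule runs_in_Seq1, rule runs_in_atoms)+,
            use i in \<open>auto intro!: runs_in_Dec simp: fun_eq_iff take_Suc_conv_app_nth N_def False\<close>)
      qed
      show "runs_in x (Dec 0) (?R, 0, ?out (Suc i)) 1 (?R(0 := ?R 0 - 1), 0, ?out (Suc i))"
        by (rule runs_in_Dec) simp_all
      show "runs_in x (Inc 1) (?R(0 := ?R 0 - 1), 0, ?out (Suc i)) 1
         (?Z(0 := N - Suc i, 1 := Suc i), 0, ?out (Suc i))"
        by (rule runs_in_Inc, goal_cases) (auto simp: fun_eq_iff)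
    qed
    then have "runs_in x (While (Nonzero 0) body) (?Z(0 := N), 0, [])
       (N * (?t + 2) + 1)
       (?Z(0 := 0, 1 := N), 0, f x)"
      by (intro runs_in_While[where S = "\<lambda>i. (?Z(0 := N - i, 1 := i), 0, ?out i)"])
        (auto simp: N_def fun_eq_iff)
    from runs_in_Seq[OF 1(2) this]
    obtain n where "n \<le> poly P (length x) +
       (N * (?t + 2) + 1)"
      and n: "runs x (Seq (compile L [] 0) (While (Nonzero 0) body)) (?Z, 0, []) n (?Z(0 := 0, 1 := N), 0, f x)"
      unfolding runs_in_def by blast
    then have "n \<le> poly P (length x) + (N * (poly Q B + 12) + 1)" by (simp add: algebra_simps)
    also have "\<dots> \<le> poly P (length x) + (poly P (length x) * (poly Q B + 12) + 1)"
      using 1(1) by (intro add_mono mult_mono) auto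
    also have "\<dots> = poly (P * Q' + smult 13 P + [:1:]) (length x)"
      by (simp add: Q'_def B_def poly_pcompose algebra_simps)
    finally show "\<exists>n R p. n \<le> poly (P * Q' + smult 13 P + [:1:]) (length x) \<and>
        runs x (Seq (compile L [] 0) (While (Nonzero 0) body)) (?Z, 0, []) n (R, p, f x)"
      using n by blast
  qed
qed

section \<open>Renaming and substitution of variables\<close>

fun rename :: "(nat \<Rightarrow> nat) \<Rightarrow> ex \<Rightarrow> ex" where
  "rename r (Var i) = Var (r i)"
| "rename r (Cst c) = Cst c"
| "rename r Len = Len"
| "rename r (Bit a) = Bit (rename r a)"
| "rename r (Add a b) = Add (rename r a) (rename r b)"
| "rename r (Sub a b) = Sub (rename r a) (rename r b)"
| "rename r (Sum a b) = Sum (rename r a) (rename (case_nat 0 (\<lambda>i. Suc (r i))) b)"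

lemma ev_rename: "ev x e (rename r E) = ev x (\<lambda>i. e (r i)) E"
proof (induction E arbitrary: e r)
  case (Sum a b)
  have "(\<lambda>j. case_nat i e (case_nat 0 (\<lambda>j. Suc (r j)) j)) = case_nat i (\<lambda>j. e (r j))" for i
    by (auto simp: fun_eq_iff split: nat.splits)
  then show ?case using Sum by simp
qed auto

fun substitute :: "(nat \<Rightarrow> ex) \<Rightarrow> ex \<Rightarrow> ex" where
  "substitute s (Var i) = s i"
| "substitute s (Cst c) = Cst c"
| "substitute s Len = Len"
| "substitute s (Bit a) = Bit (substitute s a)"
| "substitute s (Add a b) = Add (substitute s a) (substitute s b)"
| "substitute s (Sub a b) = Sub (substitute s a) (substitute s b)"
| "substitute s (Sum a b) =
     Sum (substitute s a) (substitute (case_nat (Var 0) (\<lambda>i. rename Suc (s i))) b)"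

lemma ev_substitute: "ev x e (substitute s E) = ev x (\<lambda>i. ev x e (s i)) E"
proof (induction E arbitrary: e s)
  case (Sum a b)
  have "(\<lambda>j. ev x (case_nat i e) (case_nat (Var 0) (\<lambda>j. rename Suc (s j)) j)) =
      case_nat i (\<lambda>j. ev x e (s j))" for i
    by (auto simp: fun_eq_iff ev_rename split: nat.splits)
  then show ?case using Sum by simp
qed auto

section \<open>Closure properties of expressible functions\<close>

text \<open>\<open>vh\<close> and \<open>vt\<close> play the roles of \<open>hd\<close> and \<open>tl\<close> on environments. Being constants, they
  let the introduction rules below apply by higher-order pattern unification. The predicates \<open>pt\<close>,
  \<open>pp\<close> and \<open>pl\<close> say that a number, a truth value or a word is expressible.\<close>

type_synonym env = "nat \<Rightarrow> nat"

definition vh :: "env \<Rightarrow> nat" where "vh e = e 0"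
definition vt :: "env \<Rightarrow> env" where "vt e = (\<lambda>i. e (Suc i))"

lemma vh_case_nat [simp]: "vh (case_nat i e) = i"
  by (simp add: vh_def)

lemma vt_case_nat [simp]: "vt (case_nat i e) = e"
  by (simp add: vt_def)

definition pt :: "(bool list \<Rightarrow> env \<Rightarrow> nat) \<Rightarrow> bool" where
  "pt f \<longleftrightarrow> (\<exists>E. \<forall>x e. ev x e E = f x e)"

definition pp :: "(bool list \<Rightarrow> env \<Rightarrow> bool) \<Rightarrow> bool" where
  "pp P \<longleftrightarrow> pt (\<lambda>x e. of_bool (P x e))"

definition pl :: "(bool list \<Rightarrow> env \<Rightarrow> bool list) \<Rightarrow> bool" where
  "pl F \<longleftrightarrow> pt (\<lambda>x e. length (F x e)) \<and> pp (\<lambda>x e. bt (F x (vt e)) (vh e))"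

text \<open>These are the iterates of \<open>vt\<close>. With \<open>pt_var\<close> they make every
  bound variable expressible, under any number of further binders.\<close>

definition pv :: "(env \<Rightarrow> env) \<Rightarrow> bool" where
  "pv s \<longleftrightarrow> (\<exists>k. s = (\<lambda>e i. e (i + k)))"

lemma pv_id: "pv (\<lambda>e. e)"
  unfolding pv_def by (rule exI[of _ 0]) simp

lemma pv_vt: "pv s \<Longrightarrow> pv (\<lambda>e. vt (s e))"
  unfolding pv_def vt_def by (metis add_Suc add_Suc_shift)

lemma pt_var: "pv s \<Longrightarrow> pt (\<lambda>x e. vh (s e))"
  unfolding pv_def pt_def vh_def by (metis add_0 ev.simps(1))

lemma pt_const: "pt (\<lambda>x e. c)"
  unfolding pt_def by (metis ev.simps(2))

lemma pt_len: "pt (\<lambda>x e. length x)"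
  unfolding pt_def by (metis ev.simps(3))

lemma pt_add: "pt f \<Longrightarrow> pt g \<Longrightarrow> pt (\<lambda>x e. f x e + g x e)"
  unfolding pt_def by (metis ev.simps(5))

lemma pt_sub: "pt f \<Longrightarrow> pt g \<Longrightarrow> pt (\<lambda>x e. f x e - g x e)"
  unfolding pt_def by (metis ev.simps(6))

lemma pt_Suc: "pt f \<Longrightarrow> pt (\<lambda>x e. Suc (f x e))"
  using pt_add[OF _ pt_const[of 1]] by simp

definition pe :: "(bool list \<Rightarrow> env \<Rightarrow> env) \<Rightarrow> bool" where
  "pe s \<longleftrightarrow> (\<forall>i. pt (\<lambda>x e. s x e i))"

lemma pe_id: "pe (\<lambda>x e. e)"
  unfolding pe_def pt_def by (metis ev.simps(1))

lemma pe_vt: "pe (\<lambda>x. vt)"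
  using pe_id by (simp add: pe_def vt_def)

lemma pe_case_nat:
  assumes "pt f" "pe s"
  shows "pe (\<lambda>x e. case_nat (f x e) (s x e))"
  unfolding pe_def
proof
  show "pt (\<lambda>x e. case_nat (f x e) (s x e) i)" for i
    using assms by (cases i) (simp_all add: pe_def)
qed

text \<open>Composition is simultaneous substitution of expressions for all variables.\<close>

lemma pt_comp_env:
  assumes "pt h" "pe s"
  shows "pt (\<lambda>x e. h x (s x e))"
proof -
  obtain E where E: "\<And>x e. ev x e E = h x e" using assms(1) unfolding pt_def by blast
  obtain S where S: "\<And>i x e. ev x e (S i) = s x e i" using assms(2) unfolding pe_def pt_def by metis
  have "ev x e (substitute S E) = h x (s x e)" for x e
    by (simp add: ev_substitute S E)
  then show ?thesis unfolding pt_def by blast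
qed

lemma pe_comp_vt: "pe s \<Longrightarrow> pe (\<lambda>x e. s x (vt e))"
  using pt_comp_env[OF _ pe_vt] unfolding pe_def by blast

lemma pt_vt: "pt f \<Longrightarrow> pt (\<lambda>x e. f x (vt e))"
  by (rule pt_comp_env[OF _ pe_vt])

lemma pt_comp: "pt (\<lambda>x e. h x (vt e) (vh e)) \<Longrightarrow> pt f \<Longrightarrow> pt (\<lambda>x e. h x e (f x e))"
  using pt_comp_env[OF _ pe_case_nat[OF _ pe_id], of "\<lambda>x e. h x (vt e) (vh e)" f] by simp

lemma pt_sum:
  assumes "pt f" "pt (\<lambda>x e. g x (vt e) (vh e))"
  shows "pt (\<lambda>x e. \<Sum>i<f x e. g x e i)"
proof -
  obtain E where E: "\<And>x e. ev x e E = f x e" using assms(1) unfolding pt_def by blast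
  obtain G where G: "\<And>x e. ev x e G = g x (vt e) (vh e)" using assms(2) unfolding pt_def by blast
  have "ev x e (Sum E G) = (\<Sum>i<f x e. g x e i)" for x e
    by (simp add: E G)
  then show ?thesis unfolding pt_def by blast
qed

lemma pt_mult: "pt f \<Longrightarrow> pt g \<Longrightarrow> pt (\<lambda>x e. f x e * g x e)"
  using pt_sum[of f "\<lambda>x e i. g x e"] pt_vt[of g] by simp

lemma pt_poly: "pt f \<Longrightarrow> pt (\<lambda>x e. poly p (f x e))"
  by (induction p) (auto intro: pt_mult pt_const pt_add)

lemma pt_of_bool: "pp P \<Longrightarrow> pt (\<lambda>x e. of_bool (P x e))"
  by (simp add: pp_def)

lemma pp_pt:
  assumes "pt f" "\<And>x e. f x e = of_bool (P x e)"
  shows "pp P"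
proof -
  have "(\<lambda>x e. of_bool (P x e)) = f"
    by (intro ext) (rule assms(2)[symmetric])
  then show ?thesis using assms(1) by (simp only: pp_def)
qed

lemma pp_const: "pp (\<lambda>x e. c)"
  unfolding pp_def by (rule pt_const)

lemma pp_not: "pp P \<Longrightarrow> pp (\<lambda>x e. \<not> P x e)"
  by (rule pp_pt[OF pt_sub[OF pt_const[of 1] pt_of_bool]]) auto

lemma pp_conj:
  assumes "pp P" "pp Q"
  shows "pp (\<lambda>x e. P x e \<and> Q x e)"
proof (rule pp_pt)
  show "pt (\<lambda>x e. of_bool (P x e) * of_bool (Q x e))"
    by (intro pt_mult pt_of_bool assms)
qed (simp add: of_bool_conj)

lemma pp_disj:
  assumes "pp P" "pp Q"
  shows "pp (\<lambda>x e. P x e \<or> Q x e)"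
proof (rule pp_pt)
  show "pt (\<lambda>x e. 1 - (1 - of_bool (P x e)) * (1 - of_bool (Q x e)))"
    by (intro pt_mult pt_sub pt_const pt_of_bool assms)
qed simp

lemma pp_imp: "pp P \<Longrightarrow> pp Q \<Longrightarrow> pp (\<lambda>x e. P x e \<longrightarrow> Q x e)"
  unfolding imp_conv_disj by (intro pp_disj pp_not)

lemma pp_le: "pt f \<Longrightarrow> pt g \<Longrightarrow> pp (\<lambda>x e. f x e \<le> g x e)"
  by (rule pp_pt[OF pt_sub[OF pt_const[of 1] pt_sub[of f g]]]) auto

lemma pp_less: "pt f \<Longrightarrow> pt g \<Longrightarrow> pp (\<lambda>x e. f x e < g x e)"
  using pp_not[OF pp_le[of g f]] by (simp add: not_le)

lemma pp_eq: "pt f \<Longrightarrow> pt g \<Longrightarrow> pp (\<lambda>x e. f x e = g x e)"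
  using pp_conj[OF pp_le[of f g] pp_le[of g f]] by (simp add: eq_iff[symmetric])

lemma pp_iff: "pp P \<Longrightarrow> pp Q \<Longrightarrow> pp (\<lambda>x e. P x e = Q x e)"
  using pp_conj[OF pp_imp[of P Q] pp_imp[of Q P]] unfolding iff_conv_conj_imp by blast

lemma pp_ex:
  assumes "pt f" "pp (\<lambda>x e. P x (vt e) (vh e))"
  shows "pp (\<lambda>x e. \<exists>i<f x e. P x e i)"
  by (rule pp_pt[OF pt_of_bool[OF pp_less[OF pt_const[of 0]
        pt_sum[OF assms(1) pt_of_bool[OF assms(2)]]]]])
    (auto simp: sum_eq_0_iff simp flip: neq0_conv)

lemma pp_all:
  assumes "pt f" "pp (\<lambda>x e. P x (vt e) (vh e))"
  shows "pp (\<lambda>x e. \<forall>i<f x e. P x e i)"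
  using pp_not[OF pp_ex[OF assms(1) pp_not[OF assms(2)]]] by simp

text \<open>The set is fixed, so the quantifier unrolls into a finite disjunction, and each
  \<open>P a\<close> may have an expression of its own. In this way the transition table of a fixed
  Turing machine enters an expression.\<close>

lemma pp_bex:
  assumes "finite A" "\<And>a. a \<in> A \<Longrightarrow> pp (P a)"
  shows "pp (\<lambda>x e. \<exists>a\<in>A. P a x e)"
  using assms by (induction A rule: finite_induct) (auto intro: pp_const pp_disj)

lemma pp_comp:
  assumes "pp (\<lambda>x e. h x (vt e) (vh e))" "pt f"
  shows "pp (\<lambda>x e. h x e (f x e))"
  using assms unfolding pp_def by (rule pt_comp)

lemma pt_if:
  assumes "pp P" "pt f" "pt g"
  shows "pt (\<lambda>x e. if P x e then f x e else g x e)"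
proof -
  have "pt (\<lambda>x e. of_bool (P x e) * f x e + of_bool (\<not> P x e) * g x e)"
    by (intro pt_add pt_mult pt_of_bool pp_not assms)
  moreover have "(\<lambda>x e. of_bool (P x e) * f x e + of_bool (\<not> P x e) * g x e) =
      (\<lambda>x e. if P x e then f x e else g x e)"
    by (auto simp: fun_eq_iff)
  ultimately show ?thesis by simp
qed

lemma pp_bt: "pt f \<Longrightarrow> pp (\<lambda>x e. bt x (f x e))"
  unfolding pp_def pt_def by (metis ev.simps(4))

text \<open>The quotient counts the \<open>i\<close> with \<open>Suc i * b \<le> a\<close>; the
  conjunct \<open>0 < b\<close> yields the value 0 for division by 0.\<close>

lemma pt_div:
  assumes "pt f" "pt g"
  shows "pt (\<lambda>x e. f x e div g x e)"
proof -
  have eq: "(\<Sum>i<a. of_bool (0 < b \<and> Suc i * b \<le> a)) = a div b" for a b :: nat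
  proof (cases "b = 0")
    case False
    then have h: "Suc i * b \<le> a \<longleftrightarrow> i < a div b" for i
      by (metis Suc_le_eq bot_nat_0.not_eq_extremum less_eq_div_iff_mult_less_eq)
    have "{..<a} \<inter> {i. 0 < b \<and> Suc i * b \<le> a} = {..<a div b}"
      unfolding h using False by (auto intro: less_le_trans[OF _ div_le_dividend])
    then show ?thesis by (simp only: sum_of_bool_eq finite_lessThan card_lessThan of_nat_id)
  qed simp
  have "pt (\<lambda>x e. \<Sum>i<f x e. of_bool (0 < g x e \<and> Suc i * g x e \<le> f x e))"
    by (intro pt_sum pt_of_bool pp_conj pp_less pp_le pt_const pt_mult pt_Suc pt_var pv_id
        assms assms[THEN pt_vt])
  then show ?thesis by (simp only: eq)
qed

lemma pt_mod: "pt f \<Longrightarrow> pt g \<Longrightarrow> pt (\<lambda>x e. f x e mod g x e)"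
  by (simp add: minus_mult_div_eq_mod[symmetric] pt_sub pt_mult pt_div)

lemma pp_dvd: "pt f \<Longrightarrow> pt g \<Longrightarrow> pp (\<lambda>x e. f x e dvd g x e)"
  by (simp add: dvd_eq_mod_eq_0 pp_eq pt_mod pt_const)

lemma pt_prod_encode: "pt f \<Longrightarrow> pt g \<Longrightarrow> pt (\<lambda>x e. prod_encode (f x e, g x e))"
  by (simp add: prod_encode_def triangle_def pt_add pt_div pt_mult pt_Suc pt_const)

section \<open>Expressible words\<close>

lemma bt_Nil [simp]: "\<not> bt [] i"
  by (simp add: bt_def)

lemma bt_append: "bt (a @ b) i \<longleftrightarrow> bt a i \<or> length a \<le> i \<and> bt b (i - length a)"
  by (auto simp: bt_def nth_append)

text \<open>Since \<open>bt\<close> is false past the end of a word, \<open>bt (g j)\<close> itself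
  ensures that the position lies before the end of block \<open>j\<close>.\<close>

lemma bt_concat:
  "bt (concat (map g [0..<n])) i \<longleftrightarrow>
     (\<exists>j<n. (\<Sum>l<j. length (g l)) \<le> i \<and> bt (g j) (i - (\<Sum>l<j. length (g l))))"
proof (induction n)
  case (Suc n)
  have "length (concat (map g [0..<n])) = (\<Sum>l<n. length (g l))"
    by (simp add: length_concat o_def sum_list_sum_nth atLeast0LessThan)
  then show ?case by (auto simp: bt_append Suc less_Suc_eq)
qed simp

lemma list_eq_bt: "xs = ys \<longleftrightarrow> length xs = length ys \<and> (\<forall>i<length xs. bt xs i = bt ys i)"
  by (auto simp: list_eq_iff_nth_eq bt_def)

lemma pl_length: "pl F \<Longrightarrow> pt (\<lambda>x e. length (F x e))"
  by (simp add: pl_def)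

lemma pp_nth: "pl F \<Longrightarrow> pt i \<Longrightarrow> pp (\<lambda>x e. bt (F x e) (i x e))"
  unfolding pl_def by (rule pp_comp) auto

lemma pp_vt: "pp f \<Longrightarrow> pp (\<lambda>x e. f x (vt e))"
  unfolding pp_def by (rule pt_vt)

lemma pp_comp_env: "pp P \<Longrightarrow> pe s \<Longrightarrow> pp (\<lambda>x e. P x (s x e))"
  unfolding pp_def by (rule pt_comp_env)

lemma pl_comp_env:
  assumes F: "pl F" and s: "pe s"
  shows "pl (\<lambda>x e. F x (s x e))"
proof -
  have "pp (\<lambda>x e. bt (F x (vt e)) (vh e))" using F by (simp add: pl_def)
  from pp_comp_env[OF this pe_case_nat[OF pt_var[OF pv_id] pe_comp_vt[OF s]]]
  show ?thesis
    using pt_comp_env[OF pl_length[OF F] s] by (simp add: pl_def)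
qed

lemma pl_vt: "pl F \<Longrightarrow> pl (\<lambda>x e. F x (vt e))"
  by (rule pl_comp_env[OF _ pe_vt])

lemma pl_Nil: "pl (\<lambda>x e. [])"
  by (simp add: pl_def pt_const pp_const)

lemma pl_single: "pp P \<Longrightarrow> pl (\<lambda>x e. [P x e])"
  using pp_conj[OF pp_eq[OF pt_var[OF pv_id] pt_const[of 0]] pp_vt[of P]]
  by (auto simp: pl_def bt_def pt_const less_Suc_eq cong: conj_cong)

lemma pl_append:
  assumes "pl F" "pl G"
  shows "pl (\<lambda>x e. F x e @ G x e)"
  unfolding pl_def[of "\<lambda>x e. F x e @ G x e"] bt_append length_append
  by (intro conjI pt_add pp_disj pp_conj pl_length pp_nth pp_le pt_sub pt_var pv_id
      assms assms[THEN pl_vt])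

lemma pl_Cons: "pp P \<Longrightarrow> pl F \<Longrightarrow> pl (\<lambda>x e. P x e # F x e)"
  using pl_append[OF pl_single] by simp

lemma pl_if:
  assumes "pp P" "pl F" "pl G"
  shows "pl (\<lambda>x e. if P x e then F x e else G x e)"
proof -
  have "pt (\<lambda>x e. if P x e then length (F x e) else length (G x e))"
    by (intro pt_if pl_length assms)
  moreover have "pp (\<lambda>x e. P x (vt e) \<and> bt (F x (vt e)) (vh e) \<or> \<not> P x (vt e) \<and> bt (G x (vt e)) (vh e))"
    by (intro pp_disj pp_conj pp_not pp_nth pt_var pv_id assms(1)[THEN pp_vt] assms(2,3)[THEN pl_vt])
  moreover have "bt (if c then u else v) i \<longleftrightarrow> c \<and> bt u i \<or> \<not> c \<and> bt v i" for c u v i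
    by simp
  ultimately show ?thesis unfolding pl_def if_distrib[of length] by simp
qed

text \<open>By \<open>bt_concat\<close> a bit is found by searching for its block, whose offset is a
  bounded sum of lengths. The generator thus occurs under different numbers of binders, and this is
  why \<open>G\<close> and \<open>len\<close> are shown for every projection \<open>s\<close> of the
  environment.\<close>

lemma pl_concat:
  assumes "pt n" "pl (\<lambda>x e. G x (vt e) (vh e))"
  shows "pl (\<lambda>x e. concat (map (G x e) [0..<n x e]))"
proof -
  have G: "pl (\<lambda>x e. G x (s e) (f x e))" if "pt f" and "pv s" for f s
  proof -
    have "pe (\<lambda>x. s)"
      using \<open>pv s\<close> pe_id by (auto simp: pv_def pe_def)
    from pl_comp_env[OF assms(2) pe_case_nat[OF \<open>pt f\<close> this]] show ?thesis by simp
  qed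
  have len: "pt (\<lambda>x e. \<Sum>l<f x e. length (G x (s e) l))" if "pt f" and "pv s" for f s
  proof (rule pt_sum[OF that(1)])
    obtain k where "s = (\<lambda>e i. e (i + k))" using \<open>pv s\<close> by (auto simp: pv_def)
    then have "pv (\<lambda>e. s (vt e))" unfolding pv_def vt_def by (intro exI[of _ "Suc k"]) simp
    then show "pt (\<lambda>x e. length (G x (s (vt e)) (vh e)))" by (intro pl_length G pt_var pv_id)
  qed
  have "pt (\<lambda>x e. length (concat (map (G x e) [0..<n x e])))"
    using len[OF assms(1) pv_id]
    by (simp add: length_concat o_def sum_list_sum_nth atLeast0LessThan)
  then show ?thesis
    unfolding pl_def bt_concat
    by (intro conjI pp_nth G pp_ex pp_conj pp_le pt_sub len assms(1) assms(1)[THEN pt_vt] pt_var pv_vt pv_id)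
qed

lemma pl_map:
  assumes "pt n" "pp (\<lambda>x e. P x (vt e) (vh e))"
  shows "pl (\<lambda>x e. map (P x e) [0..<n x e])"
  using pl_concat[OF assms(1), of "\<lambda>x e i. [P x e i]"] pl_single[OF assms(2)]
  by (simp add: concat_map_singleton)

lemma pp_list_eq:
  assumes "pl F" "pl G"
  shows "pp (\<lambda>x e. F x e = G x e)"
  unfolding list_eq_bt
  by (intro pp_conj pp_eq pp_all pp_iff pl_length pp_nth pt_var pv_id assms assms[THEN pl_vt])

lemma pl_poly_time:
  assumes "pl (\<lambda>x e. f x)"
  shows "poly_time f"
proof -
  obtain L where "\<And>x e. ev x e L = length (f x)"
    using assms unfolding pl_def pt_def by blast
  moreover obtain G where "\<And>x e. ev x e G = of_bool (bt (f x) (vh e))"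
    using assms unfolding pl_def pp_def pt_def by blast
  ultimately show ?thesis by (intro ex_poly_time[of L f G]) simp_all
qed

lemma pp_class_P:
  assumes "pp (\<lambda>x e. P x)"
  shows "{x. P x} \<in> class_P"
  unfolding class_P_def using pl_poly_time[OF pl_single[OF assms]] by simp

section \<open>Encodings are expressible\<close>

definition pow2 :: "nat \<Rightarrow> bool" where
  "pow2 p \<longleftrightarrow> 0 < p \<and> (\<forall>d<Suc p. d dvd p \<longrightarrow> d = 1 \<or> 2 dvd d)"

lemma pow2_1 [simp]: "pow2 (Suc 0)"
  by (auto simp: pow2_def less_Suc_eq)

lemma pow2_double: "pow2 (2 * p) \<longleftrightarrow> pow2 p"
proof
  assume "pow2 (2 * p)"
  then show "pow2 p" by (auto simp: pow2_def)
next
  assume p: "pow2 p"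
  have "d = 1 \<or> 2 dvd d" if "d dvd 2 * p" for d
  proof (rule ccontr)
    assume *: "\<not> (d = 1 \<or> 2 dvd d)"
    then have "coprime d 2" by simp
    then have "d dvd p" using that by (simp add: coprime_dvd_mult_right_iff)
    with p * show False
      by (metis pow2_def dvd_imp_le le_imp_less_Suc)
  qed
  with p show "pow2 (2 * p)" by (auto simp: pow2_def)
qed

lemma pow2_odd: "pow2 p \<Longrightarrow> odd p \<Longrightarrow> p = 1"
  unfolding pow2_def by (metis dvd_refl lessI)

text \<open>Apart from 1, the powers of two up to \<open>n\<close> are the doubles of those up to
  \<open>n div 2\<close>. This is the recursion of \<open>binary\<close>.\<close>

lemma filter_pow2:
  assumes "n \<noteq> 0"
  shows "filter pow2 [0..<Suc n] = 1 # map ((*) 2) (filter pow2 [0..<Suc (n div 2)])"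
proof (rule sorted_distinct_set_unique)
  show "set (filter pow2 [0..<Suc n]) = set (1 # map ((*) 2) (filter pow2 [0..<Suc (n div 2)]))"
    (is "?A = ?B")
  proof (intro subset_antisym subsetI)
    fix p assume p: "p \<in> ?A"
    show "p \<in> ?B"
    proof (cases "odd p")
      case True
      then show ?thesis using p pow2_odd[of p] by (simp del: upt_Suc)
    next
      case False
      then obtain q where "p = 2 * q" by auto
      with p show ?thesis by (auto simp: pow2_double simp del: upt_Suc)
    qed
  next
    fix p assume "p \<in> ?B"
    then show "p \<in> ?A" using assms by (auto simp: pow2_double simp del: upt_Suc)
  qed
  show "sorted (1 # map ((*) 2) (filter pow2 [0..<Suc (n div 2)]))"
    by (auto simp: sorted_map pow2_def sorted_wrt_filter simp del: upt_Suc)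
  show "distinct (1 # map ((*) 2) (filter pow2 [0..<Suc (n div 2)]))"
    by (auto simp: distinct_map inj_on_def simp del: upt_Suc)
qed (auto simp: sorted_wrt_filter simp del: upt_Suc)

lemma binary_pow2: "binary n = map (\<lambda>p. odd (n div p)) (filter pow2 [0..<Suc n])"
proof (induction n rule: less_induct)
  case (less n)
  show ?case
  proof (cases "n = 0")
    case True
    then show ?thesis by (simp add: binary.simps pow2_def)
  next
    case False
    then have "binary n = odd n # binary (n div 2)" by (subst binary.simps) simp
    with less[of "n div 2"] False show ?thesis
      unfolding filter_pow2[OF False] by (simp add: div_mult2_eq)
  qed
qed

lemma concat_map_if: "concat (map (\<lambda>p. if P p then [g p] else []) xs) = map g (filter P xs)"
  by (induction xs) auto

lemma pp_pow2:
  assumes "pt f"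
  shows "pp (\<lambda>x e. pow2 (f x e))"
  unfolding pow2_def
  by (intro pp_conj pp_all pp_imp pp_disj pp_dvd pp_eq pp_less pt_const pt_Suc pt_var pv_id
      assms assms[THEN pt_vt])

lemma pl_binary:
  assumes "pt f"
  shows "pl (\<lambda>x e. binary (f x e))"
  unfolding binary_pow2 concat_map_if[symmetric]
  by (intro pl_concat pl_if pl_single pl_Nil pp_pow2 pp_not pp_dvd pt_div pt_Suc pt_const
      pt_var pv_id assms assms[THEN pt_vt])

lemma pl_enc_block: "pl F \<Longrightarrow> pl (\<lambda>x e. enc_block (F x e))"
proof -
  assume F: "pl F"
  have "enc_block bs = concat (map (\<lambda>i. [True, bt bs i]) [0..<length bs]) @ [False]" for bs
    unfolding enc_block_def
    by (rule arg_cong[where f = "\<lambda>u. concat u @ _"]) (auto intro!: nth_equalityI simp: bt_def)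
  moreover have "pl (\<lambda>x e. concat (map (\<lambda>i. [True, bt (F x e) i]) [0..<length (F x e)]) @ [False])"
    by (intro pl_append pl_concat pl_Cons pl_Nil pp_const pp_nth pl_length pt_var pv_id F F[THEN pl_vt])
  ultimately show ?thesis by simp
qed

lemma pl_enc_nat: "pt f \<Longrightarrow> pl (\<lambda>x e. enc_nat (f x e))"
  unfolding enc_nat_def by (intro pl_enc_block pl_binary)

lemma pl_enc_unary: "pt f \<Longrightarrow> pl (\<lambda>x e. enc_unary (f x e))"
  using pl_append[OF pl_map[of f "\<lambda>x e i. True", OF _ pp_const] pl_single[OF pp_const[of False]]]
  by (simp add: enc_unary_def map_replicate_const)

definition enc_tests :: "nat \<Rightarrow> nat \<Rightarrow> (nat \<Rightarrow> nat \<Rightarrow> nat) \<Rightarrow> bool list" where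
  "enc_tests n m t = concat (map (\<lambda>j. concat (map (\<lambda>s. enc_nat (t j s)) [0..<n])) [0..<m])"

lemma enc_instance_tests:
  "enc_instance n c (map t [0..<m]) k =
     enc_unary n @ enc_unary c @ enc_unary m @ enc_tests n m t @ enc_int k"
  by (simp add: enc_instance_def enc_tests_def enc_test_def[abs_def] o_def)

lemma pl_enc_tests:
  assumes "pt n" "pt m" "pt (\<lambda>x e. t x (vt (vt e)) (vh (vt e)) (vh e))"
  shows "pl (\<lambda>x e. enc_tests (n x e) (m x e) (t x e))"
  unfolding enc_tests_def by (intro pl_concat pl_enc_nat assms assms(1)[THEN pt_vt])

section \<open>Layouts given by ranks\<close>

text \<open>The rank of an element is the number of its strict predecessors. Ranks below
  \<open>card A\<close> are what makes certificates short.\<close>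

lemma linear_order_rank:
  assumes "linear_order_on A \<sigma>" "finite A"
  obtains r :: "'a \<Rightarrow> nat" where "\<And>a. a \<in> A \<Longrightarrow> r a < card A"
    and "\<And>a b. a \<in> A \<Longrightarrow> b \<in> A \<Longrightarrow> (a, b) \<in> \<sigma> \<longleftrightarrow> r a \<le> r b"
proof
  let ?D = "\<lambda>a. {b \<in> A. (b, a) \<in> \<sigma> \<and> b \<noteq> a}"
  have o: "refl_on A \<sigma>" "trans \<sigma>" "antisym \<sigma>" "total_on A \<sigma>"
    using assms(1) by (auto simp: order_on_defs)
  show "card (?D a) < card A" if "a \<in> A" for a
    using that assms(2) by (intro psubset_card_mono) auto
  have mono: "card (?D a) \<le> card (?D b)" if "(a, b) \<in> \<sigma>" for a b
    using that assms(2) o by (intro card_mono) (auto dest: transD antisymD)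
  have strict: "card (?D a) < card (?D b)" if "(a, b) \<in> \<sigma>" "a \<noteq> b" "a \<in> A" for a b
    using that assms(2) o by (intro psubset_card_mono) (auto dest: transD antisymD)
  show "(a, b) \<in> \<sigma> \<longleftrightarrow> card (?D a) \<le> card (?D b)" if "a \<in> A" "b \<in> A" for a b
  proof
    assume le: "card (?D a) \<le> card (?D b)"
    show "(a, b) \<in> \<sigma>"
    proof (rule ccontr)
      assume "(a, b) \<notin> \<sigma>"
      moreover from this have "a \<noteq> b"
        using o(1) that by (auto simp: refl_on_def)
      ultimately have "(b, a) \<in> \<sigma>" "a \<noteq> b"
        using o(4) that unfolding total_on_def by blast+
      with strict[of b a] that le show False by simp
    qed
  qed (rule mono)
qed

definition rank_order :: "'a set \<Rightarrow> ('a \<Rightarrow> nat) \<Rightarrow> 'a rel" where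
  "rank_order A r = {(a, b). a \<in> A \<and> b \<in> A \<and> r a \<le> r b}"

lemma linear_rank_order: "inj_on r A \<Longrightarrow> linear_order_on A (rank_order A r)"
  by (auto simp: rank_order_def order_on_defs refl_on_def trans_def antisym_def total_on_def
      dest: inj_onD)

text \<open>The condition \<open>s < s'\<close> picks one representative of each unordered pair,
  which turns the cardinality into a bounded sum and hence into an expression.\<close>

definition rank_crossings :: "nat \<Rightarrow> nat \<Rightarrow> (nat \<Rightarrow> nat \<Rightarrow> nat) \<Rightarrow> nat" where
  "rank_crossings n m \<rho> = (\<Sum>j<m - 1. \<Sum>s<n. \<Sum>s'<n.
     of_bool (s < s' \<and> (\<rho> j s \<le> \<rho> j s') \<noteq> (\<rho> (Suc j) s \<le> \<rho> (Suc j) s')))"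

lemma crossings_rank:
  assumes "length \<pi> = m"
    and \<pi>: "\<And>j s s'. j < m \<Longrightarrow> s < n \<Longrightarrow> s' < n \<Longrightarrow> (s, s') \<in> \<pi> ! j \<longleftrightarrow> \<rho> j s \<le> \<rho> j s'"
    and inj: "\<And>j s s'. j < m \<Longrightarrow> s < n \<Longrightarrow> s' < n \<Longrightarrow> \<rho> j s = \<rho> j s' \<Longrightarrow> s = s'"
  shows "crossings {..<n} \<pi> = rank_crossings n m \<rho>"
proof -
  let ?P = "\<lambda>(j, s, s'). s < s' \<and> (\<rho> j s \<le> \<rho> j s') \<noteq> (\<rho> (Suc j) s \<le> \<rho> (Suc j) s')"
  let ?I = "{..<m - 1} \<times> {..<n} \<times> {..<n}"
  let ?f = "\<lambda>(j, s, s'). (j, {s, s'})"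
  have "{(j, {s, s'}) | j s s'. Suc j < length \<pi> \<and> s \<in> {..<n} \<and> s' \<in> {..<n} \<and> s \<noteq> s' \<and>
     ((s, s') \<in> \<pi> ! j) \<noteq> ((s, s') \<in> \<pi> ! Suc j)} = ?f ` (?I \<inter> {p. ?P p})" (is "?A = ?B")
  proof (intro subset_antisym subsetI)
    fix p assume "p \<in> ?A"
    then obtain j s s' where p: "p = (j, {s, s'})" "Suc j < m" "s < n" "s' < n" "s \<noteq> s'"
      and "((s, s') \<in> \<pi> ! j) \<noteq> ((s, s') \<in> \<pi> ! Suc j)"
      unfolding assms(1) lessThan_iff by (elim CollectE exE conjE) (rule that)
    then have p': "(\<rho> j s \<le> \<rho> j s') \<noteq> (\<rho> (Suc j) s \<le> \<rho> (Suc j) s')"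
      using \<pi> by simp
    show "p \<in> ?B"
    proof (cases "s < s'")
      case True
      with p p' show ?thesis by (intro image_eqI[of _ _ "(j, s, s')"]) auto
    next
      case False
      have "\<rho> j s \<noteq> \<rho> j s'" "\<rho> (Suc j) s \<noteq> \<rho> (Suc j) s'"
        using p inj[of j s s'] inj[of "Suc j" s s'] by auto
      with False p p' show ?thesis by (intro image_eqI[of _ _ "(j, s', s)"]) auto
    qed
  next
    fix p assume "p \<in> ?B"
    then obtain j s s' where p: "p = (j, {s, s'})" "j < m - 1" "s < n" "s' < n" "s < s'"
      and "(\<rho> j s \<le> \<rho> j s') \<noteq> (\<rho> (Suc j) s \<le> \<rho> (Suc j) s')"
      by auto
    then have "((s, s') \<in> \<pi> ! j) \<noteq> ((s, s') \<in> \<pi> ! Suc j)"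
      using \<pi>[of j s s'] \<pi>[of "Suc j" s s'] by simp
    with p assms(1) show "p \<in> ?A"
      by (intro CollectI exI[of _ j] exI[of _ s] exI[of _ s']) simp
  qed
  moreover have "inj_on ?f {p :: nat \<times> nat \<times> nat. fst (snd p) < snd (snd p)}"
    by (auto simp: inj_on_def doubleton_eq_iff)
  then have "inj_on ?f (?I \<inter> {p. ?P p})"
    by (rule inj_on_subset) auto
  ultimately have "crossings {..<n} \<pi> = card (?I \<inter> {p. ?P p})"
    unfolding crossings_def by (simp only: card_image)
  also have "\<dots> = (\<Sum>p\<in>?I. of_bool (?P p))"
    by (simp only: sum_of_bool_eq finite_cartesian_product finite_lessThan of_nat_id)
  also have "\<dots> = rank_crossings n m \<rho>"
    unfolding rank_crossings_def sum.cartesian_product by (intro sum.cong refl) auto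
  finally show ?thesis .
qed

section \<open>Membership in NP\<close>

text \<open>The condition \<open>A\<close> on the number of tests allows the unrestricted and the
  restricted problem to be treated by one proof.\<close>

definition panel_language :: "(nat \<Rightarrow> bool) \<Rightarrow> language" where
  "panel_language A = {enc_instance n c T k | n c T k.
     panel_data {..<n} {..<c} T \<and> A (length T) \<and> panel_crossing_yes {..<n} {..<c} T k}"

definition certified :: "nat \<Rightarrow> nat \<Rightarrow> nat \<Rightarrow> (nat \<Rightarrow> nat \<Rightarrow> nat) \<Rightarrow> (nat \<Rightarrow> nat) \<Rightarrow>
    (nat \<Rightarrow> nat \<Rightarrow> nat) \<Rightarrow> bool" where
  "certified n c m t r \<rho> \<longleftrightarrow> (\<forall>j<m. \<forall>s<n. t j s < c) \<and> (\<forall>a<c. \<forall>b<c. r a = r b \<longrightarrow> a = b) \<and>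
     (\<forall>j<m. \<forall>s<n. \<forall>s'<n. (\<rho> j s = \<rho> j s' \<longrightarrow> s = s') \<and> (r (t j s) < r (t j s') \<longrightarrow> \<rho> j s < \<rho> j s'))"

text \<open>The single \<open>False\<close> is the sign bit of \<open>k\<close>; a positive answer
  forces \<open>k\<close> to be nonnegative. The digits of \<open>k\<close> are kept as a word
  because \<open>k\<close> itself may be too large for an expression.\<close>

definition instance_word :: "nat \<Rightarrow> nat \<Rightarrow> nat \<Rightarrow> (nat \<Rightarrow> nat \<Rightarrow> nat) \<Rightarrow> bool list \<Rightarrow> bool list" where
  "instance_word n c m t ks =
     enc_unary n @ enc_unary c @ enc_unary m @ enc_tests n m t @ False # enc_block ks"

lemma binary_eq_Nil [simp]: "binary k = [] \<longleftrightarrow> k = 0"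
  by (simp add: binary.simps[of k])

lemma binary_last: "binary k \<noteq> [] \<Longrightarrow> last (binary k)"
proof (induction k rule: less_induct)
  case (less k)
  then have k: "k \<noteq> 0" by auto
  show ?case
  proof (cases "k = 1")
    case False
    with k have "k div 2 \<noteq> 0" by simp
    then have "last (binary (k div 2))" by (intro less.IH) (use k in auto)
    then show ?thesis
      using k \<open>k div 2 \<noteq> 0\<close> by (subst binary.simps) simp
  qed (simp add: binary.simps)
qed

text \<open>The last digit is the most significant one, so the premise excludes leading
  zeros.\<close>

lemma ex_binary: "ks = [] \<or> last ks \<Longrightarrow> \<exists>k. binary k = ks"
proof (induction ks)
  case Nil
  then show ?case by (metis binary_eq_Nil)
next
  case (Cons b ks)
  show ?case
  proof (cases "ks = []")
    case True
    with Cons.prems have "binary 1 = b # ks" by (simp add: binary.simps)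
    then show ?thesis ..
  next
    case False
    with Cons obtain k where k: "binary k = ks" by auto
    with False have "k \<noteq> 0" by auto
    then have "binary (2 * k + of_bool b) = b # ks"
      using k by (subst binary.simps) simp
    then show ?thesis ..
  qed
qed

text \<open>Since \<open>k\<close> may be exponentially large, the test that the number of crossings is at most
  \<open>k\<close> compares the digits of \<open>k\<close> with those of all smaller numbers.\<close>

lemma panel_language_certified:
  assumes "x \<in> panel_language A"
  obtains n c m t r \<rho> ks where "x = instance_word n c m t ks" "ks = [] \<or> last ks"
    "0 < m" "A m" "certified n c m t r \<rho>" "\<forall>k<rank_crossings n m \<rho>. binary k \<noteq> ks"
    "\<forall>a<c. r a < c" "\<forall>j<m. \<forall>s<n. \<rho> j s < n"
proof -
  obtain n c T k \<sigma> where x: "x = enc_instance n c T k" and T: "panel_data {..<n} {..<c} T"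
    "A (length T)" and \<sigma>: "linear_order_on {..<c} \<sigma>" "int (pcr {..<n} T \<sigma>) \<le> k"
    using assms unfolding panel_language_def panel_crossing_yes_def by blast
  define m t where "m = length T" and "t j = T ! j" for j
  have Tm: "T = map t [0..<m]"
    by (intro nth_equalityI) (auto simp: m_def t_def)
  obtain \<pi> where \<pi>: "layout {..<n} T \<sigma> \<pi>" "crossings {..<n} \<pi> = pcr {..<n} T \<sigma>"
    using pcr_attained[OF T(1) \<sigma>(1)] by blast
  obtain r where r: "\<And>a. a < c \<Longrightarrow> r a < c"
    "\<And>a b. a < c \<Longrightarrow> b < c \<Longrightarrow> (a, b) \<in> \<sigma> \<longleftrightarrow> r a \<le> r b"
    using linear_order_rank[OF \<sigma>(1) finite_lessThan] unfolding card_lessThan lessThan_iff by metis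
  have lin: "linear_order_on {..<n} (\<pi> ! j)" if "j < m" for j
    using \<pi>(1) that by (simp add: layout_def m_def)
  have "\<exists>\<rho>. (\<forall>s<n. \<rho> s < n) \<and> (\<forall>s<n. \<forall>s'<n. (s, s') \<in> \<pi> ! j \<longleftrightarrow> \<rho> s \<le> (\<rho> s' :: nat))" if "j < m" for j
    using linear_order_rank[OF lin[OF that] finite_lessThan] unfolding card_lessThan lessThan_iff
    by metis
  then obtain \<rho> where \<rho>: "\<And>j s. j < m \<Longrightarrow> s < n \<Longrightarrow> \<rho> j s < n"
    "\<And>j s s'. j < m \<Longrightarrow> s < n \<Longrightarrow> s' < n \<Longrightarrow> (s, s') \<in> \<pi> ! j \<longleftrightarrow> \<rho> j s \<le> \<rho> j s'"
    by metis
  have inj: "s = s'" if "j < m" "s < n" "s' < n" "\<rho> j s = \<rho> j s'" for j s s'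
    using lin[OF that(1)] \<rho>(2)[of j s s'] \<rho>(2)[of j s' s] that
    by (auto simp: order_on_defs dest: antisymD)
  have tc: "t j s < c" if "j < m" "s < n" for j s
    using T(1) that by (auto simp: panel_data_def t_def m_def image_subset_iff)
  have mono: "\<rho> j s < \<rho> j s'" if "j < m" "s < n" "s' < n" "r (t j s) < r (t j s')" for j s s'
  proof -
    have "(t j s, t j s') \<in> \<sigma> - Id"
      using that tc r(2)[of "t j s" "t j s'"] by auto
    then have "(s, s') \<in> \<pi> ! j - Id"
      using \<pi>(1) that unfolding layout_def t_def m_def by blast
    then show ?thesis using \<rho>(2)[of j s s'] inj[of j s s'] that by (auto simp: le_less)
  qed
  have rinj: "a = b" if "a < c" "b < c" "r a = r b" for a b
    using \<sigma>(1) r(2)[of a b] r(2)[of b a] that by (auto simp: order_on_defs dest: antisymD)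
  have "rank_crossings n m \<rho> = pcr {..<n} T \<sigma>"
    using crossings_rank[of \<pi> m n \<rho>] \<rho>(2) inj \<pi> by (auto simp: layout_def m_def)
  then have k: "0 \<le> k" "rank_crossings n m \<rho> \<le> nat k" using \<sigma>(2) by linarith+
  have "x = instance_word n c m t (binary (nat k))"
    using k(1) unfolding x Tm enc_instance_tests instance_word_def by (simp add: enc_int_def enc_nat_def)
  moreover have "certified n c m t r \<rho>"
    unfolding certified_def using tc rinj inj mono by blast
  moreover have "0 < m" using T(1) by (auto simp: panel_data_def m_def)
  moreover have "\<forall>k'<rank_crossings n m \<rho>. binary k' \<noteq> binary (nat k)"
    using k by (auto simp: binary_inj)
  moreover have "A m" using T(2) by (simp add: m_def)
  ultimately show ?thesis
    using r(1) \<rho>(1) binary_last[of "nat k"] by (intro that) auto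
qed

lemma certified_panel_language:
  assumes x: "x = instance_word n c m t ks" and ks: "ks = [] \<or> last ks"
    and m: "0 < m" "A m" and cert: "certified n c m t r \<rho>"
    and cr: "\<forall>k<rank_crossings n m \<rho>. binary k \<noteq> ks"
  shows "x \<in> panel_language A"
proof -
  obtain k where k: "binary k = ks" using ex_binary[OF ks] by blast
  define T where "T = map t [0..<m]"
  define \<sigma> where "\<sigma> = rank_order {..<c} r"
  define \<pi> where "\<pi> = map (\<lambda>j. rank_order {..<n} (\<rho> j)) [0..<m]"
  have "x = enc_instance n c T (int k)"
    unfolding x T_def enc_instance_tests instance_word_def by (simp add: enc_int_def enc_nat_def k)
  moreover have "panel_data {..<n} {..<c} T"
    using m(1) cert by (auto simp: panel_data_def T_def certified_def)
  moreover have \<sigma>: "linear_order_on {..<c} \<sigma>"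
    unfolding \<sigma>_def using cert by (intro linear_rank_order) (auto simp: certified_def inj_on_def)
  moreover have "pcr {..<n} T \<sigma> \<le> k"
  proof -
    have "linear_order_on {..<n} (rank_order {..<n} (\<rho> j))" if "j < m" for j
      using cert that by (intro linear_rank_order) (auto simp: certified_def inj_on_def)
    moreover have "(s, s') \<in> rank_order {..<n} (\<rho> j) - Id"
      if "j < m" "s < n" "s' < n" "(t j s, t j s') \<in> \<sigma> - Id" for j s s'
    proof -
      have "r (t j s) < r (t j s')"
        using that cert unfolding certified_def \<sigma>_def rank_order_def by (force simp: le_less)
      then have "\<rho> j s < \<rho> j s'" using cert that unfolding certified_def by blast
      then show ?thesis using that by (auto simp: rank_order_def)
    qed
    ultimately have "layout {..<n} T \<sigma> \<pi>"
      unfolding layout_def by (simp add: T_def \<pi>_def)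
    then have "pcr {..<n} T \<sigma> \<le> crossings {..<n} \<pi>"
      unfolding pcr_def by (intro cInf_lower) auto
    also have "\<dots> = rank_crossings n m \<rho>"
      using cert by (intro crossings_rank) (auto simp: \<pi>_def rank_order_def certified_def)
    \<comment> \<open>Otherwise \<open>k\<close> itself would be a number below the crossings whose
      digits are \<open>ks\<close>.\<close>
    also have "\<dots> \<le> k" using cr k by (metis not_le)
    finally show ?thesis .
  qed
  ultimately have "x = enc_instance n c T (int k)" "panel_data {..<n} {..<c} T"
    "panel_crossing_yes {..<n} {..<c} T (int k)"
    unfolding panel_crossing_yes_def by auto
  moreover have "A (length T)" using m(2) by (simp add: T_def)
  ultimately show "x \<in> panel_language A"
    unfolding panel_language_def by blast
qed

text \<open>A certificate lists numbers at most \<open>length x\<close> in unary, in windows of that width.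
  Both \<open>x\<close> and the certificate are extracted from \<open>bit_pair x w\<close>.\<close>

definition fst_length :: "bool list \<Rightarrow> nat" where
  "fst_length z = (\<Sum>i<length z. of_bool (\<forall>j<Suc i. bt z (2 * j)))"

definition fst_word :: "bool list \<Rightarrow> bool list" where
  "fst_word z = map (\<lambda>i. bt z (2 * i + 1)) [0..<fst_length z]"

text \<open>The windows start after the \<open>2 * fst_length z + 1\<close> bits of the encoded
  first component. An entry is the number of \<open>True\<close> bits in its window, so every
  certificate decodes to some numbers.\<close>

definition snd_entry :: "bool list \<Rightarrow> nat \<Rightarrow> nat" where
  "snd_entry z q = (\<Sum>i<fst_length z. of_bool (bt z (2 * fst_length z + 1 + (q * fst_length z + i))))"

lemma length_enc_block [simp]: "length (enc_block bs) = 2 * length bs + 1"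
  by (induction bs) (auto simp: enc_block_def)

lemma bt_enc_block_even: "bt (enc_block bs) (2 * j) \<longleftrightarrow> j < length bs"
proof (induction bs arbitrary: j)
  case (Cons b bs)
  then show ?case by (cases j) (auto simp: enc_block_def bt_def)
qed (auto simp: enc_block_def bt_def)

lemma bt_enc_block_odd: "bt (enc_block bs) (2 * j + 1) \<longleftrightarrow> bt bs j"
proof (induction bs arbitrary: j)
  case (Cons b bs)
  then show ?case by (cases j) (auto simp: enc_block_def bt_def)
qed (auto simp: enc_block_def bt_def)

lemma fst_length_bit_pair [simp]: "fst_length (bit_pair x w) = length x"
proof -
  let ?z = "bit_pair x w"
  have "(\<forall>j<Suc i. bt ?z (2 * j)) \<longleftrightarrow> i < length x" for i
  proof
    assume *: "\<forall>j<Suc i. bt ?z (2 * j)"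
    show "i < length x"
    proof (rule ccontr)
      assume "\<not> i < length x"
      with * have "bt ?z (2 * length x)" by simp
      moreover have "\<not> bt (enc_block x) (2 * length x)" by (simp add: bt_enc_block_even)
      ultimately show False by (simp add: bit_pair_def bt_append)
    qed
  next
    assume "i < length x"
    then show "\<forall>j<Suc i. bt ?z (2 * j)"
      by (auto simp: bit_pair_def bt_append bt_enc_block_even)
  qed
  then have "fst_length ?z = card ({..<length ?z} \<inter> {i. i < length x})"
    unfolding fst_length_def by (simp add: sum_of_bool_eq)
  also have "{..<length ?z} \<inter> {i. i < length x} = {..<length x}"
    by (auto simp: bit_pair_def)
  finally show ?thesis by simp
qed

lemma fst_word_bit_pair [simp]: "fst_word (bit_pair x w) = x"
proof -
  have "bt (bit_pair x w) (2 * i + 1) = x ! i" if "i < length x" for i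
    using that bt_enc_block_odd[of x i] by (auto simp: bit_pair_def bt_append bt_def[of x])
  then show ?thesis
    unfolding fst_word_def by (intro nth_equalityI) auto
qed

lemma snd_entry_bit_pair:
  "snd_entry (bit_pair x w) q = (\<Sum>i<length x. of_bool (bt w (q * length x + i)))"
proof -
  have "bt (bit_pair x w) (2 * length x + 1 + k) = bt w k" for k
    by (simp add: bit_pair_def bt_append bt_def[of "enc_block x"])
  then show ?thesis unfolding snd_entry_def fst_length_bit_pair by (simp only:)
qed

section \<open>The verifier\<close>

definition verifies :: "(nat \<Rightarrow> bool) \<Rightarrow> bool list \<Rightarrow> nat \<Rightarrow> nat \<Rightarrow> nat \<Rightarrow> nat \<Rightarrow> (nat \<Rightarrow> nat \<Rightarrow> nat) \<Rightarrow>
    (nat \<Rightarrow> nat) \<Rightarrow> (nat \<Rightarrow> nat \<Rightarrow> nat) \<Rightarrow> bool list \<Rightarrow> bool" where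
  "verifies A x n c m l t r \<rho> ks \<longleftrightarrow> x = instance_word n c m t ks \<and> (l = 0 \<or> bt ks (l - 1)) \<and>
     0 < m \<and> A m \<and> certified n c m t r \<rho> \<and> (\<forall>k<rank_crossings n m \<rho>. binary k \<noteq> ks)"

text \<open>Instead of decoding the input, the verifier encodes a guessed instance and compares. The
  sizes and the number \<open>l\<close> of digits of \<open>k\<close> are found by search, while the
  tests, the ranks of the categories and the ranks of the subjects come from the certificate,
  interleaved modulo 3. The digits of \<open>k\<close> are read off the end of the word, whose last
  block has \<open>2 * l + 1\<close> bits.\<close>

definition verifier :: "(nat \<Rightarrow> bool) \<Rightarrow> bool list \<Rightarrow> bool" where
  "verifier A z \<longleftrightarrow> (\<exists>n<Suc (fst_length z). \<exists>c<Suc (fst_length z). \<exists>m<Suc (fst_length z).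
     \<exists>l<Suc (fst_length z).
       verifies A (fst_word z) n c m l (\<lambda>j s. snd_entry z (3 * (j * fst_length z + s)))
         (\<lambda>a. snd_entry z (3 * a + 1)) (\<lambda>j s. snd_entry z (3 * (j * fst_length z + s) + 2))
         (map (\<lambda>i. bt (fst_word z) (fst_length z - 1 - 2 * l + (2 * i + 1))) [0..<l]))"

lemma pt_fst_length: "pt (\<lambda>z e. fst_length z)"
  unfolding fst_length_def
  by (intro pt_sum pt_len pt_of_bool pp_all pp_bt pt_mult pt_const pt_Suc pt_var pv_id pv_vt)

lemma pl_fst_word: "pl (\<lambda>z e. fst_word z)"
  unfolding fst_word_def
  by (intro pl_map pt_fst_length pp_bt pt_add pt_mult pt_const pt_var pv_id)

lemma pt_snd_entry: "pt f \<Longrightarrow> pt (\<lambda>z e. snd_entry z (f z e))"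
proof (rule pt_comp[where h = "\<lambda>z e. snd_entry z"])
  show "pt (\<lambda>z e. snd_entry z (vh e))"
    unfolding snd_entry_def
    by (intro pt_sum pt_fst_length pt_of_bool pp_bt pt_add pt_mult pt_const pt_var pv_id pv_vt)
qed

lemma pp_verifier:
  assumes "pp (\<lambda>z e. A (vh e))"
  shows "pp (\<lambda>z e. verifier A z)"
proof -
  have A: "pp (\<lambda>z e. A (f z e))" if "pt f" for f
    using pp_comp[where h = "\<lambda>z e. A", OF assms that] .
  show ?thesis
    unfolding verifier_def verifies_def certified_def rank_crossings_def instance_word_def
    by (intro pp_ex pp_conj pp_list_eq pp_disj pp_all pp_imp pp_eq pp_less pp_nth pp_not A pp_iff pp_le
        pl_append pl_enc_unary pl_enc_tests pl_Cons pl_enc_block pl_map pl_binary pp_const pl_fst_word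
        pt_snd_entry pt_fst_length pt_sum pt_of_bool pt_Suc pt_add pt_sub pt_mult pt_const pt_var
        pv_id pv_vt)
qed

lemma certified_cong:
  assumes t: "\<And>j s. j < m \<Longrightarrow> s < n \<Longrightarrow> t' j s = t j s" and r: "\<And>a. a < c \<Longrightarrow> r' a = r a"
    and \<rho>: "\<And>j s. j < m \<Longrightarrow> s < n \<Longrightarrow> \<rho>' j s = \<rho> j s" and cert: "certified n c m t r \<rho>"
  shows "certified n c m t' r' \<rho>'"
proof -
  have tc: "\<forall>j<m. \<forall>s<n. t j s < c"
    by (rule conjunct1[OF cert[unfolded certified_def]])
  have "(\<forall>j<m. \<forall>s<n. t' j s < c) = (\<forall>j<m. \<forall>s<n. t j s < c)"
    by (simp add: t)
  moreover have "(\<forall>a<c. \<forall>b<c. r' a = r' b \<longrightarrow> a = b) = (\<forall>a<c. \<forall>b<c. r a = r b \<longrightarrow> a = b)"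
    by (simp add: r)
  moreover have "(\<forall>j<m. \<forall>s<n. \<forall>s'<n. (\<rho>' j s = \<rho>' j s' \<longrightarrow> s = s') \<and>
        (r' (t' j s) < r' (t' j s') \<longrightarrow> \<rho>' j s < \<rho>' j s')) =
      (\<forall>j<m. \<forall>s<n. \<forall>s'<n. (\<rho> j s = \<rho> j s' \<longrightarrow> s = s') \<and>
        (r (t j s) < r (t j s') \<longrightarrow> \<rho> j s < \<rho> j s'))"
    using tc by (simp add: t r \<rho>)
  ultimately show ?thesis
    using cert by (simp only: certified_def)
qed

lemma rank_crossings_cong:
  assumes "\<And>j s. j < m \<Longrightarrow> s < n \<Longrightarrow> \<rho> j s = \<rho>' j s"
  shows "rank_crossings n m \<rho> = rank_crossings n m \<rho>'"
  unfolding rank_crossings_def using assms by (intro sum.cong refl) auto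

lemma instance_word_cong:
  assumes "\<And>j s. j < m \<Longrightarrow> s < n \<Longrightarrow> t j s = t' j s"
  shows "instance_word n c m t ks = instance_word n c m t' ks"
  unfolding instance_word_def enc_tests_def using assms
  by (auto intro!: arg_cong[where f = concat] map_cong)

lemma instance_word_bits:
  assumes "x = instance_word n c m t ks"
  shows "map (\<lambda>i. bt x (length x - 1 - 2 * length ks + (2 * i + 1))) [0..<length ks] = ks"
proof -
  define p where "p = enc_unary n @ enc_unary c @ enc_unary m @ enc_tests n m t @ [False]"
  have x: "x = p @ enc_block ks" by (simp add: assms instance_word_def p_def)
  have "bt x (length x - 1 - 2 * length ks + (2 * i + 1)) = bt ks i" for i
    using bt_enc_block_odd[of ks i] by (auto simp: x bt_append bt_def[of p])
  then show ?thesis by (intro nth_equalityI) (auto simp: bt_def)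
qed

lemma verifier_complete:
  assumes "x \<in> panel_language A"
  shows "\<exists>w. length w \<le> (3 * length x * length x + 3 * length x + 3) * length x \<and> verifier A (bit_pair x w)"
proof -
  define N where "N = length x"
  obtain n c m t r \<rho> ks where x: "x = instance_word n c m t ks" and ks: "ks = [] \<or> last ks"
    and m: "0 < m" "A m" and cert: "certified n c m t r \<rho>"
    and cr: "\<forall>k<rank_crossings n m \<rho>. binary k \<noteq> ks"
    and r: "\<forall>a<c. r a < c" and \<rho>: "\<forall>j<m. \<forall>s<n. \<rho> j s < n"
    using assms by (rule panel_language_certified)
  have N: "n < N" "c < N" "m < N" "length ks < N"
    unfolding N_def x instance_word_def by (auto simp: enc_unary_def)
  define f where "f q = (if q mod 3 = 0 then t (q div 3 div N) (q div 3 mod N)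
    else if q mod 3 = 1 then r (q div 3) else \<rho> (q div 3 div N) (q div 3 mod N))" for q
  \<comment> \<open>Enough windows for the entries \<open>3 * (j * N + s) + 2\<close> with
    \<open>j, s < N\<close> and \<open>3 * a + 1\<close> with \<open>a < N\<close>.\<close>
  define J where "J = 3 * N * N + 3 * N + 3"
  define w where "w = map (\<lambda>i. i mod N < f (i div N)) [0..<J * N]"
  define z where "z = bit_pair x w"
  have val: "snd_entry z q = f q" if "q < J" "f q \<le> N" for q
  proof -
    have "bt w (q * N + i) \<longleftrightarrow> i < f q" if "i < N" for i
    proof -
      have "q * N + i < Suc q * N" using that by simp
      also have "\<dots> \<le> J * N" using \<open>q < J\<close> by (intro mult_le_mono1) simp
      finally show ?thesis using that by (simp add: w_def bt_def)
    qed
    then have "snd_entry z q = (\<Sum>i<N. of_bool (i < f q))"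
      unfolding z_def snd_entry_bit_pair N_def[symmetric] by (intro sum.cong) auto
    also have "\<dots> = card ({..<N} \<inter> {i. i < f q})" by (simp add: sum_of_bool_eq)
    also have "{..<N} \<inter> {i. i < f q} = {..<f q}" using that by auto
    finally show ?thesis by simp
  qed
  have idx: "3 * (j * N + s) + 2 < J" if "j < m" "s < n" for j s
  proof -
    have "j * N + s < Suc j * N" using that N by simp
    also have "\<dots> \<le> N * N" using that N by (intro mult_le_mono1) simp
    finally show ?thesis by (simp add: J_def)
  qed
  have t: "snd_entry z (3 * (j * N + s)) = t j s" if "j < m" "s < n" for j s
  proof -
    have "f (3 * (j * N + s)) = t j s" using that N by (simp add: f_def)
    moreover have "t j s < N" using cert that N unfolding certified_def by fastforce
    ultimately show ?thesis using idx[OF that] by (subst val) auto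
  qed
  have \<rho>': "snd_entry z (3 * (j * N + s) + 2) = \<rho> j s" if "j < m" "s < n" for j s
  proof -
    have "(3 * (j * N + s) + 2) mod 3 = 2" "(3 * (j * N + s) + 2) div 3 = j * N + s" by presburger+
    then have "f (3 * (j * N + s) + 2) = \<rho> j s" using that N by (simp add: f_def)
    moreover have "\<rho> j s < N" using \<rho> that N by fastforce
    ultimately show ?thesis using idx[OF that] by (subst val) auto
  qed
  have r': "snd_entry z (3 * a + 1) = r a" if "a < c" for a
  proof -
    have "(3 * a + 1) mod 3 = 1" "(3 * a + 1) div 3 = a" by presburger+
    then have "f (3 * a + 1) = r a" by (simp add: f_def)
    moreover have "r a < N" using r that N by fastforce
    ultimately show ?thesis using that N by (subst val) (auto simp: J_def)
  qed
  have "verifies A x n c m (length ks) (\<lambda>j s. snd_entry z (3 * (j * N + s)))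
      (\<lambda>a. snd_entry z (3 * a + 1)) (\<lambda>j s. snd_entry z (3 * (j * N + s) + 2)) ks"
    unfolding verifies_def
  proof (intro conjI)
    show "x = instance_word n c m (\<lambda>j s. snd_entry z (3 * (j * N + s))) ks"
      unfolding x by (rule instance_word_cong) (simp only: t)
    show "certified n c m (\<lambda>j s. snd_entry z (3 * (j * N + s))) (\<lambda>a. snd_entry z (3 * a + 1))
      (\<lambda>j s. snd_entry z (3 * (j * N + s) + 2))"
      by (rule certified_cong[OF _ _ _ cert]) (simp_all only: t \<rho>' r')
    show "\<forall>k<rank_crossings n m (\<lambda>j s. snd_entry z (3 * (j * N + s) + 2)). binary k \<noteq> ks"
      using cr rank_crossings_cong[of m n "\<lambda>j s. snd_entry z (3 * (j * N + s) + 2)" \<rho>] \<rho>' by simp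
    show "length ks = 0 \<or> bt ks (length ks - 1)"
      using ks by (auto simp: bt_def last_conv_nth)
  qed (use m in auto)
  then have "verifier A z"
    using N instance_word_bits[OF x]
    unfolding verifier_def z_def fst_length_bit_pair fst_word_bit_pair N_def[symmetric]
    by (intro exI[of _ n] exI[of _ c] exI[of _ m] exI[of _ "length ks"] conjI) (simp_all add: N_def)
  moreover have "length w \<le> (3 * length x * length x + 3 * length x + 3) * length x"
    by (simp add: w_def J_def N_def)
  ultimately show ?thesis unfolding z_def by blast
qed

lemma verifier_sound:
  assumes "verifier A (bit_pair x w)"
  shows "x \<in> panel_language A"
proof -
  obtain n c m l t r \<rho> ks where v: "verifies A x n c m l t r \<rho> ks" and l: "length ks = l"
    using assms unfolding verifier_def fst_word_bit_pair
    by (elim exE conjE) (rule that, assumption, simp)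
  have "ks = [] \<or> last ks"
    using v l unfolding verifies_def by (cases "ks = []") (auto simp: bt_def last_conv_nth)
  then show ?thesis
    using v unfolding verifies_def by (intro certified_panel_language) auto
qed

lemma panel_language_NP:
  assumes "pp (\<lambda>z e. A (vh e))"
  shows "panel_language A \<in> class_NP"
  unfolding class_NP_def
proof (intro CollectI bexI exI allI)
  let ?p = "([:3:] * [:0, 1:] * [:0, 1:] + [:3:] * [:0, 1:] + [:3:]) * [:0, 1:] :: nat poly"
  show "{z. verifier A z} \<in> class_P"
    by (rule pp_class_P[OF pp_verifier[OF assms]])
  have p: "poly ?p N = (3 * N * N + 3 * N + 3) * N" for N
    by (simp add: algebra_simps)
  show "x \<in> panel_language A \<longleftrightarrow>
      (\<exists>w. length w \<le> poly ?p (length x) \<and> bit_pair x w \<in> {z. verifier A z})" for x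
    using verifier_complete[of x A] verifier_sound[of A x] unfolding p by blast
qed

section \<open>Crossings of two tests\<close>

text \<open>The relation is oriented: of the two orders of a crossing pair exactly one counts, so a
  sum over all ordered pairs counts each crossing once.\<close>

definition inverted :: "('a \<Rightarrow> nat) \<Rightarrow> 'a \<times> 'a \<Rightarrow> 'a \<times> 'a \<Rightarrow> nat" where
  "inverted r e f = of_bool (r (fst e) < r (fst f) \<and> r (snd f) < r (snd e))"

definition lex_order :: "nat \<Rightarrow> (nat \<Rightarrow> nat) \<Rightarrow> (nat \<Rightarrow> nat) \<Rightarrow> nat rel" where
  "lex_order n f g = {(s, s'). s < n \<and> s' < n \<and>
     (f s < f s' \<or> f s = f s' \<and> (g s < g s' \<or> g s = g s' \<and> s \<le> s'))}"

lemma linear_lex_order: "linear_order_on {..<n} (lex_order n f g)"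
  unfolding order_on_defs
proof (intro conjI)
  show "trans (lex_order n f g)"
  proof (rule transI)
    fix a b c assume "(a, b) \<in> lex_order n f g" "(b, c) \<in> lex_order n f g"
    then show "(a, c) \<in> lex_order n f g"
      unfolding lex_order_def mem_Collect_eq split by linarith
  qed
  show "antisym (lex_order n f g)"
    by (rule antisymI) (unfold lex_order_def mem_Collect_eq split, linarith)
  show "total_on {..<n} (lex_order n f g)"
    by (auto simp: total_on_def lex_order_def)
qed (auto simp: lex_order_def refl_on_def)

text \<open>Two subjects that the tests order strictly and oppositely cross in every layout. No
  others cross if the first order breaks ties of \<open>t0\<close> by \<open>t1\<close>, the second
  breaks ties of \<open>t1\<close> by \<open>t0\<close>, and both break the remaining ties by the
  index.\<close>

lemma pcr_two_tests:
  fixes c n :: nat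
  assumes \<sigma>: "linear_order_on {..<c} \<sigma>"
    and r: "\<And>a b. a < c \<Longrightarrow> b < c \<Longrightarrow> (a, b) \<in> \<sigma> \<longleftrightarrow> r a \<le> r b"
    and t0: "\<And>s. s < n \<Longrightarrow> t0 s < c" and t1: "\<And>s. s < n \<Longrightarrow> t1 s < c"
  shows "pcr {..<n} [t0, t1] \<sigma> = (\<Sum>s<n. \<Sum>s'<n. inverted r (t0 s, t1 s) (t0 s', t1 s'))"
proof -
  let ?inv = "\<lambda>s s'. r (t0 s) < r (t0 s') \<and> r (t1 s') < r (t1 s)"
  define I where "I = {(s, s'). s < n \<and> s' < n \<and> ?inv s s'}"
  define X where "X = (\<lambda>\<pi> :: nat rel list. {(j, {s, s'}) | j s s'. Suc j < length \<pi> \<and> s \<in> {..<n} \<and> s' \<in> {..<n} \<and>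
    s \<noteq> s' \<and> ((s, s') \<in> \<pi> ! j) \<noteq> ((s, s') \<in> \<pi> ! Suc j)})"
  have cr: "crossings {..<n} \<pi> = card (X \<pi>)" for \<pi> :: "nat rel list"
    by (simp only: crossings_def X_def)
  let ?f = "\<lambda>(s, s'). (0::nat, {s, s'})"
  have strict: "(a, b) \<in> \<sigma> - Id \<longleftrightarrow> r a < r b" if "a < c" "b < c" for a b
  proof -
    have "(a, b) \<in> \<sigma> \<and> (b, a) \<in> \<sigma> \<longrightarrow> a = b"
      using \<sigma> by (auto simp: order_on_defs dest: antisymD)
    then show ?thesis using r[OF that] r[OF that(2,1)] by auto
  qed
  have "I \<subseteq> {..<n} \<times> {..<n}" by (auto simp: I_def)
  then have "finite I" by (rule finite_subset) simp
  have "inj_on ?f I"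
    by (auto simp: inj_on_def I_def doubleton_eq_iff)
  then have cardI: "card (?f ` I) = card I" by (rule card_image)
  have "card I = (\<Sum>s<n. \<Sum>s'<n. inverted r (t0 s, t1 s) (t0 s', t1 s'))"
  proof -
    have "I = ({..<n} \<times> {..<n}) \<inter> {p. ?inv (fst p) (snd p)}" by (auto simp: I_def)
    then have "card I = (\<Sum>p\<in>{..<n} \<times> {..<n}. of_bool (?inv (fst p) (snd p)))"
      by (simp only: sum_of_bool_eq finite_cartesian_product finite_lessThan of_nat_id)
    also have "\<dots> = (\<Sum>s<n. \<Sum>s'<n. inverted r (t0 s, t1 s) (t0 s', t1 s'))"
      unfolding sum.cartesian_product inverted_def by (intro sum.cong refl) auto
    finally show ?thesis .
  qed
  moreover have "card I \<le> crossings {..<n} \<pi>" if \<pi>: "layout {..<n} [t0, t1] \<sigma> \<pi>" for \<pi>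
  proof -
    have len: "length \<pi> = 2" using \<pi> by (simp add: layout_def)
    have lin: "linear_order_on {..<n} (\<pi> ! 1)" using \<pi> by (simp add: layout_def)
    have 0: "(s, s') \<in> \<pi> ! 0 - Id" if "s < n" "s' < n" "(t0 s, t0 s') \<in> \<sigma> - Id" for s s'
      using \<pi> that unfolding layout_def by (auto dest!: spec[of _ 0])
    have 1: "(s, s') \<in> \<pi> ! 1 - Id" if "s < n" "s' < n" "(t1 s, t1 s') \<in> \<sigma> - Id" for s s'
      using \<pi> that unfolding layout_def by (auto dest!: spec[of _ 1])
    have "?f ` I \<subseteq> X \<pi>"
    proof clarify
      fix s s' assume "(s, s') \<in> I"
      then have s: "s < n" "s' < n" "?inv s s'" by (auto simp: I_def)
      then have "(s, s') \<in> \<pi> ! 0 - Id" "(s', s) \<in> \<pi> ! 1 - Id"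
        by (simp_all only: 0 1 strict t0 t1)
      moreover from this have "(s, s') \<notin> \<pi> ! 1"
        using lin by (auto simp: order_on_defs dest: antisymD)
      ultimately show "(0, {s, s'}) \<in> X \<pi>"
        unfolding X_def using s len by (intro CollectI exI[of _ 0] exI[of _ s] exI[of _ s']) simp
    qed
    moreover have "X \<pi> \<subseteq> {..<length \<pi>} \<times> Pow {..<n}"
      unfolding X_def by auto
    then have "finite (X \<pi>)" by (rule finite_subset) simp
    ultimately show ?thesis
      unfolding cr cardI[symmetric] by (intro card_mono)
  qed
  moreover have "\<exists>\<pi>. layout {..<n} [t0, t1] \<sigma> \<pi> \<and> crossings {..<n} \<pi> \<le> card I"
  proof (intro exI conjI)
    let ?\<pi> = "[lex_order n (r \<circ> t0) (r \<circ> t1), lex_order n (r \<circ> t1) (r \<circ> t0)]"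
    show "layout {..<n} [t0, t1] \<sigma> ?\<pi>"
      unfolding layout_def
    proof (intro conjI allI impI ballI)
      fix j s s' assume "j < length [t0, t1]"
      then have j: "j = 0 \<or> j = 1" by auto
      then show "linear_order_on {..<n} (?\<pi> ! j)" by (auto simp: linear_lex_order)
      assume s: "s \<in> {..<n}" "s' \<in> {..<n}" "(([t0, t1] ! j) s, ([t0, t1] ! j) s') \<in> \<sigma> - Id"
      then have "t0 s < c" "t0 s' < c" "t1 s < c" "t1 s' < c" using t0 t1 by auto
      with j s(3) strict have "j = 0 \<and> r (t0 s) < r (t0 s') \<or> j = 1 \<and> r (t1 s) < r (t1 s')"
        by (elim disjE) simp_all
      with s show "(s, s') \<in> ?\<pi> ! j - Id" by (auto simp: lex_order_def)
    qed simp
    have "X ?\<pi> \<subseteq> ?f ` I"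
    proof
      fix p assume "p \<in> X ?\<pi>"
      then obtain j s s' where p: "p = (j, {s, s'})" "Suc j < 2" "s < n" "s' < n" "s \<noteq> s'"
        "((s, s') \<in> ?\<pi> ! j) \<noteq> ((s, s') \<in> ?\<pi> ! Suc j)"
        unfolding X_def by auto
      then have "?inv s s' \<or> ?inv s' s"
        by (auto simp: lex_order_def)
      then show "p \<in> ?f ` I"
        using p by (auto simp: I_def image_iff doubleton_eq_iff)
    qed
    then show "crossings {..<n} ?\<pi> \<le> card I"
      unfolding cr cardI[symmetric]
      using \<open>finite I\<close> by (intro card_mono) auto
  qed
  moreover have "\<exists>\<pi>. layout {..<n} [t0, t1] \<sigma> \<pi> \<and> crossings {..<n} \<pi> = pcr {..<n} [t0, t1] \<sigma>"
    using t0 t1 by (intro pcr_attained[OF _ \<sigma>]) (auto simp: panel_data_def)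
  moreover have "pcr {..<n} [t0, t1] \<sigma> \<le> crossings {..<n} \<pi>" if "layout {..<n} [t0, t1] \<sigma> \<pi>" for \<pi>
    unfolding pcr_def using that by (intro cInf_lower) auto
  ultimately show ?thesis by (metis le_antisym le_trans)
qed

section \<open>From cuts to crossings\<close>

text \<open>A loop \<open>(a, a)\<close> crosses an edge \<open>(u, v)\<close> iff \<open>a\<close> lies strictly between \<open>u\<close> and \<open>v\<close>. The extra
  category \<open>N\<close> separates the two sides of a cut of \<open>{..<N}\<close>. As exactly one of three categories is
  between the other two, the crossings of the loops at vertices with the edges to \<open>N\<close> and those of
  the loops at \<open>N\<close> with all edges of a complete graph add up to a constant, and leaving out an edge
  saves crossings iff it is cut. All other crossings are fewer than the weight \<open>W\<^sup>2\<close> of a cut edge.\<close>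

definition between :: "('a \<Rightarrow> nat) \<Rightarrow> 'a \<Rightarrow> 'a \<times> 'a \<Rightarrow> nat" where
  "between r a e = inverted r e (a, a) + inverted r (a, a) e"

definition vertex_loops :: "nat \<Rightarrow> nat \<Rightarrow> (nat \<times> nat) list" where
  "vertex_loops N W = concat (map (\<lambda>v. concat (map (\<lambda>_. [(v, v)]) [0..<W])) [0..<N])"

definition centre_loops :: "nat \<Rightarrow> nat \<Rightarrow> (nat \<times> nat) list" where
  "centre_loops N W = concat (map (\<lambda>_. [(N, N)]) [0..<W * W])"

text \<open>With \<open>W\<close> loops at each vertex the multiplicity gives a crossing of loop and
  spoke the weight \<open>2 * K * W * W\<close>. The loops at \<open>N\<close> give weight
  \<open>W * W\<close> to each edge of \<open>K\<close> complete graphs. This is the ratio 2 to 1 of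
  \<open>between_trichotomy\<close>.\<close>

definition spokes :: "nat \<Rightarrow> nat \<Rightarrow> nat \<Rightarrow> (nat \<times> nat) list" where
  "spokes N K W = concat (map (\<lambda>v. concat (map (\<lambda>_. [(v, N)]) [0..<2 * K * W])) [0..<N])"

text \<open>There is one complete graph for each edge of the cut instance, so that parallel edges
  can be left out as often as they occur.\<close>

definition co_edges :: "nat \<Rightarrow> nat \<Rightarrow> (nat \<Rightarrow> nat) \<Rightarrow> (nat \<Rightarrow> nat) \<Rightarrow> (nat \<times> nat) list" where
  "co_edges N K src dst = concat (map (\<lambda>i. concat (map (\<lambda>u. concat (map (\<lambda>v.
     if u = src i \<and> v = dst i then [] else [(u, v)]) [0..<N])) [0..<N])) [0..<K])"

text \<open>Let \<open>Q = K * K * (N * N * N * N)\<close>. As there are at most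
  \<open>K * (N * N)\<close> co-edges, their crossings with vertex loops are at most
  \<open>2 * W * Q\<close>, those with spokes at most \<open>4 * W * Q\<close>, and those among
  themselves at most \<open>Q\<close>. The choice \<open>W = 7 * Q + 1\<close> puts the total below
  \<open>W * W\<close>.\<close>

definition weight :: "nat \<Rightarrow> nat \<Rightarrow> nat" where
  "weight N K = 7 * (K * K * (N * N * N * N)) + 1"

definition cut_subjects :: "nat \<Rightarrow> nat \<Rightarrow> (nat \<Rightarrow> nat) \<Rightarrow> (nat \<Rightarrow> nat) \<Rightarrow> (nat \<times> nat) list" where
  "cut_subjects N K src dst = vertex_loops N (weight N K) @ centre_loops N (weight N K) @
     spokes N K (weight N K) @ co_edges N K src dst"

text \<open>The first summand is the number of heavy crossings for a cut of size exactly
  \<open>D\<close>. The slack \<open>W * W - 1\<close> absorbs all light crossings, yet is too small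
  to pay for one missing cut edge.\<close>

definition cut_bound :: "nat \<Rightarrow> nat \<Rightarrow> nat \<Rightarrow> nat" where
  "cut_bound N K D = weight N K * weight N K * (K * (N * (N - 1)) - D) + weight N K * weight N K - 1"

section \<open>Sums over lists of edges\<close>

lemma sum_list_concat_upt:
  "sum_list (map h (concat (map g [0..<n]))) = (\<Sum>i<n. sum_list (map h (g i)))" for h :: "_ \<Rightarrow> nat"
  by (induction n) auto

definition crs :: "('a \<Rightarrow> nat) \<Rightarrow> ('a \<times> 'a) list \<Rightarrow> ('a \<times> 'a) list \<Rightarrow> nat" where
  "crs r L L' = (\<Sum>e\<leftarrow>L. \<Sum>f\<leftarrow>L'. inverted r e f)"

lemma crs_append1: "crs r (L @ L') L'' = crs r L L'' + crs r L' L''"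
  by (simp add: crs_def)

lemma crs_append2: "crs r L (L' @ L'') = crs r L L' + crs r L L''"
  by (simp add: crs_def sum_list_addf)

lemma crs_le: "crs r L L' \<le> length L * length L'"
proof -
  have "(\<Sum>f\<leftarrow>L'. inverted r e f) \<le> length L'" for e
    by (induction L') (auto simp: inverted_def of_bool_def)
  then show ?thesis
    unfolding crs_def by (induction L) (auto intro: add_mono)
qed

lemma crs_eq_0: "(\<And>e f. e \<in> set L \<Longrightarrow> f \<in> set L' \<Longrightarrow> inverted r e f = 0) \<Longrightarrow> crs r L L' = 0"
  by (auto simp: crs_def sum_list_eq_0_iff)

text \<open>The premise says, in terms of sums, that \<open>A\<close> consists of \<open>k\<close>
  loops at each element of \<open>S\<close>.\<close>

lemma crs_loop_sum:
  assumes "\<And>h :: _ \<Rightarrow> nat. sum_list (map h A) = k * (\<Sum>a\<in>S. h (a, a))"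
  shows "crs r A L + crs r L A = k * (\<Sum>a\<in>S. \<Sum>e\<leftarrow>L. between r a e)"
proof -
  have "crs r L A = (\<Sum>e\<leftarrow>L. k * (\<Sum>a\<in>S. inverted r e (a, a)))"
    by (simp add: crs_def assms)
  also have "\<dots> = k * (\<Sum>a\<in>S. \<Sum>e\<leftarrow>L. inverted r e (a, a))"
    by (induction L) (auto simp: sum.distrib algebra_simps)
  finally show ?thesis
    by (simp add: crs_def assms between_def sum_list_addf sum.distrib algebra_simps)
qed

lemma sum_list_vertex_loops: "sum_list (map h (vertex_loops N W)) = W * (\<Sum>a<N. h (a, a))"
  for h :: "_ \<Rightarrow> nat"
  by (simp add: vertex_loops_def sum_list_concat_upt sum_distrib_left o_def sum_list_triv)

lemma sum_list_centre_loops: "sum_list (map h (centre_loops N W)) = W * W * (\<Sum>a\<in>{N}. h (a, a))"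
  for h :: "_ \<Rightarrow> nat"
  by (simp add: centre_loops_def sum_list_concat_upt o_def sum_list_triv)

lemma sum_list_spokes: "sum_list (map h (spokes N K W)) = 2 * K * W * (\<Sum>v<N. h (v, N))"
  for h :: "_ \<Rightarrow> nat"
  by (simp add: spokes_def sum_list_concat_upt sum_distrib_left o_def sum_list_triv)

lemma sum_list_co_edges:
  fixes h :: "_ \<Rightarrow> nat"
  assumes "\<And>i. i < K \<Longrightarrow> src i < N \<and> dst i < N"
  shows "sum_list (map h (co_edges N K src dst)) + (\<Sum>i<K. h (src i, dst i)) =
    K * (\<Sum>u<N. \<Sum>v<N. h (u, v))"
proof -
  have "(\<Sum>u<N. \<Sum>v<N. if u = a \<and> v = b then 0 else h (u, v)) + h (a, b) = (\<Sum>u<N. \<Sum>v<N. h (u, v))"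
    if "a < N" "b < N" for a b
  proof -
    have "(\<Sum>u<N. \<Sum>v<N. if u = a \<and> v = b then h (u, v) else 0) =
        (\<Sum>u<N. if u = a then (\<Sum>v<N. if v = b then h (u, v) else 0) else 0)"
      by (intro sum.cong) auto
    then have eq: "(\<Sum>u<N. \<Sum>v<N. if u = a \<and> v = b then h (u, v) else 0) = h (a, b)"
      using that by simp
    have "(\<Sum>u<N. \<Sum>v<N. if u = a \<and> v = b then 0 else h (u, v)) +
        (\<Sum>u<N. \<Sum>v<N. if u = a \<and> v = b then h (u, v) else 0) = (\<Sum>u<N. \<Sum>v<N. h (u, v))"
      unfolding sum.distrib[symmetric] by (intro sum.cong refl) simp
    then show ?thesis by (simp only: eq)
  qed
  then have "(\<Sum>i<K. (\<Sum>u<N. \<Sum>v<N. if u = src i \<and> v = dst i then 0 else h (u, v)) + h (src i, dst i)) =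
      (\<Sum>i<K. \<Sum>u<N. \<Sum>v<N. h (u, v))"
    using assms by (intro sum.cong) auto
  then show ?thesis
    by (simp add: co_edges_def sum_list_concat_upt sum.distrib if_distrib cong: if_cong)
qed

text \<open>Over ordered pairs, the cases of \<open>u\<close> in the middle and of \<open>v\<close>
  in the middle have equal totals, whence the factor 2. The right-hand side does not depend on
  \<open>r\<close>: the balance of the two sides has cancelled.\<close>

lemma between_trichotomy:
  assumes "inj_on r {..N}"
  shows "2 * (\<Sum>u<N. \<Sum>v<N. between r u (v, N)) + (\<Sum>u<N. \<Sum>v<N. between r N (u, v)) = N * (N - 1)"
proof -
  have "between r u (v, N) + between r v (u, N) + between r N (u, v) = of_bool (u \<noteq> v)"
    if "u < N" "v < N" for u v
  proof -
    have "u \<noteq> v \<Longrightarrow> r u \<noteq> r v" "r u \<noteq> r N" "r v \<noteq> r N"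
      using assms that by (auto dest: inj_onD)
    then show ?thesis
      by (cases "u = v"; cases "r u < r v"; cases "r u < r N"; cases "r v < r N")
        (simp_all add: between_def inverted_def)
  qed
  then have "(\<Sum>u<N. \<Sum>v<N. between r u (v, N) + between r v (u, N) + between r N (u, v)) =
      (\<Sum>u<N. \<Sum>v<N. of_bool (u \<noteq> v))"
    by (intro sum.cong) auto
  moreover have "(\<Sum>v<N. of_bool (u \<noteq> v) :: nat) = N - 1" if "u < N" for u
  proof -
    have "{..<N} \<inter> {v. u \<noteq> v} = {..<N} - {u}" by auto
    then show ?thesis using that by (simp add: sum_of_bool_eq)
  qed
  moreover have "(\<Sum>u<N. \<Sum>v<N. between r v (u, N)) = (\<Sum>u<N. \<Sum>v<N. between r u (v, N))"
    by (rule sum.swap)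
  ultimately show ?thesis by (simp add: sum.distrib)
qed

lemma length_co_edges:
  assumes "\<And>i. i < K \<Longrightarrow> src i < N \<and> dst i < N"
  shows "length (co_edges N K src dst) \<le> K * (N * N)"
  using sum_list_co_edges[where h = "\<lambda>_. 1" and K = K and src = src and dst = dst, OF assms]
  by (simp add: sum_list_triv)

lemma weight_bound:
  fixes N K :: nat
  defines "W \<equiv> weight N K"
  assumes "E \<le> K * (N * N)"
  shows "2 * (N * W * E) + 2 * (N * (2 * K * W) * E) + E * E < W * W"
proof -
  define Q where "Q = K * K * (N * N * N * N)"
  have K: "K \<le> K * K" and N: "N * N * N \<le> N * N * N * N" by (cases K; simp) (cases N; simp)
  have W: "W = 7 * Q + 1" by (simp add: W_def weight_def Q_def)
  have "N * W * E \<le> N * W * (K * (N * N))" using assms(2) by (rule mult_left_mono) simp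
  also have "\<dots> = W * (K * (N * N * N))" by (simp add: algebra_simps)
  also have "\<dots> \<le> W * Q" unfolding Q_def by (intro mult_left_mono mult_mono K N) auto
  finally have 1: "N * W * E \<le> W * Q" .
  have "N * (2 * K * W) * E \<le> N * (2 * K * W) * (K * (N * N))"
    using assms(2) by (rule mult_left_mono) simp
  also have "\<dots> = 2 * (W * (K * K * (N * N * N)))" by (simp add: algebra_simps)
  also have "\<dots> \<le> 2 * (W * Q)" unfolding Q_def by (intro mult_left_mono mult_mono K N) auto
  finally have 2: "N * (2 * K * W) * E \<le> 2 * (W * Q)" .
  have "E * E \<le> (K * (N * N)) * (K * (N * N))" using assms(2) by (intro mult_mono) auto
  also have "\<dots> = Q" by (simp add: Q_def algebra_simps)
  finally have 3: "E * E \<le> Q" .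
  have "W * W = 7 * (W * Q) + W" by (simp add: W algebra_simps)
  moreover have "Q \<le> W * Q" by (simp add: W)
  ultimately show ?thesis using 1 2 3 W by linarith
qed

lemma cut_crossings:
  fixes r :: "nat \<Rightarrow> nat"
  assumes r: "inj_on r {..N}" and e: "\<And>i. i < K \<Longrightarrow> src i < N \<and> dst i < N"
    and D: "D \<le> K * (N * (N - 1))"
  shows "crs r (cut_subjects N K src dst) (cut_subjects N K src dst) \<le> cut_bound N K D \<longleftrightarrow>
    D \<le> (\<Sum>i<K. between r N (src i, dst i))"
proof -
  define W where "W = weight N K"
  define A B C E where "A = vertex_loops N W" and "B = centre_loops N W" and "C = spokes N K W"
    and "E = co_edges N K src dst"
  define S where "S = cut_subjects N K src dst"
  have S: "S = A @ B @ C @ E" by (simp add: S_def cut_subjects_def A_def B_def C_def E_def W_def)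
  define cut where "cut = (\<Sum>i<K. between r N (src i, dst i))"
  define main where "main = (crs r A C + crs r C A) + (crs r B E + crs r E B)"
  have setA: "fst p = snd p" if "p \<in> set A" for p using that by (auto simp: A_def vertex_loops_def)
  have setB: "p = (N, N)" if "p \<in> set B" for p using that by (auto simp: B_def centre_loops_def)
  have setC: "snd p = N" if "p \<in> set C" for p using that by (auto simp: C_def spokes_def)
  \<comment> \<open>Loops are ordered alike at both ends, spokes share their target
    \<open>N\<close>, and a loop at \<open>N\<close> shares this target with every spoke.\<close>
  have zero: "crs r A A = 0" "crs r A B = 0" "crs r B A = 0" "crs r B B = 0" "crs r C C = 0"
    "crs r B C = 0" "crs r C B = 0"
    by (rule crs_eq_0, auto dest!: setA setB setC simp: inverted_def)+
  have "crs r S S = main + (crs r A E + crs r E A + (crs r C E + crs r E C) + crs r E E)"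
    unfolding S crs_append1 crs_append2 main_def by (simp add: zero)
  moreover have "crs r A E + crs r E A + (crs r C E + crs r E C) + crs r E E < W * W"
  proof -
    have len: "length A = N * W" "length C = N * (2 * K * W)"
      by (simp_all add: A_def C_def vertex_loops_def spokes_def length_concat o_def sum_list_triv)
    have "crs r A E \<le> N * W * length E" "crs r C E \<le> N * (2 * K * W) * length E"
      using crs_le[of r A E] crs_le[of r C E] by (simp_all only: len)
    moreover have "crs r E A \<le> N * W * length E"
      using crs_le[of r E A] by (simp only: len mult.commute[of "length E" "N * W"])
    moreover have "crs r E C \<le> N * (2 * K * W) * length E"
      using crs_le[of r E C] by (simp only: len mult.commute[of "length E" "N * (2 * K * W)"])
    moreover have "crs r E E \<le> length E * length E" by (rule crs_le)
    moreover have "2 * (N * W * length E) + 2 * (N * (2 * K * W) * length E) + length E * length E < W * W"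
      unfolding W_def by (rule weight_bound) (unfold E_def, rule length_co_edges[OF e])
    ultimately show ?thesis by linarith
  qed
  moreover have "main + W * W * cut = W * W * (K * (N * (N - 1)))"
  proof -
    have 1: "crs r A C + crs r C A = 2 * (W * W * K) * (\<Sum>u<N. \<Sum>v<N. between r u (v, N))"
      unfolding A_def C_def crs_loop_sum[OF sum_list_vertex_loops] sum_list_spokes
      by (simp add: sum_distrib_left algebra_simps)
    have co: "(\<Sum>e\<leftarrow>E. between r N e) + cut = K * (\<Sum>u<N. \<Sum>v<N. between r N (u, v))"
      unfolding cut_def E_def by (rule sum_list_co_edges[OF e])
    have "crs r B E + crs r E B = W * W * (\<Sum>e\<leftarrow>E. between r N e)"
      unfolding B_def crs_loop_sum[OF sum_list_centre_loops] by simp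
    then have 2: "crs r B E + crs r E B + W * W * cut = W * W * K * (\<Sum>u<N. \<Sum>v<N. between r N (u, v))"
      by (simp only: mult.assoc[of "W * W" K] co[symmetric] add_mult_distrib2)
    have "main + W * W * cut = (crs r A C + crs r C A) + (crs r B E + crs r E B + W * W * cut)"
      by (simp add: main_def)
    also have "\<dots> = W * W * K *
        (2 * (\<Sum>u<N. \<Sum>v<N. between r u (v, N)) + (\<Sum>u<N. \<Sum>v<N. between r N (u, v)))"
      unfolding 1 2 by (simp add: algebra_simps)
    finally have "main + W * W * cut = W * W * K *
        (2 * (\<Sum>u<N. \<Sum>v<N. between r u (v, N)) + (\<Sum>u<N. \<Sum>v<N. between r N (u, v)))" .
    then show ?thesis unfolding between_trichotomy[OF r] by (simp add: mult.assoc)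
  qed
  moreover have "W * W * (K * (N * (N - 1)) - D) + W * W * D = W * W * (K * (N * (N - 1)))"
    using D by (simp add: add_mult_distrib2[symmetric])
  moreover have "0 < W * W" by (simp add: W_def weight_def)
  moreover have "cut_bound N K D = W * W * (K * (N * (N - 1)) - D) + W * W - 1"
    by (simp add: cut_bound_def W_def)
  moreover have "W * W * D \<le> W * W * cut" if "D \<le> cut" using that by simp
  moreover have "W * W * cut + W * W \<le> W * W * D" if "\<not> D \<le> cut"
  proof -
    have "W * W * Suc cut \<le> W * W * D" using that by (intro mult_left_mono) auto
    then show ?thesis by simp
  qed
  ultimately have "crs r S S \<le> cut_bound N K D \<longleftrightarrow> D \<le> cut"
    by (cases "D \<le> cut") linarith+
  then show ?thesis by (simp add: S_def cut_def)
qed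

section \<open>From satisfiability to cuts\<close>

definition edge_yes :: "nat \<Rightarrow> (nat \<times> nat) list \<Rightarrow> nat \<Rightarrow> bool" where
  "edge_yes c L k \<longleftrightarrow> panel_crossing_yes {..<length L} {..<c} [\<lambda>s. fst (L ! s), \<lambda>s. snd (L ! s)] (int k)"

lemma edge_yes_rank:
  assumes "\<And>e. e \<in> set L \<Longrightarrow> fst e < c \<and> snd e < c"
  shows "edge_yes c L k \<longleftrightarrow> (\<exists>r. inj_on r {..<c} \<and> crs r L L \<le> k)"
proof -
  let ?T = "[\<lambda>s. fst (L ! s), \<lambda>s. snd (L ! s)]"
  have pcr: "pcr {..<length L} ?T \<sigma> = crs r L L"
    if "linear_order_on {..<c} \<sigma>" "\<And>a b. a < c \<Longrightarrow> b < c \<Longrightarrow> (a, b) \<in> \<sigma> \<longleftrightarrow> r a \<le> r b" for \<sigma> r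
  proof -
    have "pcr {..<length L} ?T \<sigma> = (\<Sum>s<length L. \<Sum>s'<length L. inverted r (L ! s) (L ! s'))"
      using pcr_two_tests[OF that, of "length L" "\<lambda>s. fst (L ! s)" "\<lambda>s. snd (L ! s)"] assms by simp
    then show ?thesis by (simp add: crs_def sum_list_sum_nth atLeast0LessThan)
  qed
  show ?thesis
  proof
    assume "edge_yes c L k"
    then obtain \<sigma> where \<sigma>: "linear_order_on {..<c} \<sigma>" "pcr {..<length L} ?T \<sigma> \<le> k"
      unfolding edge_yes_def panel_crossing_yes_def by auto
    obtain r :: "nat \<Rightarrow> nat" where r: "\<And>a b. a < c \<Longrightarrow> b < c \<Longrightarrow> (a, b) \<in> \<sigma> \<longleftrightarrow> r a \<le> r b"
      using linear_order_rank[OF \<sigma>(1) finite_lessThan] unfolding lessThan_iff by metis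
    have "a = b" if "a < c" "b < c" "r a = r b" for a b
      using \<sigma>(1) r[of a b] r[of b a] that by (auto simp: order_on_defs dest: antisymD)
    then have "inj_on r {..<c}" by (auto intro: inj_onI)
    with \<sigma> pcr[OF \<sigma>(1) r] show "\<exists>r. inj_on r {..<c} \<and> crs r L L \<le> k" by auto
  next
    assume "\<exists>r. inj_on r {..<c} \<and> crs r L L \<le> k"
    then obtain r where r: "inj_on r {..<c}" "crs r L L \<le> k" by blast
    have "pcr {..<length L} ?T (rank_order {..<c} r) = crs r L L"
      by (rule pcr[OF linear_rank_order[OF r(1)]]) (simp add: rank_order_def)
    then show "edge_yes c L k"
      using r linear_rank_order[OF r(1)] unfolding edge_yes_def panel_crossing_yes_def
      by (intro exI[of _ "rank_order {..<c} r"]) simp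
  qed
qed

lemma cut_subjects_range:
  assumes "e \<in> set (cut_subjects N K src dst)"
  shows "fst e < Suc N \<and> snd e < Suc N"
  using assms unfolding cut_subjects_def vertex_loops_def centre_loops_def spokes_def co_edges_def
  by (auto split: if_splits)

lemma edge_yes_cut:
  assumes e: "\<And>i. i < K \<Longrightarrow> src i < N \<and> dst i < N" and D: "D \<le> K * (N * (N - 1))"
  shows "edge_yes (Suc N) (cut_subjects N K src dst) (cut_bound N K D) \<longleftrightarrow>
    (\<exists>col. D \<le> (\<Sum>i<K. of_bool (col (src i) \<noteq> (col (dst i) :: bool))))"
proof -
  let ?S = "cut_subjects N K src dst"
  let ?few = "\<lambda>r. crs r ?S ?S \<le> cut_bound N K D"
  have "edge_yes (Suc N) ?S (cut_bound N K D) \<longleftrightarrow> (\<exists>r. inj_on r {..<Suc N} \<and> ?few r)"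
    by (rule edge_yes_rank) (rule cut_subjects_range)
  also have "\<dots> \<longleftrightarrow> (\<exists>col. D \<le> (\<Sum>i<K. of_bool (col (src i) \<noteq> (col (dst i) :: bool))))"
  proof
  assume "\<exists>r. inj_on r {..<Suc N} \<and> ?few r"
  then obtain r where inj: "inj_on r {..<Suc N}" and
    "?few r"
    by blast
  with cut_crossings[OF inj[unfolded lessThan_Suc_atMost] e D]
  have r: "inj_on r {..N}" "D \<le> (\<Sum>i<K. between r N (src i, dst i))"
    by (simp_all only: lessThan_Suc_atMost)
  have "between r N (u, v) = of_bool ((r u < r N) \<noteq> (r v < r N))" if "u < N" "v < N" for u v
  proof -
    have "r u \<noteq> r N" "r v \<noteq> r N" using r(1) that by (auto dest: inj_onD)
    then show ?thesis by (auto simp: between_def inverted_def)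
  qed
  then have "(\<Sum>i<K. between r N (src i, dst i)) =
      (\<Sum>i<K. of_bool ((r (src i) < r N) \<noteq> (r (dst i) < r N)))"
    using e by (intro sum.cong refl) simp
  with r(2) have "D \<le> (\<Sum>i<K. of_bool ((r (src i) < r N) \<noteq> (r (dst i) < r N)))" by simp
  then show "\<exists>col. D \<le> (\<Sum>i<K. of_bool (col (src i) \<noteq> (col (dst i) :: bool)))"
    by (rule exI[of _ "\<lambda>u. r u < r N"])
next
  assume "\<exists>col. D \<le> (\<Sum>i<K. of_bool (col (src i) \<noteq> (col (dst i) :: bool)))"
  then obtain col :: "nat \<Rightarrow> bool" where col: "D \<le> (\<Sum>i<K. of_bool (col (src i) \<noteq> col (dst i)))" by blast
  \<comment> \<open>Vertices of colour \<open>True\<close> are placed before \<open>N\<close>, the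
    others after it.\<close>
  define r where "r v = (if v = N then N else if col v then v else N + 1 + v)" for v
  have inj: "inj_on r {..N}" by (auto simp: inj_on_def r_def)
  have "between r N (u, v) = of_bool (col u \<noteq> col v)" if "u < N" "v < N" for u v
    using that by (auto simp: between_def inverted_def r_def)
  then have "(\<Sum>i<K. between r N (src i, dst i)) = (\<Sum>i<K. of_bool (col (src i) \<noteq> col (dst i)))"
    using e by (intro sum.cong refl) simp
  with col have "D \<le> (\<Sum>i<K. between r N (src i, dst i))" by simp
  moreover have "?few r \<longleftrightarrow>
      D \<le> (\<Sum>i<K. between r N (src i, dst i))"
    by (rule cut_crossings[OF inj _ D]) (rule e)
  ultimately have "?few r"
    by (rule iffD2[rotated])
  with inj show "\<exists>r. inj_on r {..<Suc N} \<and>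
      ?few r"
    unfolding lessThan_Suc_atMost by blast
  qed
  finally show ?thesis .
qed

text \<open>A triangle contributes two edges to a cut unless it is monochromatic.\<close>

definition tri_u :: "(nat \<Rightarrow> nat \<Rightarrow> nat) \<Rightarrow> nat \<Rightarrow> nat" where
  "tri_u \<tau> i = \<tau> (i div 3) (if i mod 3 = 1 then 1 else 0)"

definition tri_v :: "(nat \<Rightarrow> nat \<Rightarrow> nat) \<Rightarrow> nat \<Rightarrow> nat" where
  "tri_v \<tau> i = \<tau> (i div 3) (if i mod 3 = 0 then 1 else 2)"

lemma sum_triples: "(\<Sum>i<3 * m. f i) = (\<Sum>i<m. f (3 * i) + f (3 * i + 1) + f (3 * i + 2))"
  for f :: "nat \<Rightarrow> nat"
  by (induction m) (simp_all add: numeral_3_eq_3 add_ac)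

text \<open>No triangle contributes more than two edges to a cut, so the value \<open>2 * m\<close>
  leaves no room for a monochromatic one. This covers degenerate triangles with a repeated vertex,
  which force two vertices to differ.\<close>

lemma edge_yes_triangles:
  assumes \<tau>: "\<And>i j. i < m \<Longrightarrow> j < 3 \<Longrightarrow> \<tau> i j < N" and N: "2 \<le> N"
  shows "edge_yes (Suc N) (cut_subjects N (3 * m) (tri_u \<tau>) (tri_v \<tau>)) (cut_bound N (3 * m) (2 * m)) \<longleftrightarrow>
    (\<exists>col. \<forall>i<m. \<not> (col (\<tau> i 0) = (col (\<tau> i 1) :: bool) \<and> col (\<tau> i 1) = col (\<tau> i 2)))"
proof -
  have "2 * m \<le> 3 * m * (N * (N - 1))"
  proof -
    have "1 \<le> N * (N - 1)" using N by (cases N) auto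
    then have "2 * m * 1 \<le> 3 * m * (N * (N - 1))" by (intro mult_mono) auto
    then show ?thesis by simp
  qed
  moreover have "tri_u \<tau> i < N \<and> tri_v \<tau> i < N" if "i < 3 * m" for i
    using that by (auto simp: tri_u_def tri_v_def intro!: \<tau>)
  moreover have "2 * m \<le> (\<Sum>i<3 * m. of_bool (col (tri_u \<tau> i) \<noteq> col (tri_v \<tau> i))) \<longleftrightarrow>
      (\<forall>i<m. \<not> (col (\<tau> i 0) = col (\<tau> i 1) \<and> col (\<tau> i 1) = col (\<tau> i 2)))" for col :: "nat \<Rightarrow> bool"
  proof -
    let ?g = "\<lambda>i. of_bool (col (\<tau> i 0) \<noteq> col (\<tau> i 1)) + of_bool (col (\<tau> i 1) \<noteq> col (\<tau> i 2)) +
      of_bool (col (\<tau> i 0) \<noteq> col (\<tau> i 2)) :: nat"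
    have 3: "(3 * i) div 3 = i" "(3 * i + 1) div 3 = i" "(3 * i + 2) div 3 = i"
      "(3 * i) mod 3 = 0" "(3 * i + 1) mod 3 = 1" "(3 * i + 2) mod 3 = 2" for i :: nat
      by presburger+
    have "(\<Sum>i<3 * m. of_bool (col (tri_u \<tau> i) \<noteq> col (tri_v \<tau> i))) = (\<Sum>i<m. ?g i)"
      unfolding sum_triples tri_u_def tri_v_def 3 by (intro sum.cong refl) simp
    moreover have "2 * m \<le> (\<Sum>i<m. ?g i) \<longleftrightarrow>
        (\<forall>i<m. \<not> (col (\<tau> i 0) = col (\<tau> i 1) \<and> col (\<tau> i 1) = col (\<tau> i 2)))"
    proof -
      define bad :: nat where "bad = (\<Sum>i<m. if col (\<tau> i 0) = col (\<tau> i 1) \<and> col (\<tau> i 1) = col (\<tau> i 2) then 2 else 0)"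
      have "(\<Sum>i<m. ?g i) + bad = (\<Sum>i<m. 2)"
        unfolding bad_def sum.distrib[symmetric] by (intro sum.cong refl) auto
      then have "(\<Sum>i<m. ?g i) + bad = 2 * m" by simp
      then have "2 * m \<le> (\<Sum>i<m. ?g i) \<longleftrightarrow> bad = 0" by linarith
      also have "\<dots> \<longleftrightarrow> (\<forall>i<m. \<not> (col (\<tau> i 0) = col (\<tau> i 1) \<and> col (\<tau> i 1) = col (\<tau> i 2)))"
        by (auto simp: bad_def sum_eq_0_iff)
      finally show ?thesis .
    qed
    ultimately show ?thesis by simp
  qed
  ultimately show ?thesis by (subst edge_yes_cut) auto
qed

section \<open>Clauses as triangles\<close>

definition lit :: "(nat \<Rightarrow> bool) \<Rightarrow> nat \<Rightarrow> bool" where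
  "lit \<alpha> l \<longleftrightarrow> (if even l then \<alpha> (l div 2) else \<not> \<alpha> (l div 2))"

definition satisfiable :: "nat \<Rightarrow> (nat \<Rightarrow> nat \<Rightarrow> nat \<Rightarrow> bool) \<Rightarrow> bool" where
  "satisfiable M Cl \<longleftrightarrow> (\<exists>\<alpha>. \<forall>a<M. \<forall>b<M. \<forall>c<M. Cl a b c \<longrightarrow> lit \<alpha> a \<or> lit \<alpha> b \<or> lit \<alpha> c)"

text \<open>The code \<open>p\<close> is read in base \<open>M\<close> as three literals, the least
  significant digit first. The bound on the leading digit leaves no codes from
  \<open>M * M * M\<close> on.\<close>

definition is_clause :: "nat \<Rightarrow> (nat \<Rightarrow> nat \<Rightarrow> nat \<Rightarrow> bool) \<Rightarrow> nat \<Rightarrow> bool" where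
  "is_clause M Cl p \<longleftrightarrow> p div M div M < M \<and> Cl (p mod M) (p div M mod M) (p div M div M)"

text \<open>Vertex \<open>0\<close> has the colour of false literals, vertex \<open>2 + l\<close> belongs to the literal
  \<open>l\<close>, vertex \<open>2 + M + 2 * p\<close> is an auxiliary vertex for the clause with code \<open>p\<close>, and the
  vertices \<open>2 * p\<close> and \<open>2 * p + 1\<close> get opposite colours. Non-clauses contribute the harmless
  triangle \<open>0, 0, 1\<close>.\<close>

definition sat_triangle :: "nat \<Rightarrow> (nat \<Rightarrow> nat \<Rightarrow> nat \<Rightarrow> bool) \<Rightarrow> nat \<Rightarrow> nat \<Rightarrow> nat" where
  "sat_triangle M Cl i j =
     (if i mod 3 = 0 then (if j = 2 then 2 * (i div 3) + 1 else 2 * (i div 3))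
      else if \<not> is_clause M Cl (i div 3) then (if j = 2 then 1 else 0)
      else if i mod 3 = 1 then (if j = 0 then 2 + i div 3 mod M
        else if j = 1 then 2 + i div 3 div M mod M else 2 + M + 2 * (i div 3))
      else (if j = 0 then 2 + M + 2 * (i div 3) + 1 else if j = 1 then 2 + i div 3 div M div M else 0))"

text \<open>This is the number of pairs of oppositely coloured vertices: the pair of the constants,
  one pair for each of \<open>h\<close> variables, and one auxiliary pair for each triple of the
  \<open>2 * h\<close> literals. A number \<open>p\<close> below it indexes both a pair and a
  possible clause.\<close>

definition sat_half :: "nat \<Rightarrow> nat" where
  "sat_half h = 1 + h + 2 * h * (2 * h) * (2 * h)"

lemma less_3_times: "(\<forall>i<3 * P. Q i) \<longleftrightarrow> (\<forall>p<P. Q (3 * p) \<and> Q (3 * p + 1) \<and> Q (3 * p + 2))" for P :: nat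
proof
  assume *: "\<forall>p<P. Q (3 * p) \<and> Q (3 * p + 1) \<and> Q (3 * p + 2)"
  show "\<forall>i<3 * P. Q i"
  proof (intro allI impI)
    fix i assume "i < 3 * P"
    then have "i div 3 < P" by auto
    moreover have "i = 3 * (i div 3) \<or> i = 3 * (i div 3) + 1 \<or> i = 3 * (i div 3) + 2" by presburger
    ultimately show "Q i" using * by metis
  qed
qed auto

lemma is_clause_less: "is_clause M Cl p \<Longrightarrow> p < M * M * M"
  by (cases "M = 0") (auto simp: is_clause_def div_less_iff_less_mult mult.assoc)

lemma sat_triangle_less:
  assumes "i < 3 * sat_half h"
  shows "sat_triangle (2 * h) Cl i j < 2 * sat_half h"
proof -
  have *: "i div 3 < sat_half h" using assms by auto
  have "0 < h" if "is_clause (2 * h) Cl (i div 3)"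
    using that by (cases "h = 0") (auto simp: is_clause_def)
  with * is_clause_less[of "2 * h" Cl "i div 3"] show ?thesis
    by (cases "is_clause (2 * h) Cl (i div 3)")
      (auto simp: sat_triangle_def sat_half_def is_clause_def intro!: trans_less_add1)
qed

text \<open>A clause with literals \<open>a\<close>, \<open>b\<close>, \<open>c\<close> becomes two
  triangles: \<open>a\<close>, \<open>b\<close>, \<open>y\<close> and the opposite of
  \<open>y\<close> with \<open>c\<close> and vertex \<open>0\<close>. If all three literals have the
  colour of vertex \<open>0\<close>, then the first triangle forces \<open>y\<close> to the other
  colour, and the second is monochromatic. Truth is read as differing from vertex \<open>0\<close>,
  as both constants may be swapped.\<close>

lemma satisfiable_triangles:
  "(\<exists>col. \<forall>i<3 * sat_half h. \<not> (col (sat_triangle (2 * h) Cl i 0) = (col (sat_triangle (2 * h) Cl i 1) :: bool) \<and>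
      col (sat_triangle (2 * h) Cl i 1) = col (sat_triangle (2 * h) Cl i 2))) \<longleftrightarrow>
   satisfiable (2 * h) Cl"
proof -
  define M where "M = 2 * h"
  define P where "P = sat_half h"
  let ?A = "\<lambda>p. p mod M" and ?B = "\<lambda>p. p div M mod M" and ?C = "\<lambda>p. p div M div M"
  let ?good = "\<lambda>col :: nat \<Rightarrow> bool. \<forall>p<P. col (2 * p) \<noteq> col (2 * p + 1) \<and> (is_clause M Cl p \<longrightarrow>
     \<not> (col (2 + ?A p) = col (2 + ?B p) \<and> col (2 + ?B p) = col (2 + M + 2 * p)) \<and>
     \<not> (col (2 + M + 2 * p + 1) = col (2 + ?C p) \<and> col (2 + ?C p) = col 0))"
  have P: "P = 1 + h + M * M * M" by (simp add: P_def M_def sat_half_def)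
  have 3: "(3 * p) div 3 = p" "(3 * p + 1) div 3 = p" "(3 * p + 2) div 3 = p"
    "(3 * p) mod 3 = 0" "(3 * p + 1) mod 3 = 1" "(3 * p + 2) mod 3 = 2" for p :: nat
    by presburger+
  have good: "(\<forall>i<3 * P. \<not> (col (sat_triangle M Cl i 0) = col (sat_triangle M Cl i 1) \<and>
      col (sat_triangle M Cl i 1) = col (sat_triangle M Cl i 2))) \<longleftrightarrow> ?good col" (is "?l \<longleftrightarrow> _") for col :: "nat \<Rightarrow> bool"
  proof -
    have "?l \<longleftrightarrow> (\<forall>p<P. col (2 * p) \<noteq> col (2 * p + 1) \<and>
      (if is_clause M Cl p then
         \<not> (col (2 + ?A p) = col (2 + ?B p) \<and> col (2 + ?B p) = col (2 + M + 2 * p)) \<and>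
         \<not> (col (2 + M + 2 * p + 1) = col (2 + ?C p) \<and> col (2 + ?C p) = col 0)
       else col 0 \<noteq> col 1))"
      unfolding less_3_times by (intro all_cong) (simp add: sat_triangle_def 3[simplified] 3)
    also have "\<dots> \<longleftrightarrow> ?good col"
    proof -
      \<comment> \<open>The condition \<open>col 0 \<noteq> col 1\<close> imposed by non-clauses is
        already the case \<open>p = 0\<close> of opposite colours.\<close>
      have "0 < P" by (simp add: P)
      then have "(\<forall>p<P. col (2 * p) \<noteq> col (2 * p + 1)) \<Longrightarrow> col 0 \<noteq> col 1"
        by (drule_tac spec[of _ 0]) simp
      then show ?thesis by (smt (verit, best))
    qed
    finally show ?thesis .
  qed
  have "(\<exists>col. ?good col) \<longleftrightarrow> satisfiable M Cl"
  proof
    assume "\<exists>col. ?good col"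
    then obtain col where col: "?good col" by blast
    define \<alpha> where "\<alpha> v = (col (2 + 2 * v) \<noteq> col 0)" for v
    have neg: "col (2 * p) \<noteq> col (2 * p + 1)" if "p < P" for p using col that by blast
    have lit: "lit \<alpha> l \<longleftrightarrow> col (2 + l) \<noteq> col 0" if "l < M" for l
    proof (cases "even l")
      case True
      then obtain v where "l = 2 * v" by auto
      then show ?thesis by (simp add: lit_def \<alpha>_def)
    next
      case False
      then obtain v where v: "l = 2 * v + 1" by (auto elim: oddE)
      then have "1 + v < P" using that by (simp add: P M_def)
      from neg[OF this] v show ?thesis by (auto simp: lit_def \<alpha>_def)
    qed
    have "lit \<alpha> a \<or> lit \<alpha> b \<or> lit \<alpha> c" if l: "a < M" "b < M" "c < M" and "Cl a b c" for a b c
    proof -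
      define p where "p = a + M * (b + M * c)"
      have p: "p mod M = a" "p div M mod M = b" "p div M div M = c"
        using l by (simp_all add: p_def)
      then have cl: "is_clause M Cl p" using that by (simp add: is_clause_def)
      then have "p < M * M * M" by (rule is_clause_less)
      then have "p < P" "1 + h + p < P" by (simp_all add: P)
      moreover have "2 * (1 + h + p) = 2 + M + 2 * p" by (simp add: M_def)
      ultimately have "col (2 + M + 2 * p) \<noteq> col (2 + M + 2 * p + 1)"
        using neg[of "1 + h + p"] by simp
      moreover have "\<not> (col (2 + a) = col (2 + b) \<and> col (2 + b) = col (2 + M + 2 * p))"
        "\<not> (col (2 + M + 2 * p + 1) = col (2 + c) \<and> col (2 + c) = col 0)"
        using col \<open>p < P\<close> cl p by metis+
      ultimately show ?thesis
        unfolding lit[OF l(1)] lit[OF l(2)] lit[OF l(3)] by blast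
    qed
    then show "satisfiable M Cl" unfolding satisfiable_def by blast
  next
    assume "satisfiable M Cl"
    then obtain \<alpha> where \<alpha>: "\<And>a b c. a < M \<Longrightarrow> b < M \<Longrightarrow> c < M \<Longrightarrow> Cl a b c \<Longrightarrow>
        lit \<alpha> a \<or> lit \<alpha> b \<or> lit \<alpha> c"
      unfolding satisfiable_def by blast
    \<comment> \<open>If the first two literals agree, \<open>y\<close> has to differ from them, and
      the second triangle then contains their value and that of the third literal. Otherwise
      \<open>y\<close> copies the third literal, and the second triangle contains this value and its
      negation.\<close>
    define y where "y p = (if lit \<alpha> (?A p) = lit \<alpha> (?B p) then \<not> lit \<alpha> (?A p) else lit \<alpha> (?C p))" for p
    define col where "col v = (if v < 2 then v = 1 else if v < 2 + M then lit \<alpha> (v - 2)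
      else y ((v - 2 - M) div 2) = even v)" for v
    have "?good col"
    proof (intro allI impI conjI)
      fix p assume "p < P"
      consider "p = 0" | q where "p = Suc q" "q < h" | q where "p = 1 + h + q"
        by (metis add.commute le_Suc_ex not_less not0_implies_Suc plus_1_eq_Suc Suc_le_eq less_Suc_eq_le not_less_eq)
      then show "col (2 * p) \<noteq> col (2 * p + 1)"
      proof cases
        case 3
        have "(2 * (1 + h + q) - 2 - M) div 2 = q" "(2 * (1 + h + q) + 1 - 2 - M) div 2 = q"
          by (simp_all add: M_def)
        then show ?thesis using 3 by (simp add: col_def M_def)
      qed (auto simp: col_def M_def lit_def)
    next
      fix p assume "is_clause M Cl p"
      then have M: "M \<noteq> 0" and c: "?C p < M" and cl: "Cl (?A p) (?B p) (?C p)"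
        by (auto simp: is_clause_def)
      then have ab: "?A p < M" "?B p < M" by simp_all
      have col': "col (2 + l) = lit \<alpha> l" if "l < M" for l using that by (simp add: col_def)
      have yp: "col (2 + M + 2 * p) = y p" "col (2 + M + 2 * p + 1) = (\<not> y p)" "\<not> col 0"
        by (simp_all add: col_def M_def)
      show "\<not> (col (2 + ?A p) = col (2 + ?B p) \<and> col (2 + ?B p) = col (2 + M + 2 * p))"
        unfolding yp col'[OF ab(1)] col'[OF ab(2)] by (auto simp: y_def)
      show "\<not> (col (2 + M + 2 * p + 1) = col (2 + ?C p) \<and> col (2 + ?C p) = col 0)"
        using \<alpha>[OF ab c cl] yp(3) unfolding yp(2) col'[OF c] by (auto simp: y_def)
    qed
    then show "\<exists>col. ?good col" by blast
  qed
  then show ?thesis unfolding good[symmetric] P_def[symmetric] M_def[symmetric] .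
qed

definition sat_subjects :: "nat \<Rightarrow> (nat \<Rightarrow> nat \<Rightarrow> nat \<Rightarrow> bool) \<Rightarrow> (nat \<times> nat) list" where
  "sat_subjects h Cl = cut_subjects (2 * sat_half h) (3 * (3 * sat_half h))
     (tri_u (sat_triangle (2 * h) Cl)) (tri_v (sat_triangle (2 * h) Cl))"

definition sat_bound :: "nat \<Rightarrow> nat" where
  "sat_bound h = cut_bound (2 * sat_half h) (3 * (3 * sat_half h)) (2 * (3 * sat_half h))"

lemma edge_yes_satisfiable:
  "edge_yes (Suc (2 * sat_half h)) (sat_subjects h Cl) (sat_bound h) \<longleftrightarrow> satisfiable (2 * h) Cl"
  unfolding sat_subjects_def sat_bound_def satisfiable_triangles[symmetric]
  by (rule edge_yes_triangles) (simp_all add: sat_triangle_less, simp add: sat_half_def)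

section \<open>Writing down the instance\<close>

definition edge_word :: "nat \<Rightarrow> (nat \<times> nat) list \<Rightarrow> nat \<Rightarrow> bool list" where
  "edge_word c L k = enc_instance (length L) c [\<lambda>s. fst (L ! s), \<lambda>s. snd (L ! s)] (int k)"

lemma panel_crossing_yes_cong:
  assumes "list_all2 (\<lambda>t t'. \<forall>s<n. t s = t' s) T T'"
  shows "panel_crossing_yes {..<n} C T k \<longleftrightarrow> panel_crossing_yes {..<n} C T' k"
proof -
  have len: "length T = length T'" using assms by (rule list_all2_lengthD)
  have "(T ! j) s = (T' ! j) s" if "j < length T" "s < n" for j s
    using assms that by (auto dest: list_all2_nthD)
  then have "layout {..<n} T \<sigma> \<pi> = layout {..<n} T' \<sigma> \<pi>" for \<sigma> \<pi>
    unfolding layout_def len[symmetric] by auto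
  then show ?thesis unfolding panel_crossing_yes_def pcr_def by simp
qed

text \<open>Membership only yields some instance with the same encoding; by injectivity its tests
  agree with the given ones on all subjects, which is all that layouts depend on.\<close>

lemma edge_word_panel_language:
  assumes "A 2" "\<And>e. e \<in> set L \<Longrightarrow> fst e < c \<and> snd e < c"
  shows "edge_word c L k \<in> panel_language A \<longleftrightarrow> edge_yes c L k"
proof
  assume "edge_word c L k \<in> panel_language A"
  then show "edge_yes c L k"
    unfolding edge_word_def panel_language_def edge_yes_def mem_Collect_eq enc_instance_inj
    using panel_crossing_yes_cong by blast
next
  assume "edge_yes c L k"
  moreover have "panel_data {..<length L} {..<c} [\<lambda>s. fst (L ! s), \<lambda>s. snd (L ! s)]"
    using assms(2)[OF nth_mem] by (auto simp: panel_data_def)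
  moreover have "A (length [\<lambda>s. fst (L ! s), \<lambda>s. snd (L ! s)])"
    using assms(1) by (simp add: numeral_2_eq_2)
  ultimately show "edge_word c L k \<in> panel_language A"
    unfolding edge_word_def panel_language_def edge_yes_def by blast
qed

text \<open>A list of pairs is characterised by its use: every expressible word in the two
  components may be written out along the list. This covers the number of subjects, their sources
  and their targets without representing the list itself.\<close>

definition pq :: "(bool list \<Rightarrow> env \<Rightarrow> (nat \<times> nat) list) \<Rightarrow> bool" where
  "pq L \<longleftrightarrow> (\<forall>g. pl (\<lambda>x e. g (vh e) (vh (vt e))) \<longrightarrow> pl (\<lambda>x e. concat (map (\<lambda>(a, b). g a b) (L x e))))"

lemma pq_Nil: "pq (\<lambda>x e. [])"
  by (simp add: pq_def pl_Nil)

lemma pq_append: "pq F \<Longrightarrow> pq G \<Longrightarrow> pq (\<lambda>x e. F x e @ G x e)"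
  by (simp add: pq_def pl_append)

lemma pq_if:
  assumes "pp P" "pq F" "pq G"
  shows "pq (\<lambda>x e. if P x e then F x e else G x e)"
  unfolding pq_def
proof (intro allI impI)
  fix g :: "nat \<Rightarrow> nat \<Rightarrow> bool list" assume g: "pl (\<lambda>x e. g (vh e) (vh (vt e)))"
  have "pl (\<lambda>x e. if P x e then concat (map (\<lambda>(a, b). g a b) (F x e)) else concat (map (\<lambda>(a, b). g a b) (G x e)))"
    using assms g by (intro pl_if) (auto simp: pq_def)
  then show "pl (\<lambda>x e. concat (map (\<lambda>(a, b). g a b) (if P x e then F x e else G x e)))"
    by (simp add: if_distrib)
qed

lemma pq_single:
  assumes "pt f" "pt g"
  shows "pq (\<lambda>x e. [(f x e, g x e)])"
  unfolding pq_def
proof (intro allI impI)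
  fix G :: "nat \<Rightarrow> nat \<Rightarrow> bool list" assume G: "pl (\<lambda>x e. G (vh e) (vh (vt e)))"
  from pl_comp_env[OF G pe_case_nat[OF assms(1) pe_case_nat[OF assms(2) pe_id]]]
  show "pl (\<lambda>x e. concat (map (\<lambda>(a, b). G a b) [(f x e, g x e)]))" by simp
qed

lemma concat_map_concat: "concat (map h (concat (map G xs))) = concat (map (\<lambda>i. concat (map h (G i))) xs)"
  by (induction xs) auto

lemma pq_concat:
  assumes "pt n" "pq (\<lambda>x e. G x (vt e) (vh e))"
  shows "pq (\<lambda>x e. concat (map (G x e) [0..<n x e]))"
  using assms unfolding pq_def concat_map_concat by (auto intro!: pl_concat)

text \<open>Even the unary length is written as one \<open>True\<close> per edge, so that every part
  depending on \<open>L\<close> has the form treated by \<open>pq\<close>.\<close>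

lemma edge_word_concat:
  "edge_word c L k = (concat (map (\<lambda>(a, b). [True]) L) @ [False]) @ enc_unary c @ enc_unary 2 @
     (concat (map (\<lambda>(a, b). enc_nat a) L) @ concat (map (\<lambda>(a, b). enc_nat b) L)) @ False # enc_nat k"
proof -
  have "concat (map (\<lambda>s. enc_nat (f (L ! s))) [0..<length L]) = concat (map (\<lambda>e. enc_nat (f e)) L)" for f
    by (rule arg_cong[where f = concat]) (auto intro: nth_equalityI)
  moreover have "concat (map (\<lambda>(a, b). [True]) L) = replicate (length L) True"
    by (induction L) auto
  ultimately show ?thesis
    by (simp add: edge_word_def enc_instance_def enc_unary_def enc_test_def enc_int_def split_def
        numeral_2_eq_2)
qed

lemma pl_edge_word:
  assumes "pt c" "pq L" "pt k"
  shows "pl (\<lambda>x e. edge_word (c x e) (L x e) (k x e))"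
proof -
  have "pl (\<lambda>x e. concat (map (\<lambda>(a, b). g a b) (L x e)))" if "pl (\<lambda>x e. g (vh e) (vh (vt e)))" for g
    using assms(2) that unfolding pq_def by blast
  note L = this[of "\<lambda>a b. [True]", OF pl_single[OF pp_const]]
    this[of "\<lambda>a b. enc_nat a", OF pl_enc_nat[OF pt_var[OF pv_id]]]
    this[of "\<lambda>a b. enc_nat b", OF pl_enc_nat[OF pt_var[OF pv_vt[OF pv_id]]]]
  show ?thesis
    unfolding edge_word_concat
    by (intro pl_append pl_Cons pl_Nil L pl_enc_unary pl_enc_nat pp_const pt_const assms)
qed

lemma pl_sat_word:
  assumes h: "pt (\<lambda>x e. h x)" and Cl: "pp (\<lambda>x e. Cl x (vh (vt (vt e))) (vh (vt e)) (vh e))"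
  shows "pl (\<lambda>x e. edge_word (Suc (2 * sat_half (h x))) (sat_subjects (h x) (Cl x)) (sat_bound (h x)))"
proof -
  have Cl': "pp (\<lambda>x e. Cl x (f x e) (g x e) (k x e))" if "pt f" "pt g" "pt k" for f g k
    using pp_comp_env[OF Cl pe_case_nat[OF that(3) pe_case_nat[OF that(2) pe_case_nat[OF that(1) pe_id]]]]
    by simp
  have half: "pt (\<lambda>x e. sat_half (h x))"
    unfolding sat_half_def by (intro pt_add pt_mult pt_const h)
  have tri: "pt (\<lambda>x e. sat_triangle (2 * h x) (Cl x) (f x e) (g x e))" if "pt f" "pt g" for f g
    unfolding sat_triangle_def is_clause_def
    by (intro pt_if pp_eq pt_mod pt_div pt_add pt_mult pt_const pp_not pp_conj pp_less Cl' h that)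
  have uv: "pt (\<lambda>x e. tri_u (sat_triangle (2 * h x) (Cl x)) (f x e))"
    "pt (\<lambda>x e. tri_v (sat_triangle (2 * h x) (Cl x)) (f x e))" if "pt f" for f
    unfolding tri_u_def tri_v_def
    by (intro tri pt_if pp_eq pt_mod pt_div pt_const that)+
  have "pt (\<lambda>x e. sat_bound (h x))"
    unfolding sat_bound_def cut_bound_def weight_def
    by (intro pt_add pt_sub pt_mult pt_const half)
  moreover have "pq (\<lambda>x e. sat_subjects (h x) (Cl x))"
    unfolding sat_subjects_def cut_subjects_def vertex_loops_def centre_loops_def spokes_def
      co_edges_def weight_def
    by (intro pq_append pq_concat pq_if pq_Nil pq_single uv pp_conj pp_eq pt_add pt_mult pt_const
        half pt_var pv_id pv_vt)
  ultimately show ?thesis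
    by (intro pl_edge_word pt_Suc pt_mult pt_const half)
qed

section \<open>Tableaux of Turing machines\<close>

text \<open>A tape is seen from its head, so that a step changes only cell \<open>0\<close> and then shifts. A symbol
  \<open>a\<close> becomes \<open>2 * a\<close>, or \<open>2 * a + 1\<close> on the cell whose absolute position is \<open>0\<close>, where the
  output is read in the end.\<close>

fun rel_tape :: "tape \<Rightarrow> int \<Rightarrow> nat" where
  "rel_tape (f, h) p = 2 * f (h + p) + of_bool (h + p = 0)"

text \<open>The list \<open>us\<close> consists of the state and the symbols under the heads.\<close>

definition tm_move :: "tm \<Rightarrow> nat list \<Rightarrow> nat \<Rightarrow> nat \<times> move" where
  "tm_move M us k = (if hd us = tm_states M then (us ! Suc k div 2, Move_Stay)
     else snd (tm_delta M (hd us) (map (\<lambda>e. e div 2) (tl us))) ! k)"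

definition tm_next :: "tm \<Rightarrow> nat list \<Rightarrow> nat" where
  "tm_next M us = (if hd us = tm_states M then hd us
     else fst (tm_delta M (hd us) (map (\<lambda>e. e div 2) (tl us))))"

text \<open>Writing replaces the symbol but keeps the parity, which marks the absolute position
  0.\<close>

definition tm_write :: "tm \<Rightarrow> nat list \<Rightarrow> nat \<Rightarrow> nat" where
  "tm_write M us k = 2 * fst (tm_move M us k) + us ! Suc k mod 2"

text \<open>One more than the movement of the head.\<close>

definition tm_shift :: "tm \<Rightarrow> nat list \<Rightarrow> nat \<Rightarrow> nat" where
  "tm_shift M us k = (case snd (tm_move M us k) of Move_Left \<Rightarrow> 0 | Move_Stay \<Rightarrow> 1 | Move_Right \<Rightarrow> 2)"

section \<open>The run as seen from the heads\<close>

definition run :: "tm \<Rightarrow> bool list \<Rightarrow> nat \<Rightarrow> config" where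
  "run M z t = (tm_step M ^^ t) (tm_init M z)"

definition run_cell :: "tm \<Rightarrow> bool list \<Rightarrow> nat \<Rightarrow> nat \<Rightarrow> int \<Rightarrow> nat" where
  "run_cell M z t k = rel_tape (snd (run M z t) ! k)"

text \<open>The symbols under the first \<open>k\<close> heads only: these partial lists let a
  clause add a single symbol.\<close>

definition run_read :: "tm \<Rightarrow> bool list \<Rightarrow> nat \<Rightarrow> nat \<Rightarrow> nat list" where
  "run_read M z t k = fst (run M z t) # map (\<lambda>j. run_cell M z t j 0) [0..<k]"

lemma rel_tape_act:
  "rel_tape (tape_act (a, d) t) p =
     (let q = p + (case d of Move_Left \<Rightarrow> -1 | Move_Stay \<Rightarrow> 0 | Move_Right \<Rightarrow> 1) in
      if q = 0 then 2 * a + rel_tape t 0 mod 2 else rel_tape t q)"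
  by (cases t; cases d) (auto simp: Let_def algebra_simps)

text \<open>The bound on the head positions guarantees that absolute cell 0, where the output is,
  lies within distance \<open>t\<close> of every head at time \<open>t\<close>.\<close>

definition config_ok :: "tm \<Rightarrow> nat \<Rightarrow> config \<Rightarrow> bool" where
  "config_ok M t c \<longleftrightarrow> fst c \<le> tm_states M \<and> length (snd c) = tm_tapes M \<and>
     (\<forall>k<tm_tapes M. (\<forall>i. fst (snd c ! k) i < tm_symbols M) \<and> \<bar>snd (snd c ! k)\<bar> \<le> int t)"

lemma rel_tape_0: "rel_tape t 0 div 2 = tape_read t"
  by (cases t) auto

lemma tm_step_move:
  assumes M: "tm_wf M" and c: "config_ok M t c"
  defines "us \<equiv> fst c # map (\<lambda>j. rel_tape (snd c ! j) 0) [0..<tm_tapes M]"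
  shows "fst (tm_step M c) = tm_next M us" and "length (snd (tm_step M c)) = tm_tapes M"
    and "k < tm_tapes M \<Longrightarrow> snd (tm_step M c) ! k = tape_act (tm_move M us k) (snd c ! k)"
    and "tm_next M us \<le> tm_states M" and "k < tm_tapes M \<Longrightarrow> fst (tm_move M us k) < tm_symbols M"
proof -
  obtain q ts where qt: "c = (q, ts)" by (cases c)
  have len: "length ts = tm_tapes M" and q: "q \<le> tm_states M" using c by (simp_all add: config_ok_def qt)
  have as: "map (\<lambda>e. e div 2) (tl us) = map tape_read ts"
    using len by (intro nth_equalityI) (auto simp: us_def qt rel_tape_0)
  have sym: "tape_read (ts ! k) < tm_symbols M" if "k < tm_tapes M" for k
    using c that by (cases "ts ! k") (auto simp: config_ok_def qt dest!: spec[of _ k])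
  have "fst (tm_step M c) = tm_next M us \<and> length (snd (tm_step M c)) = tm_tapes M \<and>
    (\<forall>k<tm_tapes M. snd (tm_step M c) ! k = tape_act (tm_move M us k) (snd c ! k)) \<and>
    tm_next M us \<le> tm_states M \<and> (\<forall>k<tm_tapes M. fst (tm_move M us k) < tm_symbols M)"
  proof (cases "q = tm_states M")
    case True
    have "us ! Suc k div 2 = tape_read (ts ! k)" if "k < tm_tapes M" for k
      using that len by (simp add: us_def qt rel_tape_0)
    then show ?thesis
      using True len sym by (simp add: qt tm_next_def tm_move_def us_def del: tape_act.simps)
  next
    case False
    with q have q: "q < tm_states M" by simp
    have "set (map tape_read ts) \<subseteq> {..<tm_symbols M}"
    proof
      fix a assume "a \<in> set (map tape_read ts)"
      then obtain j where "j < length ts" "a = tape_read (ts ! j)"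
        by (metis in_set_conv_nth length_map nth_map)
      then show "a \<in> {..<tm_symbols M}" using sym len by simp
    qed
    then have wf: "fst (tm_delta M q (map tape_read ts)) \<le> tm_states M"
      "length (snd (tm_delta M q (map tape_read ts))) = tm_tapes M"
      "fst ` set (snd (tm_delta M q (map tape_read ts))) \<subseteq> {..<tm_symbols M}"
      using M q len unfolding tm_wf_def by auto
    have us: "hd us = q" by (simp add: us_def qt)
    have step: "tm_step M c = (fst (tm_delta M q (map tape_read ts)),
        map2 tape_act (snd (tm_delta M q (map tape_read ts))) ts)"
      using False by (simp add: qt Let_def split_def)
    show ?thesis
      using wf len False nth_mem[of _ "snd (tm_delta M q (map tape_read ts))"]
      unfolding step tm_next_def tm_move_def us as by (auto simp: qt image_subset_iff)
  qed
  then show "fst (tm_step M c) = tm_next M us" "length (snd (tm_step M c)) = tm_tapes M"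
    "k < tm_tapes M \<Longrightarrow> snd (tm_step M c) ! k = tape_act (tm_move M us k) (snd c ! k)"
    "tm_next M us \<le> tm_states M" "k < tm_tapes M \<Longrightarrow> fst (tm_move M us k) < tm_symbols M"
    by blast+
qed

lemma config_ok_step:
  assumes M: "tm_wf M" and c: "config_ok M t c"
  shows "config_ok M (Suc t) (tm_step M c)"
  unfolding config_ok_def
proof (intro conjI allI impI)
  note st = tm_step_move[OF assms]
  show "fst (tm_step M c) \<le> tm_states M" "length (snd (tm_step M c)) = tm_tapes M"
    using st by simp_all
  fix k assume k: "k < tm_tapes M"
  obtain a d where ad: "tm_move M (fst c # map (\<lambda>j. rel_tape (snd c ! j) 0) [0..<tm_tapes M]) k = (a, d)"
    by force
  obtain f h where fh: "snd c ! k = (f, h)" by force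
  have a: "a < tm_symbols M" using st(5)[OF k] ad by simp
  have f: "f i < tm_symbols M" "\<bar>h\<bar> \<le> int t" for i
    using c k fh by (auto simp: config_ok_def dest!: spec[of _ k])
  show "fst (snd (tm_step M c) ! k) i < tm_symbols M" for i
    unfolding st(3)[OF k] ad fh using a f by simp
  show "\<bar>snd (snd (tm_step M c) ! k)\<bar> \<le> int (Suc t)"
    unfolding st(3)[OF k] ad fh using f(2) by (auto split: move.splits)
qed

lemma config_ok_run:
  assumes M: "tm_wf M"
  shows "config_ok M t (run M z t)"
proof (induction t)
  case 0
  have sym: "3 \<le> tm_symbols M" "2 \<le> tm_tapes M" using M by (auto simp: tm_wf_def)
  then show ?case
    by (auto simp: config_ok_def run_def tm_init_def input_tape_def blank_tape_def bit_symbol_def nth_Cons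
        split: nat.splits)
next
  case (Suc t)
  then show ?case using config_ok_step[OF M] by (simp add: run_def)
qed

text \<open>When the head moves by \<open>d\<close>, the cell at relative position \<open>p\<close>
  is the one that was at \<open>p + d\<close> before. As \<open>tm_shift\<close> is
  \<open>d + 1\<close>, the written cell is the one with \<open>p + tm_shift = 1\<close>.\<close>

lemma run_Suc:
  assumes M: "tm_wf M"
  defines "us \<equiv> \<lambda>z t. run_read M z t (tm_tapes M)"
  shows "fst (run M z (Suc t)) = tm_next M (us z t)"
    and "k < tm_tapes M \<Longrightarrow> run_cell M z (Suc t) k p =
      (if p + int (tm_shift M (us z t) k) = 1 then tm_write M (us z t) k
       else run_cell M z t k (p + int (tm_shift M (us z t) k) - 1))"
proof -
  note st = tm_step_move[OF M config_ok_run[OF M, of t z]]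
  have us: "us z t = fst (run M z t) # map (\<lambda>j. rel_tape (snd (run M z t) ! j) 0) [0..<tm_tapes M]"
    by (simp add: us_def run_read_def run_cell_def)
  have run: "run M z (Suc t) = tm_step M (run M z t)" by (simp add: run_def)
  show "fst (run M z (Suc t)) = tm_next M (us z t)" unfolding run us by (rule st(1))
  assume k: "k < tm_tapes M"
  obtain a d where ad: "tm_move M (us z t) k = (a, d)" by force
  have "us z t ! Suc k = rel_tape (snd (run M z t) ! k) 0" using k by (simp add: us)
  then show "run_cell M z (Suc t) k p =
      (if p + int (tm_shift M (us z t) k) = 1 then tm_write M (us z t) k
       else run_cell M z t k (p + int (tm_shift M (us z t) k) - 1))"
    unfolding run_cell_def run st(3)[OF k] us[symmetric] ad rel_tape_act tm_write_def tm_shift_def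
    by (auto simp: ad Let_def ac_simps split: move.splits)
qed

lemma run_bounds:
  assumes M: "tm_wf M"
  shows "fst (run M z t) \<le> tm_states M" and "k < tm_tapes M \<Longrightarrow> run_cell M z t k p < 2 * tm_symbols M"
proof -
  note ok = config_ok_run[OF M, of t z]
  show "fst (run M z t) \<le> tm_states M" using ok by (simp add: config_ok_def)
  assume k: "k < tm_tapes M"
  obtain f h where fh: "snd (run M z t) ! k = (f, h)" by force
  then have "f (h + p) < tm_symbols M" using ok k by (auto simp: config_ok_def dest!: spec[of _ k])
  then show "run_cell M z t k p < 2 * tm_symbols M"
    by (cases "h + p = 0") (simp_all add: run_cell_def fh)
qed

lemma run_cell_0:
  assumes M: "tm_wf M"
  shows "run_cell M z 0 0 p = of_bool (p = 0) +
      2 * (if 0 \<le> p \<and> p < int (length z) then 1 + of_bool (z ! nat p) else 0)"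
    and "0 < k \<Longrightarrow> k < tm_tapes M \<Longrightarrow> run_cell M z 0 k p = of_bool (p = 0)"
  by (auto simp: run_cell_def run_def tm_init_def input_tape_def blank_tape_def bit_symbol_def nth_Cons
      split: nat.splits)

lemma run_cell_input:
  assumes "tm_wf M"
  shows "run_cell M z 0 0 (int (S + i) - int S) =
    of_bool (i = 0) + 2 * (if i < length z then 1 + of_bool (z ! i) else 0)"
  by (simp add: run_cell_0(1)[OF assms])

lemma run_cell_blank:
  assumes "tm_wf M" "k < tm_tapes M" "\<not> (k = 0 \<and> S \<le> P)"
  shows "run_cell M z 0 k (int P - int S) = of_bool (P = S)"
proof (cases "k = 0")
  case True
  then show ?thesis using assms(3) by (simp add: run_cell_0(1)[OF assms(1)])
next
  case False
  then show ?thesis using assms(2) by (subst run_cell_0(2)[OF assms(1)]) auto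
qed

section \<open>Tableaux as clauses\<close>

text \<open>The variable stands for the state and the first symbols read at time \<open>t\<close>.
  The tag 0 separates it from the cells, whose tag is \<open>Suc k\<close>. The lists come from
  finite sets fixed by the machine, so in expressions \<open>list_encode us\<close> is a
  constant.\<close>

definition var_state :: "nat \<Rightarrow> nat list \<Rightarrow> nat" where
  "var_state t us = prod_encode (0, prod_encode (t, list_encode us))"

definition var_cell :: "nat \<Rightarrow> nat \<Rightarrow> nat \<Rightarrow> nat \<Rightarrow> nat" where
  "var_cell t k P e = prod_encode (Suc k, prod_encode (t, prod_encode (P, e)))"

definition read_lists :: "tm \<Rightarrow> nat \<Rightarrow> nat list set" where
  "read_lists M k = {us. set us \<subseteq> {..<Suc (tm_states M) + 2 * tm_symbols M} \<and> length us = Suc k}"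

text \<open>Nothing is prescribed on the input tape from \<open>n1\<close> up to \<open>n2\<close>,
  where the certificate is guessed. The symbols 1 and 2 of bits appear doubled, with 1 added at
  absolute position 0.\<close>

definition init_cell :: "nat \<Rightarrow> nat \<Rightarrow> nat \<Rightarrow> (nat \<Rightarrow> bool) \<Rightarrow> nat \<Rightarrow> nat \<Rightarrow> nat \<Rightarrow> bool" where
  "init_cell S n1 n2 inp k P e \<longleftrightarrow>
     (0 < k \<or> P < S) \<and> e = of_bool (P = S) \<or> k = 0 \<and> S + n2 \<le> P \<and> e = 0 \<or>
     k = 0 \<and> S \<le> P \<and> P < S + n1 \<and> e = of_bool (P = S) + 2 * (1 + of_bool (inp (P - S)))"

text \<open>Cell \<open>S\<close> of a tape is the one under the head. The input is known up to position \<open>n1\<close> and free,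
  except for being a word followed by blanks, up to position \<open>n2\<close>. Literals \<open>2 * v\<close> are
  positive. A clause is repeated literals where it has fewer than three.\<close>

definition tableau :: "tm \<Rightarrow> nat \<Rightarrow> nat \<Rightarrow> nat \<Rightarrow> nat \<Rightarrow> (nat \<Rightarrow> bool) \<Rightarrow> nat \<Rightarrow> nat \<Rightarrow> nat \<Rightarrow> bool" where
  "tableau M T S n1 n2 inp a b c \<longleftrightarrow>
     a = 2 * var_state 0 [0] \<and> b = a \<and> c = a \<or>
     (\<exists>k\<in>{..<tm_tapes M}. \<exists>e\<in>{..<6}. \<exists>P<Suc (2 * S). init_cell S n1 n2 inp k P e \<and>
        a = 2 * var_cell 0 k P e \<and> b = a \<and> c = a) \<or>
     (\<exists>i<S. n1 \<le> i \<and> i < n2 \<and> a = 2 * var_cell 0 0 (S + i) 0 \<and>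
        b = 2 * var_cell 0 0 (S + i) 2 \<and> c = 2 * var_cell 0 0 (S + i) 4) \<or>
     (\<exists>i<S. n1 \<le> i \<and> i < n2 \<and> a = 2 * var_cell 0 0 (S + i) 0 + 1 \<and>
        b = 2 * var_cell 0 0 (S + Suc i) 0 \<and> c = b) \<or>
     (\<exists>k\<in>{..<tm_tapes M}. \<exists>us\<in>read_lists M k. \<exists>e\<in>{..<2 * tm_symbols M}. \<exists>t<T.
        a = 2 * var_state t us + 1 \<and> b = 2 * var_cell t k S e + 1 \<and> c = 2 * var_state t (us @ [e])) \<or>
     (\<exists>us\<in>read_lists M (tm_tapes M). \<exists>t<T.
        a = 2 * var_state t us + 1 \<and> b = 2 * var_state (Suc t) [tm_next M us] \<and> c = b) \<or>
     (\<exists>us\<in>read_lists M (tm_tapes M). \<exists>k\<in>{..<tm_tapes M}. \<exists>e\<in>{..<2 * tm_symbols M}. \<exists>t<T. \<exists>P<2 * S - 1.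
        P + tm_shift M us k \<noteq> S \<and> a = 2 * var_state t us + 1 \<and>
        b = 2 * var_cell t k (P + tm_shift M us k) e + 1 \<and> c = 2 * var_cell (Suc t) k (Suc P) e) \<or>
     (\<exists>us\<in>read_lists M (tm_tapes M). \<exists>k\<in>{..<tm_tapes M}. \<exists>t<T.
        a = 2 * var_state t us + 1 \<and>
        b = 2 * var_cell (Suc t) k (Suc S - tm_shift M us k) (tm_write M us k) \<and> c = b) \<or>
     (\<exists>P<Suc (2 * S). a = 2 * var_cell T 1 P 3 + 1 \<and> b = a \<and> c = a)"

lemma finite_read_lists: "finite (read_lists M k)"
  unfolding read_lists_def by (rule finite_lists_length_eq) simp

lemma lit_simps [simp]: "lit \<alpha> (2 * v) = \<alpha> v" "lit \<alpha> (Suc (2 * v)) = (\<not> \<alpha> v)"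
  by (simp_all add: lit_def)

lemma run_read_Suc: "run_read M z t (Suc k) = run_read M z t k @ [run_cell M z t k 0]"
  by (simp add: run_read_def)

lemma run_read_lists:
  assumes M: "tm_wf M" and k: "k \<le> tm_tapes M"
  shows "run_read M z t k \<in> read_lists M k"
proof -
  have "run_cell M z t j 0 < Suc (tm_states M) + 2 * tm_symbols M" if "j < k" for j
    using run_bounds(2)[OF M, of j z t 0] that k by simp
  then show ?thesis
    using run_bounds(1)[OF M, of z t] by (auto simp: run_read_def read_lists_def)
qed

section \<open>Runs and satisfying assignments\<close>

definition run_assignment :: "tm \<Rightarrow> nat \<Rightarrow> bool list \<Rightarrow> nat \<Rightarrow> bool" where
  "run_assignment M S z v \<longleftrightarrow> (\<exists>t k. v = var_state t (run_read M z t k)) \<or>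
     (\<exists>t k P. v = var_cell t k P (run_cell M z t k (int P - int S)))"

lemma run_assignment_state:
  "run_assignment M S z (var_state t us) \<longleftrightarrow> (\<exists>k. us = run_read M z t k)"
  by (auto simp: run_assignment_def var_state_def var_cell_def prod_encode_eq list_encode_eq)

lemma run_assignment_cell:
  "run_assignment M S z (var_cell t k P e) \<longleftrightarrow> e = run_cell M z t k (int P - int S)"
  by (auto simp: run_assignment_def var_state_def var_cell_def prod_encode_eq list_encode_eq)

lemma run_assignment_read:
  assumes "us \<in> read_lists M k" "run_assignment M S z (var_state t us)"
  shows "us = run_read M z t k"
  using assms by (auto simp: run_assignment_state read_lists_def run_read_def)

lemma tableau_complete:
  assumes M: "tm_wf M" and n1: "n1 = length (enc_block x)" and n2: "n1 + length w \<le> n2" "n2 \<le> S"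
    and S: "0 < S"
    and acc: "\<And>p. run_cell M (bit_pair x w) T 1 p \<noteq> 3"
    and cl: "tableau M T S n1 n2 (bt (enc_block x)) a b c"
  defines "\<alpha> \<equiv> run_assignment M S (bit_pair x w)"
  shows "lit \<alpha> a \<or> lit \<alpha> b \<or> lit \<alpha> c"
proof -
  define z where "z = bit_pair x w"
  have z: "z = enc_block x @ w" by (simp add: z_def bit_pair_def)
  note cell = run_assignment_cell[of M S z] and state = run_assignment_state[of M S z]
  have \<alpha>: "\<alpha> = run_assignment M S z" by (simp add: \<alpha>_def z_def)
  note in0 = run_cell_input[OF M, of z S]
  have n1': "0 < n1" by (simp add: n1)
  from cl show ?thesis
    unfolding tableau_def
  proof (elim disjE bexE exE conjE)
    assume "a = 2 * var_state 0 [0]"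
    moreover have "run_read M z 0 0 = [0]" by (simp add: run_read_def run_def tm_init_def)
    ultimately show ?thesis by (auto simp: \<alpha> state intro!: exI[of _ 0])
  next
    fix k e P assume k: "k \<in> {..<tm_tapes M}" and P: "init_cell S n1 n2 (bt (enc_block x)) k P e"
      and a: "a = 2 * var_cell 0 k P e"
    have "e = run_cell M z 0 k (int P - int S)"
    proof (cases "k = 0 \<and> S \<le> P")
      case True
      then obtain i where i: "P = S + i" by (auto simp: le_iff_add)
      from P True n1 n2 n1' show ?thesis
        unfolding i using in0[of i] by (auto simp: True init_cell_def z nth_append bt_def)
    next
      case False
      then have "e = of_bool (P = S)" using P by (auto simp: init_cell_def)
      then show ?thesis using run_cell_blank[OF M _ False] k by simp
    qed
    then show ?thesis by (simp add: a \<alpha> cell)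
  next
    fix i assume "n1 \<le> i" and "a = 2 * var_cell 0 0 (S + i) 0" "b = 2 * var_cell 0 0 (S + i) 2"
      "c = 2 * var_cell 0 0 (S + i) 4"
    then show ?thesis using n1' in0[of i] by (auto simp: \<alpha> cell split: if_splits)
  next
    fix i assume "n1 \<le> i" and "a = 2 * var_cell 0 0 (S + i) 0 + 1" "b = 2 * var_cell 0 0 (S + Suc i) 0"
    then show ?thesis using n1' in0[of i] in0[of "Suc i"] by (auto simp: \<alpha> cell split: if_splits)
  next
    fix k us e t assume "k \<in> {..<tm_tapes M}" "us \<in> read_lists M k" and
      l: "a = 2 * var_state t us + 1" "b = 2 * var_cell t k S e + 1" "c = 2 * var_state t (us @ [e])"
    show ?thesis
    proof (rule ccontr)
      assume "\<not> ?thesis"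
      then have *: "\<alpha> (var_state t us)" "\<alpha> (var_cell t k S e)" "\<not> \<alpha> (var_state t (us @ [e]))"
        by (simp_all add: l)
      then have "us = run_read M z t k" "e = run_cell M z t k 0"
        using run_assignment_read[OF \<open>us \<in> read_lists M k\<close>] by (simp_all add: \<alpha> cell)
      then have "us @ [e] = run_read M z t (Suc k)" by (simp add: run_read_Suc)
      with *(3) show False unfolding \<alpha> state by blast
    qed
  next
    fix us t assume us: "us \<in> read_lists M (tm_tapes M)" and
      l: "a = 2 * var_state t us + 1" "b = 2 * var_state (Suc t) [tm_next M us]"
    have "\<alpha> (var_state (Suc t) [tm_next M us])" if "\<alpha> (var_state t us)"
    proof -
      have "us = run_read M z t (tm_tapes M)"
        using run_assignment_read[OF us] that by (simp add: \<alpha>)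
      then have "[tm_next M us] = run_read M z (Suc t) 0"
        using run_Suc(1)[OF M, of z t] by (simp add: run_read_def)
      then show ?thesis unfolding \<alpha> state by blast
    qed
    then show ?thesis by (auto simp: l)
  next
    fix us k e t P assume us: "us \<in> read_lists M (tm_tapes M)" and k: "k \<in> {..<tm_tapes M}"
      and ne: "P + tm_shift M us k \<noteq> S" and l: "a = 2 * var_state t us + 1"
      "b = 2 * var_cell t k (P + tm_shift M us k) e + 1" "c = 2 * var_cell (Suc t) k (Suc P) e"
    have "run_cell M z (Suc t) k (int (Suc P) - int S) =
        run_cell M z t k (int (P + tm_shift M us k) - int S)" if "us = run_read M z t (tm_tapes M)"
    proof -
      have "run_cell M z (Suc t) k (int (Suc P) - int S) =
          run_cell M z t k (int (Suc P) - int S + int (tm_shift M us k) - 1)"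
        using k ne that run_Suc(2)[OF M, of k z t "int (Suc P) - int S"] by auto
      then show ?thesis by (simp add: algebra_simps)
    qed
    then show ?thesis
      using run_assignment_read[OF us, of S z t] unfolding l by (auto simp: \<alpha> cell)
  next
    fix us k t assume us: "us \<in> read_lists M (tm_tapes M)" and k: "k \<in> {..<tm_tapes M}"
      and l: "a = 2 * var_state t us + 1"
      "b = 2 * var_cell (Suc t) k (Suc S - tm_shift M us k) (tm_write M us k)"
    \<comment> \<open>This is where \<open>0 < S\<close> matters: the subtraction in
      \<open>Suc S - tm_shift M us k\<close> is not truncated.\<close>
    have "tm_shift M us k \<le> Suc S" using S by (simp add: tm_shift_def split: move.splits)
    then have "run_cell M z (Suc t) k (int (Suc S - tm_shift M us k) - int S) = tm_write M us k"
      if "us = run_read M z t (tm_tapes M)"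
      using k that run_Suc(2)[OF M, of k z t "int (Suc S - tm_shift M us k) - int S"] by auto
    then show ?thesis
      using run_assignment_read[OF us, of S z t] unfolding l by (auto simp: \<alpha> cell)
  next
    fix P assume "a = 2 * var_cell T 1 P 3 + 1"
    moreover have "\<not> \<alpha> (var_cell T 1 P 3)"
      using acc[of "int P - int S"] unfolding \<alpha> cell z_def[symmetric] by (rule not_sym)
    ultimately show ?thesis by simp
  qed
qed

text \<open>The clauses force every fact about the run on some certificate, up to a distance from
  the head that shrinks by one per step; further variables may be true as well. The unit clauses
  then exclude the code 3, which is the symbol 1 for \<open>False\<close> together with the mark of
  absolute position 0. The margin \<open>2 * T\<close> in \<open>S\<close> leaves a window of radius
  \<open>T\<close> after \<open>T\<close> steps.\<close>

lemma tableau_sound: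
  assumes M: "tm_wf M" and n1: "n1 = length (enc_block x)" and n2: "n1 \<le> n2" "n2 + 2 * T < S"
    and m: "\<And>a b c. tableau M T S n1 n2 (bt (enc_block x)) a b c \<Longrightarrow> lit \<alpha> a \<or> lit \<alpha> b \<or> lit \<alpha> c"
  obtains w where "n1 + length w \<le> n2"
    "\<And>p. \<bar>p\<bar> \<le> int T \<Longrightarrow> run_cell M (bit_pair x w) T 1 p \<noteq> 3"
proof -
  let ?inp = "bt (enc_block x)"
  note m1 = m[unfolded tableau_def, OF disjI1]
    and m2 = m[unfolded tableau_def, OF disjI2, OF disjI1]
    and m3 = m[unfolded tableau_def, OF disjI2, OF disjI2, OF disjI1]
    and m4 = m[unfolded tableau_def, OF disjI2, OF disjI2, OF disjI2, OF disjI1]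
    and m5 = m[unfolded tableau_def, OF disjI2, OF disjI2, OF disjI2, OF disjI2, OF disjI1]
    and m6 = m[unfolded tableau_def, OF disjI2, OF disjI2, OF disjI2, OF disjI2, OF disjI2, OF disjI1]
    and m7 = m[unfolded tableau_def, OF disjI2, OF disjI2, OF disjI2, OF disjI2, OF disjI2,
      OF disjI2, OF disjI1]
    and m8 = m[unfolded tableau_def, OF disjI2, OF disjI2, OF disjI2, OF disjI2, OF disjI2,
      OF disjI2, OF disjI2, OF disjI1]
    and m9 = m[unfolded tableau_def, OF disjI2, OF disjI2, OF disjI2, OF disjI2, OF disjI2,
      OF disjI2, OF disjI2, OF disjI2]
  have K: "0 < tm_tapes M" "1 < tm_tapes M" using M by (auto simp: tm_wf_def)
  have init: "\<alpha> (var_cell 0 k P e)" if "k < tm_tapes M" "e < 6" "P < Suc (2 * S)"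
    "init_cell S n1 n2 ?inp k P e" for k P e
  proof -
    have "lit \<alpha> (2 * var_cell 0 k P e) \<or> lit \<alpha> (2 * var_cell 0 k P e) \<or>
          lit \<alpha> (2 * var_cell 0 k P e)"
      by (rule m2) (use that in blast)
    then show ?thesis by simp
  qed
  let ?blank = "\<lambda>i. \<alpha> (var_cell 0 0 (S + i) 0)"
  have choice: "?blank i \<or> \<alpha> (var_cell 0 0 (S + i) 2) \<or> \<alpha> (var_cell 0 0 (S + i) 4)"
    if "n1 \<le> i" "i < n2" for i
  proof -
    have i: "i < S" using that n2 by simp
    have "lit \<alpha> (2 * var_cell 0 0 (S + i) 0) \<or> lit \<alpha> (2 * var_cell 0 0 (S + i) 2) \<or>
          lit \<alpha> (2 * var_cell 0 0 (S + i) 4)"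
      by (rule m3) (use that i in blast)
    then show ?thesis by simp
  qed
  have propagate: "?blank (Suc i)" if "n1 \<le> i" "i < n2" "?blank i" for i
  proof -
    have i: "i < S" using that n2 by simp
    have "lit \<alpha> (2 * var_cell 0 0 (S + i) 0 + 1) \<or> lit \<alpha> (2 * var_cell 0 0 (S + Suc i) 0) \<or>
          lit \<alpha> (2 * var_cell 0 0 (S + Suc i) 0)"
      by (rule m4) (use that i in blast)
    with that(3) show ?thesis by simp
  qed
  have end_blank: "?blank i" if "n2 \<le> i" "i \<le> S" for i
    using K that by (intro init) (auto simp: init_cell_def)
  \<comment> \<open>The certificate ends at the first position whose blank variable is true; from
    there on propagation and the initial cells make all further cells blank.\<close>
  define l where "l = (LEAST i. n1 \<le> i \<and> ?blank i)"
  have ex: "n1 \<le> n2 \<and> ?blank n2" using n2 end_blank[of n2] by simp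
  have l: "n1 \<le> l" "?blank l" using LeastI[of "\<lambda>i. n1 \<le> i \<and> ?blank i", OF ex] by (simp_all add: l_def)
  have ln2: "l \<le> n2" using Least_le[of "\<lambda>i. n1 \<le> i \<and> ?blank i", OF ex] by (simp add: l_def)
  have before: "\<not> ?blank i" if "n1 \<le> i" "i < l" for i
    using not_less_Least[of i "\<lambda>i. n1 \<le> i \<and> ?blank i"] that by (simp add: l_def)
  have after: "?blank i" if "l \<le> i" "i \<le> n2" for i
    using that
  proof (induction rule: dec_induct)
    case (step i)
    then show ?case using propagate[of i] l(1) by simp
  qed (rule l(2))
  \<comment> \<open>Both bit variables of a cell may be true; the bit is then taken to be
    \<open>True\<close>. If only the other one is true, the clause on the three possible symbols
    guarantees it, as no blank occurs before \<open>l\<close>.\<close>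
  define w where "w = map (\<lambda>i. \<alpha> (var_cell 0 0 (S + (n1 + i)) 4)) [0..<l - n1]"
  define z where "z = bit_pair x w"
  have z: "z = enc_block x @ w" by (simp add: z_def bit_pair_def)
  have lw: "n1 + length w = l" using l(1) by (simp add: w_def)
  have cell0: "\<alpha> (var_cell 0 k P (run_cell M z 0 k (int P - int S)))"
    if k: "k < tm_tapes M" and P: "P \<le> 2 * S" for k P
  proof (cases "k = 0 \<and> S \<le> P")
    case True
    then obtain i where i: "P = S + i" by (auto simp: le_iff_add)
    note in0 = run_cell_input[OF M, of z S i, folded i]
    have "0 < n1" by (simp add: n1)
    consider "i < n1" | "n1 \<le> i" "i < l" | "l \<le> i" by linarith
    then show ?thesis
    proof cases
      case 1
      then have "run_cell M z 0 0 (int P - int S) = of_bool (P = S) + 2 * (1 + of_bool (?inp (P - S)))"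
        unfolding in0 by (simp add: z n1 nth_append bt_def i)
      then show ?thesis
        using 1 True P K by (intro init) (auto simp: init_cell_def i of_bool_def)
    next
      case 2
      then have "z ! i = \<alpha> (var_cell 0 0 (S + i) 4)" "i < length z"
        using lw by (auto simp: z n1 nth_append w_def)
      then have "run_cell M z 0 k (int P - int S) = (if \<alpha> (var_cell 0 0 (S + i) 4) then 4 else 2)"
        using in0 True 2 \<open>0 < n1\<close> by simp
      then show ?thesis
        using 2 True choice[of i] before[of i] ln2 by (auto simp: i)
    next
      case 3
      then have "\<not> i < length z" using lw by (simp add: z n1)
      then have "run_cell M z 0 k (int P - int S) = 0"
        using in0 True 3 l(1) \<open>0 < n1\<close> by simp
      moreover have "?blank i"
        using after[of i] end_blank[of i] 3 P i by (cases "i \<le> n2") auto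
      ultimately show ?thesis using True i by simp
    qed
  next
    case False
    then show ?thesis
      unfolding run_cell_blank[OF M k False] using k P by (intro init) (auto simp: init_cell_def)
  qed
  \<comment> \<open>The known part of a tape loses one cell at either end per step, since the new
    contents of a cell may come from a neighbour.\<close>
  have "\<alpha> (var_state t (run_read M z t 0)) \<and> (\<forall>k<tm_tapes M. \<forall>P. t \<le> P \<and> P + t \<le> 2 * S \<longrightarrow>
      \<alpha> (var_cell t k P (run_cell M z t k (int P - int S))))" if "t \<le> T" for t
    using that
  proof (induction t)
    case 0
    have "lit \<alpha> (2 * var_state 0 [0]) \<or> lit \<alpha> (2 * var_state 0 [0]) \<or>
          lit \<alpha> (2 * var_state 0 [0])"
      by (rule m1) (rule conjI, rule refl, rule conjI, rule refl, rule refl)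
    then have "\<alpha> (var_state 0 [0])" by simp
    moreover have "run_read M z 0 0 = [0]" by (simp add: run_read_def run_def tm_init_def)
    ultimately show ?case using cell0 by simp
  next
    case (Suc t)
    then have t: "t < T" and state: "\<alpha> (var_state t (run_read M z t 0))"
      and cells: "\<And>k P. k < tm_tapes M \<Longrightarrow> t \<le> P \<Longrightarrow> P + t \<le> 2 * S \<Longrightarrow>
        \<alpha> (var_cell t k P (run_cell M z t k (int P - int S)))"
      by simp_all
    have "\<alpha> (var_state t (run_read M z t k))" if "k \<le> tm_tapes M" for k
      using that
    proof (induction k)
      case 0
      show ?case by (rule state)
    next
      case (Suc k)
      let ?us = "run_read M z t k" and ?e = "run_cell M z t k 0"
      have k: "k \<in> {..<tm_tapes M}" "?us \<in> read_lists M k" "?e \<in> {..<2 * tm_symbols M}"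
        using Suc.prems run_read_lists[OF M, of k z t] run_bounds(2)[OF M, of k z t 0] by auto
      have "lit \<alpha> (2 * var_state t ?us + 1) \<or> lit \<alpha> (2 * var_cell t k S ?e + 1) \<or>
          lit \<alpha> (2 * var_state t (?us @ [?e]))"
      by (rule m5) (use k t in blast)
      then have "\<alpha> (var_state t ?us) \<Longrightarrow> \<alpha> (var_cell t k S ?e) \<Longrightarrow> \<alpha> (var_state t (?us @ [?e]))"
        by simp
      moreover have "\<alpha> (var_cell t k S ?e)"
        using cells[of k S] k(1) t n2 by simp
      ultimately show ?case using Suc by (simp add: run_read_Suc)
    qed
    then have full: "\<alpha> (var_state t (run_read M z t (tm_tapes M)))" by simp
    define us where "us = run_read M z t (tm_tapes M)"
    have us: "us \<in> read_lists M (tm_tapes M)" unfolding us_def by (rule run_read_lists[OF M]) simp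
    have "lit \<alpha> (2 * var_state t us + 1) \<or> lit \<alpha> (2 * var_state (Suc t) [tm_next M us]) \<or>
          lit \<alpha> (2 * var_state (Suc t) [tm_next M us])"
      by (rule m6) (use us t in blast)
    then have "\<alpha> (var_state (Suc t) [tm_next M us])" using full by (simp add: us_def)
    then have "\<alpha> (var_state (Suc t) (run_read M z (Suc t) 0))"
      using run_Suc(1)[OF M, of z t] by (simp add: run_read_def us_def)
    moreover have "\<alpha> (var_cell (Suc t) k P (run_cell M z (Suc t) k (int P - int S)))"
      if k: "k < tm_tapes M" and P: "Suc t \<le> P" "P + Suc t \<le> 2 * S" for k P
    proof -
      let ?o = "tm_shift M us k"
      have o: "?o \<le> 2" by (simp add: tm_shift_def split: move.splits)
      have k': "k \<in> {..<tm_tapes M}" using k by simp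
      obtain P' where P': "P = Suc P'" using P(1) by (cases P) auto
      show ?thesis
      proof (cases "P' + ?o = S")
        case True
        then have "int P - int S + int ?o = 1" unfolding P' by linarith
        then have "run_cell M z (Suc t) k (int P - int S) = tm_write M us k"
          using run_Suc(2)[OF M k, of z t "int P - int S"] by (simp add: us_def)
        moreover have "P = Suc S - ?o" using True P' by simp
        moreover have "lit \<alpha> (2 * var_state t us + 1) \<or> lit \<alpha> (2 * var_cell (Suc t) k (Suc S - ?o) (tm_write M us k)) \<or>
          lit \<alpha> (2 * var_cell (Suc t) k (Suc S - ?o) (tm_write M us k))"
      by (rule m8) (use us t k' in blast)
        then have "\<alpha> (var_cell (Suc t) k (Suc S - ?o) (tm_write M us k))"
          using full by (simp add: us_def)
        ultimately show ?thesis by simp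
      next
        case False
        define e where "e = run_cell M z t k (int (P' + ?o) - int S)"
        have "int P - int S + int ?o \<noteq> 1" using False unfolding P' by linarith
        moreover have "int P - int S + int ?o - 1 = int (P' + ?o) - int S" by (simp add: P')
        ultimately have cell: "run_cell M z (Suc t) k (int P - int S) = e"
          using run_Suc(2)[OF M k, of z t "int P - int S", folded us_def] by (simp only: if_False e_def)
        have e: "e \<in> {..<2 * tm_symbols M}"
          using run_bounds(2)[OF M k, of z t] by (simp add: e_def)
        have P'': "P' < 2 * S - 1" using P P' by simp
        have "lit \<alpha> (2 * var_state t us + 1) \<or> lit \<alpha> (2 * var_cell t k (P' + ?o) e + 1) \<or>
          lit \<alpha> (2 * var_cell (Suc t) k (Suc P') e)"
      by (rule m7) (use us t k' e False P'' in blast)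
        then have "\<alpha> (var_cell t k (P' + ?o) e) \<Longrightarrow> \<alpha> (var_cell (Suc t) k (Suc P') e)"
          using full by (simp add: us_def)
        moreover have "\<alpha> (var_cell t k (P' + ?o) e)"
          unfolding e_def using k P P' o by (intro cells) auto
        ultimately have "\<alpha> (var_cell (Suc t) k P e)" by (simp add: P')
        then show ?thesis unfolding cell .
      qed
    qed
    ultimately show ?case by blast
  qed
  then have cells: "\<alpha> (var_cell T 1 P (run_cell M z T 1 (int P - int S)))" if "T \<le> P" "P + T \<le> 2 * S" for P
    using that K by blast
  have "run_cell M z T 1 p \<noteq> 3" if p: "\<bar>p\<bar> \<le> int T" for p
  proof
    assume 3: "run_cell M z T 1 p = 3"
    define P where "P = nat (p + int S)"
    have P: "int P = p + int S" using p n2 by (simp add: P_def)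
    then have "T \<le> P" "P + T \<le> 2 * S" "P < Suc (2 * S)" using p n2 by linarith+
    with cells[of P] have "\<alpha> (var_cell T 1 P 3)" using 3 P by simp
    moreover have "lit \<alpha> (2 * var_cell T 1 P 3 + 1) \<or> lit \<alpha> (2 * var_cell T 1 P 3 + 1) \<or>
          lit \<alpha> (2 * var_cell T 1 P 3 + 1)"
      by (rule m9) (use \<open>P < Suc (2 * S)\<close> in blast)
    then have "\<not> \<alpha> (var_cell T 1 P 3)" by simp
    ultimately show False by blast
  qed
  then show ?thesis using that[of w] lw ln2 by (simp add: z_def)
qed

text \<open>A complete binary tree of pairings of depth 3 with all leaves \<open>s\<close> dominates
  the smaller trees that encode the two kinds of variables, and it is expressible.\<close>

definition var_bound :: "nat \<Rightarrow> nat" where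
  "var_bound s = prod_encode (prod_encode (prod_encode (s, s), prod_encode (s, s)),
     prod_encode (prod_encode (s, s), prod_encode (s, s)))"

lemma prod_encode_mono: "a \<le> a' \<Longrightarrow> b \<le> b' \<Longrightarrow> prod_encode (a, b) \<le> prod_encode (a', b')"
  by (auto simp: prod_encode_def triangle_def intro!: add_mono div_le_mono mult_le_mono)

lemma le_prod_encode: "a \<le> s \<Longrightarrow> a \<le> prod_encode (s, s)"
  using le_prod_encode_1 le_trans by blast

lemma var_cell_le: "Suc k \<le> s \<Longrightarrow> t \<le> s \<Longrightarrow> P \<le> s \<Longrightarrow> e \<le> s \<Longrightarrow> var_cell t k P e \<le> var_bound s"
  unfolding var_cell_def var_bound_def by (intro prod_encode_mono le_prod_encode)

lemma var_state_le: "t \<le> s \<Longrightarrow> list_encode us \<le> s \<Longrightarrow> var_state t us \<le> var_bound s"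
  unfolding var_state_def var_bound_def by (intro prod_encode_mono le_prod_encode) auto

text \<open>Only times and positions vary with the input. All other numbers in a clause belong to a
  finite set determined by \<open>M\<close>, and \<open>C\<close> bounds this set, so one constant
  serves all inputs.\<close>

lemma tableau_less:
  obtains C where "\<And>T S n1 n2 inp a b c. tableau M T S n1 n2 inp a b c \<Longrightarrow> 0 < S \<Longrightarrow>
    a div 2 \<le> var_bound (T + 2 * S + C) \<and> b div 2 \<le> var_bound (T + 2 * S + C) \<and>
    c div 2 \<le> var_bound (T + 2 * S + C)"
proof -
  define U where "U = (\<Union>k\<le>Suc (tm_tapes M). read_lists M k)"
  define F where "F = list_encode ` U \<union> (\<lambda>us. list_encode [tm_next M us]) ` U \<union>
    (\<lambda>(us, k). tm_write M us k) ` (U \<times> {..<tm_tapes M}) \<union>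
    {list_encode [0], 6, 2 * tm_symbols M, Suc (tm_tapes M)}"
  have "finite U" by (simp add: U_def finite_read_lists)
  then have "finite F" by (simp add: F_def)
  then obtain C where C: "\<And>v. v \<in> F \<Longrightarrow> v \<le> C"
    unfolding finite_nat_set_iff_bounded_le by blast
  have c: "list_encode [0] \<le> C" "6 \<le> C" "2 * tm_symbols M \<le> C" "Suc (tm_tapes M) \<le> C"
    by (rule C, simp add: F_def)+
  have U: "us \<in> U" if "us \<in> read_lists M k" "k \<le> Suc (tm_tapes M)" for us k
    using that by (auto simp: U_def)
  have us: "list_encode us \<le> C" "list_encode [tm_next M us] \<le> C" if "us \<in> U" for us
    by (rule C, use that in \<open>simp add: F_def\<close>)+
  have wr: "tm_write M us k \<le> C" if "us \<in> U" "k < tm_tapes M" for us k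
    by (rule C) (use that in \<open>force simp: F_def\<close>)
  have shift: "tm_shift M us k \<le> 2" for us k by (simp add: tm_shift_def split: move.splits)
  have snoc: "us @ [e] \<in> U" if "us \<in> read_lists M k" "e < 2 * tm_symbols M" "k < tm_tapes M" for us e k
    using that by (intro U[of _ "Suc k"]) (auto simp: read_lists_def)
  have "a div 2 \<le> var_bound (T + 2 * S + C) \<and> b div 2 \<le> var_bound (T + 2 * S + C) \<and>
    c div 2 \<le> var_bound (T + 2 * S + C)" if tab: "tableau M T S n1 n2 inp a b c" and "0 < S"
    for T S n1 n2 inp a b c
  proof -
    let ?B = "var_bound (T + 2 * S + C)"
    have cell: "var_cell t k P e \<le> ?B" if "t \<le> T" "k \<le> tm_tapes M \<or> k \<le> 1" "P \<le> 2 * S" "e \<le> C" for t k P e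
      using that c by (intro var_cell_le) auto
    have state: "var_state t us \<le> ?B" if "t \<le> T" "list_encode us \<le> C" for t us
      using that by (intro var_state_le) auto
    have le: "P + tm_shift M us k \<le> 2 * S" if "P < 2 * S - 1" for P us k
      using that shift[of us k] by simp
    note bounds = cell state us wr snoc U[of _ "tm_tapes M"] U[of _ k for k] le
    from tab show ?thesis
      unfolding tableau_def using c \<open>0 < S\<close>
      by (elim disjE bexE exE conjE; simp add: bounds del: list_encode.simps; (intro conjI bounds)?; auto intro: bounds)
  qed
  then show ?thesis using that by blast
qed

lemma pp_tableau:
  assumes "pt (\<lambda>x e. T x)" "pt (\<lambda>x e. S x)" "pt (\<lambda>x e. n1 x)" "pt (\<lambda>x e. n2 x)"
  shows "pp (\<lambda>x e. tableau M (T x) (S x) (n1 x) (n2 x) (bt (enc_block x)) (vh (vt (vt e))) (vh (vt e)) (vh e))"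
proof -
  have "pl (\<lambda>x e. x)"
    by (simp add: pl_def pt_len pp_bt pt_var pv_id)
  then have inp: "pp (\<lambda>x e. bt (enc_block x) (f x e))" if "pt f" for f
    using that by (intro pp_nth pl_enc_block)
  show ?thesis
    unfolding tableau_def init_cell_def var_state_def var_cell_def
    by (intro pp_disj pp_conj pp_eq pp_ex pp_bex finite_read_lists finite_lessThan pp_less pp_le pp_not inp
        pt_mult pt_add pt_Suc pt_sub pt_const pt_prod_encode pt_of_bool pt_var pv_vt pv_id assms)
qed

section \<open>NP-completeness\<close>

lemma run_halted:
  assumes "tm_computes_within M f (poly q)" "poly q (length z) \<le> t"
  shows "tape_holds (snd (run M z t) ! 1) (f z)"
proof -
  have halts: "case (tm_step M ^^ poly q (length z)) (tm_init M z) of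
      (q', ts) \<Rightarrow> q' = tm_states M \<and> tape_holds (ts ! 1) (f z)"
    using assms(1) unfolding tm_computes_within_def by (rule spec)
  obtain q' ts where run: "(tm_step M ^^ poly q (length z)) (tm_init M z) = (q', ts)"
    by (rule prod.exhaust)
  from halts have "q' = tm_states M" "tape_holds (ts ! 1) (f z)"
    unfolding run by simp_all
  then show ?thesis
    using tm_step_halted_mono[OF run[unfolded \<open>q' = tm_states M\<close>] assms(2)]
    unfolding run_def by (simp only: snd_conv)
qed

lemma NP_hard_panel_language:
  assumes "A 2"
  shows "NP_hard (panel_language A)"
  unfolding NP_hard_def
proof
  fix L assume "L \<in> class_NP"
  then obtain R p where R: "R \<in> class_P"
    and L: "\<forall>x. x \<in> L \<longleftrightarrow> (\<exists>w. length w \<le> poly p (length x) \<and> bit_pair x w \<in> R)"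
    unfolding class_NP_def by (elim CollectE bexE exE) (rule that)
  obtain M q where M: "tm_wf M" and comp: "tm_computes_within M (\<lambda>z. [z \<in> R]) (poly q)"
    using R unfolding class_P_def poly_time_def by (elim CollectE exE conjE) (rule that)
  \<comment> \<open>\<open>n2\<close> is the greatest length of a pair formed with an admissible
    certificate. By monotonicity \<open>T\<close> bounds the running time on all these pairs, so the
    output may be inspected at time \<open>T\<close> for each of them. \<open>S\<close> leaves the
    margin demanded by \<open>tableau_sound\<close>.\<close>
  define n1 n2 T S where "n1 x = length (enc_block x)" and "n2 x = n1 x + poly p (length x)"
    and "T x = poly q (n2 x)" and "S x = Suc (n2 x + 2 * T x)" for x :: "bool list"
  obtain C where C: "\<And>T S n1 n2 inp a b c. tableau M T S n1 n2 inp a b c \<Longrightarrow> 0 < S \<Longrightarrow>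
    a div 2 \<le> var_bound (T + 2 * S + C) \<and> b div 2 \<le> var_bound (T + 2 * S + C) \<and>
    c div 2 \<le> var_bound (T + 2 * S + C)"
    by (rule tableau_less[of M], rule that, blast)
  \<comment> \<open>One more than the largest variable, so that all literals lie below
    \<open>2 * h x\<close>.\<close>
  define h where "h x = Suc (var_bound (T x + 2 * S x + C))" for x
  define Cl where "Cl x = tableau M (T x) (S x) (n1 x) (n2 x) (bt (enc_block x))" for x
  define f where "f x = edge_word (Suc (2 * sat_half (h x))) (sat_subjects (h x) (Cl x)) (sat_bound (h x))" for x
  \<comment> \<open>Relative to a head at \<open>i\<close>, absolute cell 0 is at
    \<open>- i\<close>, which is within distance \<open>T x\<close>. No other cell can hold the odd
    code 3, so looking at all cells amounts to looking at the output bit.\<close>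
  have accept: "(\<forall>k. \<bar>k\<bar> \<le> int (T x) \<longrightarrow> run_cell M (bit_pair x w) (T x) 1 k \<noteq> 3) \<longleftrightarrow> bit_pair x w \<in> R"
      "bit_pair x w \<in> R \<Longrightarrow> run_cell M (bit_pair x w) (T x) 1 k \<noteq> 3"
    if "n1 x + length w \<le> n2 x" for x w k
  proof -
    let ?z = "bit_pair x w"
    obtain g i where gi: "snd (run M ?z (T x)) ! 1 = (g, i)" by force
    have "poly q (length ?z) \<le> T x"
      using that by (simp add: T_def n1_def bit_pair_def nat_poly_mono)
    then have "tape_holds (g, i) [?z \<in> R]" using run_halted[OF comp] gi by metis
    then have g: "g 0 = 1 + of_bool (?z \<in> R)" by (auto simp: tape_holds_def bit_symbol_def)
    have "\<bar>i\<bar> \<le> int (T x)"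
      using config_ok_run[OF M, of "T x" ?z] M gi by (auto simp: config_ok_def tm_wf_def dest!: spec[of _ 1])
    moreover have cell: "run_cell M ?z (T x) 1 k = 3 \<longleftrightarrow> k = - i \<and> ?z \<notin> R" for k
    proof -
      have "run_cell M ?z (T x) 1 k = rel_tape (g, i) k" by (simp only: run_cell_def gi)
      moreover have "2 * g (i + k) \<noteq> 3" by presburger
      ultimately show ?thesis using g by (cases "i + k = 0") auto
    qed
    ultimately show "(\<forall>k. \<bar>k\<bar> \<le> int (T x) \<longrightarrow> run_cell M ?z (T x) 1 k \<noteq> 3) \<longleftrightarrow> ?z \<in> R"
      unfolding cell by (auto dest: spec[of _ "- i"])
    show "?z \<in> R \<Longrightarrow> run_cell M ?z (T x) 1 k \<noteq> 3" unfolding cell by blast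
  qed
  have sat: "satisfiable (2 * h x) (Cl x) \<longleftrightarrow> x \<in> L" for x
  proof
    assume "satisfiable (2 * h x) (Cl x)"
    then obtain \<alpha> where \<alpha>: "\<And>a b c. a < 2 * h x \<Longrightarrow> b < 2 * h x \<Longrightarrow> c < 2 * h x \<Longrightarrow> Cl x a b c \<Longrightarrow>
        lit \<alpha> a \<or> lit \<alpha> b \<or> lit \<alpha> c"
      unfolding satisfiable_def by blast
    have div2: "v < 2 * u" if "v div 2 < u" for v u :: nat using that by arith
    have m: "lit \<alpha> a \<or> lit \<alpha> b \<or> lit \<alpha> c"
      if "tableau M (T x) (S x) (n1 x) (n2 x) (bt (enc_block x)) a b c" for a b c
      using C[OF that] that by (intro \<alpha> div2) (simp_all add: h_def Cl_def S_def less_Suc_eq_le)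
    have "n1 x \<le> n2 x" "n2 x + 2 * T x < S x" by (simp_all add: n2_def S_def)
    then obtain w where w: "n1 x + length w \<le> n2 x"
      "\<And>p. \<bar>p\<bar> \<le> int (T x) \<Longrightarrow> run_cell M (bit_pair x w) (T x) 1 p \<noteq> 3"
      using tableau_sound[OF M n1_def _ _ m] by metis
    then have "bit_pair x w \<in> R" using accept(1)[OF w(1)] by blast
    moreover have "length w \<le> poly p (length x)" using w(1) by (simp add: n2_def)
    ultimately show "x \<in> L" using L by blast
  next
    assume "x \<in> L"
    then obtain w where "length w \<le> poly p (length x)" and R: "bit_pair x w \<in> R" using L by blast
    then have w: "n1 x + length w \<le> n2 x" by (simp add: n2_def)
    show "satisfiable (2 * h x) (Cl x)"
      unfolding satisfiable_def Cl_def
      using tableau_complete[OF M n1_def w _ _ accept(2)[OF w R]]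
      by (intro exI[of _ "run_assignment M (S x) (bit_pair x w)"]) (auto simp: S_def)
  qed
  have n1: "pt (\<lambda>x e. n1 x)"
    unfolding n1_def length_enc_block by (intro pt_add pt_mult pt_const pt_len)
  have n2: "pt (\<lambda>x e. n2 x)" unfolding n2_def by (intro pt_add pt_poly pt_len n1)
  have T: "pt (\<lambda>x e. T x)" unfolding T_def by (intro pt_poly n2)
  have S: "pt (\<lambda>x e. S x)" unfolding S_def by (intro pt_Suc pt_add pt_mult pt_const n2 T)
  have "pt (\<lambda>x e. h x)"
    unfolding h_def var_bound_def by (intro pt_Suc pt_prod_encode pt_add pt_mult pt_const T S)
  moreover have "pp (\<lambda>x e. Cl x (vh (vt (vt e))) (vh (vt e)) (vh e))"
    unfolding Cl_def by (rule pp_tableau[OF T S n1 n2])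
  ultimately have "poly_time f"
    unfolding f_def by (intro pl_poly_time pl_sat_word)
  moreover have "x \<in> L \<longleftrightarrow> f x \<in> panel_language A" for x
  proof -
    have "f x \<in> panel_language A \<longleftrightarrow> edge_yes (Suc (2 * sat_half (h x))) (sat_subjects (h x) (Cl x)) (sat_bound (h x))"
      unfolding f_def by (rule edge_word_panel_language[of A, OF assms])
        (unfold sat_subjects_def, rule cut_subjects_range)
    then show ?thesis unfolding edge_yes_satisfiable sat by blast
  qed
  ultimately show "poly_reducible L (panel_language A)"
    unfolding poly_reducible_def by blast
qed

theorem theorem6:
  shows "NP_complete Panel_Crossing_Minimization \<and>
         NP_complete (Panel_Crossing_Minimization_tests 2)"
proof -
  have "Panel_Crossing_Minimization = panel_language (\<lambda>_. True)"
    "Panel_Crossing_Minimization_tests 2 = panel_language (\<lambda>m. m \<le> 2)"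
    unfolding Panel_Crossing_Minimization_def Panel_Crossing_Minimization_tests_def panel_language_def
    by simp_all
  moreover have "panel_language (\<lambda>_. True) \<in> class_NP"
    by (intro panel_language_NP pp_const)
  moreover have "panel_language (\<lambda>m. m \<le> 2) \<in> class_NP"
    by (intro panel_language_NP pp_le pt_var pv_id pt_const)
  ultimately show ?thesis
    using NP_hard_panel_language[of "\<lambda>_. True"] NP_hard_panel_language[of "\<lambda>m. m \<le> 2"]
    unfolding NP_complete_def by simp
qed

end
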